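(* (Log-linear model.) Consider a finite POMDP with log-linear models as in part (A) of the context, with $\kappa_P,\kappa_\Phi\in(0,1]$ and $\alpha:=(1-\kappa_P)(4-3\kappa_\Phi)<1$, and the reward/preference model of part (C). Let $\Theta=(\theta,w)$ with $\|\Theta-\Theta^\star\|_2\le r_\Theta$, let $\{(Y_i^{(1)},Y_i^{(2)},y_i)\}_{i=1}^{N_{\mathrm{HF}}}$ be $N_{\mathrm{HF}}$ independent preference comparisons, let $\tilde\phi_i$ be the perturbed trajectory feature differences computed from the beliefs $b^{(j),\Theta}_{i,h}$, let $\tilde\Sigma=\frac1{N_{\mathrm{HF}}}\sum_i\tilde\phi_i\tilde\phi_i^\top$, and let $\tilde\mu$ be the constrained Bradley–Terry maximum likelihood estimator $$\tilde\mu\in\arg\min_{\|\mu\|_2\le r_\mu}\Big\{-\sum_{i=1}^{N_{\mathrm{HF}}}\big[y_i\log\sigma(\tilde\phi_i^\top\mu)+(1-y_i)\log(1-\sigma(\tilde\phi_i^\top\mu))\big]\Big\}.$$ Fix $\delta_b,\delta_c\in(0,1)$ and any $c_\zeta>1$. Write $\epsilon_b:=\epsilon_b(\delta_b,2N_{\mathrm{HF}})$ (defined in the context) and set $$\zeta:=16\,c_\zeta T^2B_r^2\,\epsilon_b(1+\epsilon_b),\qquad \rho:=\frac{1}{2+\exp(2TB_rr_\mu)+\exp(-2TB_rr_\mu)}.$$ Then with probability at least $1-(\delta_b+\delta_c)$, $$\|\tilde\mu-\mu^\star\|_{\tilde\Sigma+\zeta I}\le\frac{2\sqrt{c_\zeta}}{\rho\sqrt{N_{\mathrm{HF}}(c_\zeta-1)}}\sqrt{d\log\Big(1+\frac{4T^2B_r^2}{\zeta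 d}\Big)+2\log\Big(\frac1{\delta_c}\Big)}+\frac{8TB_r\,\epsilon_b}{\rho\sqrt\zeta}\Big(1+\tfrac12TB_rr_\mu\Big)+2r_\mu\sqrt\zeta .$$ (Neural-softmax model.) The same conclusion holds for the neural-softmax POMDP model of part (B) (with $\alpha_{\mathrm{NN}}:=(1-\kappa_P^{\mathrm{NN}})(4-3\kappa_\Phi^{\mathrm{NN}})<1$, $W,W^\star\in\mathcal D$, $W^\star$ the true parameter): additionally fixing $\delta_{\mathrm{NN}}\in(0,1)$, with probability at least $1-(\delta_b+\delta_c+\delta_{\mathrm{NN}})$ the displayed bound holds after replacing the beliefs $b^{(j),\Theta}_{i,h},b^{(j),\Theta^\star}_{i,h}$ by $b^{(j),W}_{i,h},b^{(j),W^\star}_{i,h}$ and replacing $\epsilon_b(\delta_b,2N_{\mathrm{HF}})$ everywhere, including in the definition of $\zeta$, by $\epsilon_b^{\mathrm{NN}}(\delta_b,2N_{\mathrm{HF}},\delta_{\mathrm{NN}})$.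
   Context: Common notation. $\mathbb S$ (latent states), $\hat{\mathbb S}$ (observations), $\mathbb A$ (actions) are finite nonempty sets; $\Delta_X$ is the set of probability vectors on $X$; $\|\mu-\nu\|_{\mathrm{TV}}=\frac12\|\mu-\nu\|_1$; $\|v\|_M=\sqrt{v^\top Mv}$; $\sigma(z)=1/(1+e^{-z})$; $\nu_0\in\Delta_{\mathbb S}$ is the known initial distribution. For a transition kernel $P$ and observation model $\Phi$, the belief process along a history is $b_0=\nu_0$, $b_{k+1}(s')\propto\Phi(\hat s_{k+1}\mid s')\sum_sP(s'\mid s,a_k)b_k(s)$, normalized over $s'\in\mathbb S$; superscript $\Theta$ means $(P_\theta,\Phi_w)$ is used, superscript $W$ means $(P_{W_p},\Phi_{W_\Phi})$. (A) Log-linear model. For $\theta\in\mathbb R^{d_\theta}$, $w\in\mathbb R^{d_w}$, $$P_\theta(s'\mid s,a)=\frac{\exp\{\theta^\top\phi_p(s,a,s')\}}{\sum_{\bar s\in\mathbb S}\exp\{\theta^\top\phi_p(s,a,\bar s)\}},\qquad \Phi_w(\hat s\mid s)=\frac{\exp\{w^\top\phi_\Phi(s,\hat s)\}}{\sum_{\bar s\in\hat{\mathbb S}}\exp\{w^\top\phi_\Phi(s,\bar s)\}},$$ with $\|\phi_p\|_2\le B$, $\|\phi_\Phi\|_2\le B$ uniformly, $B<\infty$; $1>\nu_{\max}\ge\nu_0(s)\ge\nu_{\min}>0$ for all $s$. True parameter $\Theta^\star=(\theta^\star,w^\star)$; feasible set $\{\Theta:\|\Theta-\Theta^\star\|_2\le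 r_\Theta\}$, $r_\Theta>0$; $\delta(\theta)=\|\theta-\theta^\star\|_2$, $\delta(w)=\|w-w^\star\|_2$. Dobrushin coefficients (infima over feasible $(\theta,w)$): $\kappa_P:=\inf_\theta\inf_{s,s',a}\sum_{x\in\mathbb S}\min\{P_\theta(x\mid s,a),P_\theta(x\mid s',a)\}$, $\kappa_\Phi:=\inf_w\inf_{s,s'}\sum_{\hat s\in\hat{\mathbb S}}\min\{\Phi_w(\hat s\mid s),\Phi_w(\hat s\mid s')\}$. With $c_b:=B\big(\delta(w)+\frac{3-2\kappa_\Phi}2\delta(\theta)\big)$, $$\epsilon_b(\delta_b,2N_{\mathrm{HF}}):=\frac{2c_b}{1-\alpha}+\frac2{1-\alpha}\sqrt{\frac{2c_b\log(2N_{\mathrm{HF}}/\delta_b)}{T}}+\frac{\log(2N_{\mathrm{HF}}/\delta_b)}{T(1-\alpha)}\Big(\frac43+\frac{2\alpha}{1-\alpha}\Big).$$ (B) Neural-softmax model. $\|\cdot\|_F$, $\langle\cdot,\cdot\rangle_F$: Frobenius norm and inner product. Let $m$ be even, $x_p(s,a,s')\in\mathbb R^{d_{x,p}}$, $x_\Phi(s,\hat s)\in\mathbb R^{d_{x,\Phi}}$ fixed encodings. For $W_p=(\omega_{p,i})_{i\le m}$, $W_\Phi=(\omega_{\Phi,i})_{i\le m}$ and fixed signs $c_{p,i},c_{\Phi,i}\in\{-1,1\}$: $F_p(s,a,s';W_p)=\frac1{\sqrt m}\sum_{i=1}^mc_{p,i}\mathrm{ReLU}(\omega_{p,i}^\top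 x_p(s,a,s'))$, $F_\Phi(s,\hat s;W_\Phi)=\frac1{\sqrt m}\sum_{i=1}^mc_{\Phi,i}\mathrm{ReLU}(\omega_{\Phi,i}^\top x_\Phi(s,\hat s))$, $P_{W_p}(s'\mid s,a)=e^{F_p(s,a,s';W_p)}/\sum_{\bar s\in\mathbb S}e^{F_p(s,a,\bar s;W_p)}$, $\Phi_{W_\Phi}(\hat s\mid s)=e^{F_\Phi(s,\hat s;W_\Phi)}/\sum_{\bar s\in\hat{\mathbb S}}e^{F_\Phi(s,\bar s;W_\Phi)}$. Symmetric random initialization: for $g\in\{p,\Phi\}$, $i\le m/2$, independently $c_{g,i}$ Rademacher, $\omega_{g,i,0}\sim\mathcal N(0,I_{d_{x,g}})$; $c_{g,i+m/2}=-c_{g,i}$, $\omega_{g,i+m/2,0}=\omega_{g,i,0}$; $W_{g,0}=(\omega_{g,i,0})_{i\le m}$ (scores vanish at initialization). Tangent features $\phi_p^{\mathrm{NN}}:=\nabla_{W_p}F_p(\cdot;W_{p,0})$, $\phi_\Phi^{\mathrm{NN}}:=\nabla_{W_\Phi}F_\Phi(\cdot;W_{\Phi,0})$ (fixed convention for $\mathrm{ReLU}'(0)\in[0,1]$), uniformly bounded in Frobenius norm by $B^{\mathrm{NN}}<\infty$. Linearized scores $F^{\mathrm{lin}}_{p,W_p}=F_p(\cdot;W_{p,0})+\langle\phi_p^{\mathrm{NN}},W_p-W_{p,0}\rangle_F$, $F^{\mathrm{lin}}_{\Phi,W_\Phi}=F_\Phi(\cdot;W_{\Phi,0})+\langle\phi_\Phi^{\mathrm{NN}},W_\Phi-W_{\Phi,0}\rangle_F$.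 $\mathcal D=\mathcal D_p\times\mathcal D_\Phi$ is a bounded convex neighborhood of the initialization containing $W^\star=(W_p^\star,W_\Phi^\star)$, whose kernels are those of the true POMDP. $\mathcal E^{\mathrm{NN}}_{\mathrm{lin}}(\delta_{\mathrm{NN}})$ is the event (over the initialization) that $\sup_{W_p\in\mathcal D_p}\sup_{s,a,s'}|F_p(s,a,s';W_p)-F^{\mathrm{lin}}_{p,W_p}(s,a,s')|\le\varepsilon_p^{\mathrm{NN}}(m,\delta_{\mathrm{NN}})$ and $\sup_{W_\Phi\in\mathcal D_\Phi}\sup_{s,\hat s}|F_\Phi(s,\hat s;W_\Phi)-F^{\mathrm{lin}}_{\Phi,W_\Phi}(s,\hat s)|\le\varepsilon_\Phi^{\mathrm{NN}}(m,\delta_{\mathrm{NN}})$; $\mathcal D$ and the levels $\varepsilon^{\mathrm{NN}}_p,\varepsilon^{\mathrm{NN}}_\Phi\ge0$ are such that it has probability at least $1-\delta_{\mathrm{NN}}$. $\kappa_P^{\mathrm{NN}}:=\inf_{W_p\in\mathcal D_p}\inf_{a,s,s''}\sum_{x}\min\{P_{W_p}(x\mid s,a),P_{W_p}(x\mid s'',a)\}$, $\kappa_\Phi^{\mathrm{NN}}:=\inf_{W_\Phi\in\mathcal D_\Phi}\inf_{s,s''}\sum_{\hat s}\min\{\Phi_{W_\Phi}(\hat s\mid s),\Phi_{W_\Phi}(\hat s\mid s'')\}$. With $c_b^{\mathrm{NN}}:=B^{\mathrm{NN}}\|W_\Phi-W_\Phi^\star\|_F+2\varepsilon_\Phi^{\mathrm{NN}}(m,\delta_{\mathrm{NN}})+(3-2\kappa_\Phi^{\mathrm{NN}})\big(\frac{B^{\mathrm{NN}}}2\|W_p-W_p^\star\|_F+\varepsilon_p^{\mathrm{NN}}(m,\delta_{\mathrm{NN}})\big)$,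 the quantity $\epsilon_b^{\mathrm{NN}}(\delta_b,2N_{\mathrm{HF}},\delta_{\mathrm{NN}})$ is given by the formula for $\epsilon_b(\delta_b,2N_{\mathrm{HF}})$ with $(\alpha,c_b)$ replaced by $(\alpha_{\mathrm{NN}},c_b^{\mathrm{NN}})$. (C) Reward and preference model. The reward is $r(s,a)=\phi_r(s,a)^\top\mu^\star$ with $\|\phi_r(s,a)\|_2\le B_r$, $0<B_r<\infty$, and unknown $\mu^\star\in\mathbb R^d$, $\|\mu^\star\|_2\le r_\mu$. Belief features: $\phi_b(b,a):=\sum_sb(s)\phi_r(s,a)$. All trajectories have fixed horizon $T\in\mathbb N$, $T\ge1$. For $i\le N_{\mathrm{HF}}$, $j\in\{1,2\}$ the history is $Y_i^{(j)}=(\hat s^{(j)}_{i,1:T},a^{(j)}_{i,0:T-1})$: the action sequences are treated as given, and the observations are generated by the true POMDP under these actions ($s_0\sim\nu_0$, $s_{k+1}\sim P^{\rm true}(\cdot\mid s_k,a_k)$, $\hat s_k\sim\Phi^{\rm true}(\cdot\mid s_k)$). $b^{(j),\Theta}_{i,h}$ and $b^{(j),\Theta^\star}_{i,h}$ are the beliefs at time $h$ computed on $Y_i^{(j)}$. Define $$\phi_i:=\sum_{h=0}^{T-1}\phi_b(b^{(1),\Theta^\star}_{i,h},a^{(1)}_{i,h})-\sum_{h=0}^{T-1}\phi_b(b^{(2),\Theta^\star}_{i,h},a^{(2)}_{i,h}),\qquad \tilde\phi_i:=\sum_{h=0}^{T-1}\phi_b(b^{(1),\Theta}_{i,h},a^{(1)}_{i,h})-\sum_{h=0}^{T-1}\phi_b(b^{(2),\Theta}_{i,h},a^{(2)}_{i,h}).$$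 The comparisons are independent over $i$, the labels $y_i\in\{0,1\}$ are conditionally independent given the clean feature differences, and $\mathbb P(y_i=1\mid\phi_i)=\sigma(\phi_i^\top\mu^\star)$. *)

theory Defs
  imports "HOL-Probability.Probability"
begin

text \<open>Conventions: a transition kernel is written \<open>P s a s'\<close> for \<open>P(s' | s, a)\<close>, an observation
  model \<open>Q s x\<close> for \<open>\<Phi>(x | s)\<close>. An action sequence is \<open>a 0, a 1, \<dots>\<close>; an observation sequence is
  \<open>x 1, x 2, \<dots>\<close> (the value \<open>x 0\<close> is never used).\<close>

type_synonym ('s, 'a) trans = "'s \<Rightarrow> 'a \<Rightarrow> 's \<Rightarrow> real"
type_synonym ('s, 'x) emission = "'s \<Rightarrow> 'x \<Rightarrow> real"


subsection \<open>Probabilistic vocabulary\<close>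

text \<open>Inner probability: no measurability of \<open>{\<omega>. Q \<omega>}\<close> itself is presupposed, and for a measurable
  event this is just \<open>measure M {\<omega> \<in> space M. Q \<omega>} \<ge> p\<close> (in a finite measure space).\<close>
definition with_prob_at_least :: "'w measure \<Rightarrow> real \<Rightarrow> ('w \<Rightarrow> bool) \<Rightarrow> bool" where
  "with_prob_at_least M p Q \<longleftrightarrow> (\<exists>A\<in>sets M. (\<forall>\<omega>\<in>A. Q \<omega>) \<and> p \<le> measure M A)"

definition prob_vector :: "('s::finite \<Rightarrow> real) \<Rightarrow> bool" where
  "prob_vector \<nu> \<longleftrightarrow> (\<forall>s. 0 \<le> \<nu> s) \<and> (\<Sum>s\<in>UNIV. \<nu> s) = 1"

definition sigmoid :: "real \<Rightarrow> real" where
  "sigmoid z = 1 / (1 + exp (- z))"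

definition softmax :: "('x::finite \<Rightarrow> real) \<Rightarrow> 'x \<Rightarrow> real" where
  "softmax f x = exp (f x) / (\<Sum>y\<in>UNIV. exp (f y))"


subsection \<open>Finite POMDPs\<close>

fun belief ::
  "('s::finite \<Rightarrow> real) \<Rightarrow> ('s, 'a) trans \<Rightarrow> ('s, 'x) emission \<Rightarrow> (nat \<Rightarrow> 'a) \<Rightarrow> (nat \<Rightarrow> 'x) \<Rightarrow> nat \<Rightarrow> 's \<Rightarrow> real"
where
  "belief \<nu>0 P Q a x 0 = \<nu>0"
| "belief \<nu>0 P Q a x (Suc k) =
     (\<lambda>s'. Q s' (x (Suc k)) * (\<Sum>s\<in>UNIV. P s (a k) s' * belief \<nu>0 P Q a x k s) /
       (\<Sum>s''\<in>UNIV. Q s'' (x (Suc k)) * (\<Sum>s\<in>UNIV. P s (a k) s'' * belief \<nu>0 P Q a x k s)))"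

text \<open>Probability of observing \<open>x 1, \<dots>, x T\<close> under the fixed actions \<open>a 0, \<dots>, a (T - 1)\<close>, when
  \<open>s 0 \<sim> \<nu>0\<close>, \<open>s (k + 1) \<sim> P(\<cdot> | s k, a k)\<close> and \<open>x k \<sim> Q(\<cdot> | s k)\<close>: the latent path is summed out.\<close>
definition obs_prob ::
  "('s::finite \<Rightarrow> real) \<Rightarrow> ('s, 'a) trans \<Rightarrow> ('s, 'x) emission \<Rightarrow> nat \<Rightarrow> (nat \<Rightarrow> 'a) \<Rightarrow> (nat \<Rightarrow> 'x) \<Rightarrow> real"
where
  "obs_prob \<nu>0 P Q T a x =
     (\<Sum>s \<in> {0..T} \<rightarrow>\<^sub>E UNIV.
        \<nu>0 (s 0) * (\<Prod>k<T. P (s k) (a k) (s (Suc k)) * Q (s (Suc k)) (x (Suc k))))"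

text \<open>Dobrushin coefficients of a parametrised family, the parameter ranging over \<open>D\<close>.\<close>
definition kappa_trans :: "('p \<Rightarrow> ('s::finite, 'a::finite) trans) \<Rightarrow> 'p set \<Rightarrow> real" where
  "kappa_trans P D =
     (INF p\<in>D. INF (s, s', a)\<in>UNIV. \<Sum>x\<in>UNIV. min (P p s a x) (P p s' a x))"

definition kappa_obs :: "('p \<Rightarrow> ('s::finite, 'x::finite) emission) \<Rightarrow> 'p set \<Rightarrow> real" where
  "kappa_obs Q D =
     (INF p\<in>D. INF (s, s')\<in>UNIV. \<Sum>x\<in>UNIV. min (Q p s x) (Q p s' x))"

definition contraction :: "real \<Rightarrow> real \<Rightarrow> real" where
  "contraction \<kappa>P \<kappa>Q = (1 - \<kappa>P) * (4 - 3 * \<kappa>Q)"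

definition belief_error :: "real \<Rightarrow> real \<Rightarrow> nat \<Rightarrow> real \<Rightarrow> real \<Rightarrow> real" where
  "belief_error \<alpha> c T \<delta> K =
     2 * c / (1 - \<alpha>)
     + 2 / (1 - \<alpha>) * sqrt (2 * c * ln (K / \<delta>) / real T)
     + ln (K / \<delta>) / (real T * (1 - \<alpha>)) * (4 / 3 + 2 * \<alpha> / (1 - \<alpha>))"


subsection \<open>Log-linear model\<close>

definition loglin_trans ::
  "('s::finite \<Rightarrow> 'a \<Rightarrow> 's \<Rightarrow> real^'dp) \<Rightarrow> real^'dp \<Rightarrow> ('s, 'a) trans" where
  "loglin_trans \<phi> \<theta> s a = softmax (\<lambda>s'. \<theta> \<bullet> \<phi> s a s')"

definition loglin_obs ::
  "('s \<Rightarrow> 'x::finite \<Rightarrow> real^'dw) \<Rightarrow> real^'dw \<Rightarrow> ('s, 'x) emission" where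
  "loglin_obs \<phi> w s = softmax (\<lambda>x. w \<bullet> \<phi> s x)"

definition loglin_cb :: "real \<Rightarrow> real \<Rightarrow> real \<Rightarrow> real \<Rightarrow> real" where
  "loglin_cb B \<kappa>Q \<delta>w \<delta>\<theta> = B * (\<delta>w + (3 - 2 * \<kappa>Q) / 2 * \<delta>\<theta>)"


subsection \<open>Neural-softmax model\<close>

text \<open>A weight matrix \<open>W = (\<omega>\<^sub>i)\<^sub>i\<^sub>\<le>\<^sub>m\<close> is an element of \<open>real^'e^'m\<close> with \<open>m = CARD('m)\<close>; the library norm and
  inner product on this type are the Frobenius ones. For symmetric initialization the index
  type is \<open>'k + 'k\<close>, so that \<open>m = 2 * CARD('k)\<close> is even and \<open>Inl i\<close>, \<open>Inr i\<close> are the units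
  \<open>i\<close> and \<open>i + m/2\<close>.\<close>

definition relu :: "real \<Rightarrow> real" where
  "relu z = max 0 z"

text \<open>\<open>z0\<close> is the convention chosen for the derivative at 0.\<close>
definition relu_deriv :: "real \<Rightarrow> real \<Rightarrow> real" where
  "relu_deriv z0 z = (if z > 0 then 1 else if z < 0 then 0 else z0)"

definition nn_score :: "('m::finite \<Rightarrow> real) \<Rightarrow> real^'e^'m \<Rightarrow> real^'e \<Rightarrow> real" where
  "nn_score c W x = 1 / sqrt (real CARD('m)) * (\<Sum>i\<in>UNIV. c i * relu (W $ i \<bullet> x))"

text \<open>The gradient of \<open>\<lambda>W. nn_score c W x\<close> at \<open>W0\<close>, row by row.\<close>
definition nn_tangent :: "real \<Rightarrow> ('m::finite \<Rightarrow> real) \<Rightarrow> real^'e^'m \<Rightarrow> real^'e \<Rightarrow> real^'e^'m" where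
  "nn_tangent z0 c W0 x =
     (\<chi> i. (1 / sqrt (real CARD('m)) * c i * relu_deriv z0 (W0 $ i \<bullet> x)) *\<^sub>R x)"

definition nn_lin_score ::
  "real \<Rightarrow> ('m::finite \<Rightarrow> real) \<Rightarrow> real^'e^'m \<Rightarrow> real^'e^'m \<Rightarrow> real^'e \<Rightarrow> real" where
  "nn_lin_score z0 c W0 W x = nn_score c W0 x + nn_tangent z0 c W0 x \<bullet> (W - W0)"

definition nn_trans ::
  "('m::finite \<Rightarrow> real) \<Rightarrow> ('s::finite \<Rightarrow> 'a \<Rightarrow> 's \<Rightarrow> real^'e) \<Rightarrow> real^'e^'m \<Rightarrow> ('s, 'a) trans" where
  "nn_trans c e W s a = softmax (\<lambda>s'. nn_score c W (e s a s'))"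

definition nn_obs ::
  "('m::finite \<Rightarrow> real) \<Rightarrow> ('s \<Rightarrow> 'x::finite \<Rightarrow> real^'e) \<Rightarrow> real^'e^'m \<Rightarrow> ('s, 'x) emission" where
  "nn_obs c e W s = softmax (\<lambda>x. nn_score c W (e s x))"

definition nn_cb :: "real \<Rightarrow> real \<Rightarrow> real \<Rightarrow> real \<Rightarrow> real \<Rightarrow> real \<Rightarrow> real" where
  "nn_cb B \<kappa>Q \<delta>Q \<epsilon>Q \<delta>P \<epsilon>P = B * \<delta>Q + 2 * \<epsilon>Q + (3 - 2 * \<kappa>Q) * (B / 2 * \<delta>P + \<epsilon>P)"

text \<open>The independent scalar sources of randomness of the initialization (first half of the
  units only): a sign, respectively a coordinate of the Gaussian weight vector, of a unit of the
  transition network (\<open>P\<close>) or of the observation network (\<open>Q\<close>).\<close>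
datatype ('k, 'ep, 'eq) init_coord = SignP 'k | SignQ 'k | WeightP 'k 'ep | WeightQ 'k 'eq

primrec init_value ::
  "('k + 'k \<Rightarrow> real) \<Rightarrow> ('k + 'k \<Rightarrow> real) \<Rightarrow> real^'ep^('k + 'k) \<Rightarrow> real^'eq^('k + 'k)
    \<Rightarrow> ('k::finite, 'ep::finite, 'eq::finite) init_coord \<Rightarrow> real"
where
  "init_value cP cQ WP WQ (SignP i) = cP (Inl i)"
| "init_value cP cQ WP WQ (SignQ i) = cQ (Inl i)"
| "init_value cP cQ WP WQ (WeightP i j) = WP $ Inl i $ j"
| "init_value cP cQ WP WQ (WeightQ i j) = WQ $ Inl i $ j"

definition symmetric_net :: "('k::finite + 'k \<Rightarrow> real) \<Rightarrow> real^'e^('k + 'k) \<Rightarrow> bool" where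
  "symmetric_net c W \<longleftrightarrow>
     (\<forall>i. c i \<in> {-1, 1}) \<and> (\<forall>i. c (Inr i) = - c (Inl i)) \<and> (\<forall>i. W $ Inr i = W $ Inl i)"

locale symmetric_initialization = prob_space M0
  for M0 :: "'v measure" +
  fixes cP cQ :: "'v \<Rightarrow> 'k::finite + 'k \<Rightarrow> real"
    and WP0 :: "'v \<Rightarrow> real^'ep^('k + 'k)"
    and WQ0 :: "'v \<Rightarrow> real^'eq^('k + 'k)"
  assumes symmetric: "\<And>v. v \<in> space M0 \<Longrightarrow> symmetric_net (cP v) (WP0 v) \<and> symmetric_net (cQ v) (WQ0 v)"
    and independent:
      "indep_vars (\<lambda>_. borel) (\<lambda>j v. init_value (cP v) (cQ v) (WP0 v) (WQ0 v) j)
         (UNIV :: ('k, 'ep, 'eq) init_coord set)"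
    and rademacherP: "\<And>i z. z \<in> {-1, 1} \<Longrightarrow> prob {v \<in> space M0. cP v (Inl i) = z} = 1 / 2"
    and rademacherQ: "\<And>i z. z \<in> {-1, 1} \<Longrightarrow> prob {v \<in> space M0. cQ v (Inl i) = z} = 1 / 2"
    and gaussianP: "\<And>i j. distributed M0 lborel (\<lambda>v. WP0 v $ Inl i $ j) std_normal_density"
    and gaussianQ: "\<And>i j. distributed M0 lborel (\<lambda>v. WQ0 v $ Inl i $ j) std_normal_density"

text \<open>Uniform accuracy of the linearized scores over the domains \<open>DP\<close>, \<open>DQ\<close>, at one realization of
  the initialization.\<close>
definition linearization_ok ::
  "real \<Rightarrow> ('s \<Rightarrow> 'a \<Rightarrow> 's \<Rightarrow> real^'ep) \<Rightarrow> ('s \<Rightarrow> 'x \<Rightarrow> real^'eq) \<Rightarrow> real \<Rightarrow> real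
    \<Rightarrow> ('m::finite \<Rightarrow> real) \<Rightarrow> ('m \<Rightarrow> real) \<Rightarrow> real^'ep^'m \<Rightarrow> real^'eq^'m
    \<Rightarrow> (real^'ep^'m) set \<Rightarrow> (real^'eq^'m) set \<Rightarrow> bool" where
  "linearization_ok z0 eP eQ \<epsilon>P \<epsilon>Q cP cQ WP0 WQ0 DP DQ \<longleftrightarrow>
     (\<forall>W\<in>DP. \<forall>s a s'.
        \<bar>nn_score cP W (eP s a s') - nn_lin_score z0 cP WP0 W (eP s a s')\<bar> \<le> \<epsilon>P) \<and>
     (\<forall>W\<in>DQ. \<forall>s x.
        \<bar>nn_score cQ W (eQ s x) - nn_lin_score z0 cQ WQ0 W (eQ s x)\<bar> \<le> \<epsilon>Q)"


subsection \<open>Reward features and preference data\<close>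

definition belief_feature :: "('s::finite \<Rightarrow> 'a \<Rightarrow> real^'d) \<Rightarrow> ('s \<Rightarrow> real) \<Rightarrow> 'a \<Rightarrow> real^'d" where
  "belief_feature \<phi>r b a = (\<Sum>s\<in>UNIV. b s *\<^sub>R \<phi>r s a)"

definition traj_feature ::
  "('s::finite \<Rightarrow> 'a \<Rightarrow> real^'d) \<Rightarrow> ('s \<Rightarrow> real) \<Rightarrow> nat \<Rightarrow> ('s, 'a) trans \<Rightarrow> ('s, 'x) emission
    \<Rightarrow> (nat \<Rightarrow> 'a) \<Rightarrow> (nat \<Rightarrow> 'x) \<Rightarrow> real^'d" where
  "traj_feature \<phi>r \<nu>0 T P Q a x = (\<Sum>h<T. belief_feature \<phi>r (belief \<nu>0 P Q a x h) (a h))"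

text \<open>The first argument of \<open>a\<close> and \<open>x\<close> selects the trajectory, 1 or 2, of the comparison.\<close>
definition feature_diff ::
  "('s::finite \<Rightarrow> 'a \<Rightarrow> real^'d) \<Rightarrow> ('s \<Rightarrow> real) \<Rightarrow> nat \<Rightarrow> ('s, 'a) trans \<Rightarrow> ('s, 'x) emission
    \<Rightarrow> (nat \<Rightarrow> nat \<Rightarrow> 'a) \<Rightarrow> (nat \<Rightarrow> nat \<Rightarrow> 'x) \<Rightarrow> real^'d" where
  "feature_diff \<phi>r \<nu>0 T P Q a x =
     traj_feature \<phi>r \<nu>0 T P Q (a 1) (x 1) - traj_feature \<phi>r \<nu>0 T P Q (a 2) (x 2)"

text \<open>\<open>N\<close> comparisons of trajectories of length \<open>T\<close> of the POMDP \<open>(\<nu>0, P, Q)\<close>: \<open>act i j h\<close> is the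
  given action and \<open>Obs i j k\<close> the random observation of trajectory \<open>j \<in> {1, 2}\<close> of comparison \<open>i\<close>,
  and \<open>y i\<close> is its label (\<open>True\<close> for 1). No relation between the two trajectories of one
  comparison is imposed. All conditioning is on feature differences, which take finitely many values.\<close>
locale preference_data = prob_space M
  for M :: "'w measure" +
  fixes \<nu>0 :: "'s::finite \<Rightarrow> real"
    and P :: "('s, 'a) trans"
    and Q :: "('s, 'x) emission"
    and \<phi>r :: "'s \<Rightarrow> 'a \<Rightarrow> real^'d"
    and \<mu>star :: "real^'d"
    and T N :: nat
    and act :: "nat \<Rightarrow> nat \<Rightarrow> nat \<Rightarrow> 'a"
    and Obs :: "nat \<Rightarrow> nat \<Rightarrow> nat \<Rightarrow> 'w \<Rightarrow> 'x"
    and y :: "nat \<Rightarrow> 'w \<Rightarrow> bool"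
  assumes obs_measurable: "\<And>i j k. \<lbrakk>i \<in> {1..N}; j \<in> {1, 2}; k \<in> {1..T}\<rbrakk> \<Longrightarrow>
        Obs i j k \<in> measurable M (count_space UNIV)"
    and label_measurable: "\<And>i. i \<in> {1..N} \<Longrightarrow> y i \<in> measurable M (count_space UNIV)"
    and obs_law: "\<And>i j x. \<lbrakk>i \<in> {1..N}; j \<in> {1, 2}\<rbrakk> \<Longrightarrow>
        \<P>(\<omega> in M. \<forall>k\<in>{1..T}. Obs i j k \<omega> = x k) = obs_prob \<nu>0 P Q T (act i j) x"
    and comparisons_independent:
      "indep_vars (\<lambda>_. count_space UNIV)
         (\<lambda>i \<omega>. (map (\<lambda>k. Obs i 1 k \<omega>) [1..<Suc T], map (\<lambda>k. Obs i 2 k \<omega>) [1..<Suc T], y i \<omega>))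
         {1..N}"
    and labels_cond_independent: "\<And>v l.
        \<P>(\<omega> in M. \<forall>i\<in>{1..N}. feature_diff \<phi>r \<nu>0 T P Q (act i) (\<lambda>j k. Obs i j k \<omega>) = v i) > 0 \<Longrightarrow>
        \<P>(\<omega> in M. (\<forall>i\<in>{1..N}. y i \<omega> = l i)
           \<bar> (\<forall>i\<in>{1..N}. feature_diff \<phi>r \<nu>0 T P Q (act i) (\<lambda>j k. Obs i j k \<omega>) = v i))
        = (\<Prod>n\<in>{1..N}. \<P>(\<omega> in M. y n \<omega> = l n
           \<bar> (\<forall>i\<in>{1..N}. feature_diff \<phi>r \<nu>0 T P Q (act i) (\<lambda>j k. Obs i j k \<omega>) = v i)))"
    and label_law: "\<And>i v. i \<in> {1..N} \<Longrightarrow>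
        \<P>(\<omega> in M. feature_diff \<phi>r \<nu>0 T P Q (act i) (\<lambda>j k. Obs i j k \<omega>) = v) > 0 \<Longrightarrow>
        \<P>(\<omega> in M. y i \<omega> \<bar> feature_diff \<phi>r \<nu>0 T P Q (act i) (\<lambda>j k. Obs i j k \<omega>) = v)
        = sigmoid (v \<bullet> \<mu>star)"


subsection \<open>Maximum likelihood estimation and the error bound\<close>

definition neg_log_lik :: "nat \<Rightarrow> (nat \<Rightarrow> real^'d) \<Rightarrow> (nat \<Rightarrow> bool) \<Rightarrow> real^'d \<Rightarrow> real" where
  "neg_log_lik N \<phi> y \<mu> =
     - (\<Sum>i=1..N. of_bool (y i) * ln (sigmoid (\<phi> i \<bullet> \<mu>))
                 + (1 - of_bool (y i)) * ln (1 - sigmoid (\<phi> i \<bullet> \<mu>)))"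

definition constrained_mle ::
  "real \<Rightarrow> nat \<Rightarrow> (nat \<Rightarrow> real^'d) \<Rightarrow> (nat \<Rightarrow> bool) \<Rightarrow> real^'d \<Rightarrow> bool" where
  "constrained_mle r N \<phi> y \<mu> \<longleftrightarrow> is_arg_min (neg_log_lik N \<phi> y) (\<lambda>\<mu>. norm \<mu> \<le> r) \<mu>"

definition empirical_cov :: "nat \<Rightarrow> (nat \<Rightarrow> real^'d) \<Rightarrow> real^'d^'d" where
  "empirical_cov N \<phi> = (1 / real N) *\<^sub>R (\<Sum>i=1..N. \<chi> k l. \<phi> i $ k * \<phi> i $ l)"

definition mat_norm :: "real^'d^'d \<Rightarrow> real^'d \<Rightarrow> real" where
  "mat_norm A v = sqrt (v \<bullet> (A *v v))"

definition zeta_reg :: "real \<Rightarrow> nat \<Rightarrow> real \<Rightarrow> real \<Rightarrow> real" where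
  "zeta_reg c\<zeta> T Br \<epsilon> = 16 * c\<zeta> * (real T)\<^sup>2 * Br\<^sup>2 * \<epsilon> * (1 + \<epsilon>)"

definition rho_curv :: "nat \<Rightarrow> real \<Rightarrow> real \<Rightarrow> real" where
  "rho_curv T Br r\<mu> = 1 / (2 + exp (2 * real T * Br * r\<mu>) + exp (- (2 * real T * Br * r\<mu>)))"

definition estimation_bound ::
  "real \<Rightarrow> real \<Rightarrow> nat \<Rightarrow> nat \<Rightarrow> nat \<Rightarrow> real \<Rightarrow> real \<Rightarrow> real \<Rightarrow> real" where
  "estimation_bound c\<zeta> \<delta>c d T N Br r\<mu> \<epsilon> =
     (let \<zeta> = zeta_reg c\<zeta> T Br \<epsilon>; \<rho> = rho_curv T Br r\<mu> in
        2 * sqrt c\<zeta> / (\<rho> * sqrt (real N * (c\<zeta> - 1)))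
          * sqrt (real d * ln (1 + 4 * (real T)\<^sup>2 * Br\<^sup>2 / (\<zeta> * real d)) + 2 * ln (1 / \<delta>c))
        + 8 * real T * Br * \<epsilon> / (\<rho> * sqrt \<zeta>) * (1 + 1 / 2 * real T * Br * r\<mu>)
        + 2 * r\<mu> * sqrt \<zeta>)"

end

theory Submission
  imports Defs
begin

text \<open>
  The estimator sees features computed from beliefs of a misspecified model, and labels that are
  random given the features of the true model. These two sources of error are controlled on two
  separate events; on their intersection the bound is deterministic.

  Let \<open>D k\<close> be the total variation distance at time \<open>k\<close> between the beliefs that the perturbed and
  the true kernels assign to one history. In one filtering step, prediction contracts by the overlap
  of the transition rows, and the Bayes correction, averaged over the true law of the next
  observation, costs the distance of the joint laws of state and observation plus the distance of
  their observation marginals (\<open>bayes_expected_tv\<close>). Model mismatch enters through the distance of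
  two softmax distributions, which is at most half the uniform distance of their scores
  (\<open>tv_softmax_le\<close>). Hence \<open>D (k + 1)\<close> has conditional mean at most \<open>\<alpha> * D k + c\<close>
  (\<open>filter_step_contraction\<close>). As \<open>D\<close> has values in \<open>[0, 1]\<close>, the exponentials of the accumulated error,
  suitably compensated, form a supermartingale (\<open>exponential_moment\<close>), and Chernoff's bound with a
  Bernstein-type rate gives a tail bound at the level \<open>belief_error\<close> (\<open>accumulated_gap_tail\<close>). A union
  bound over the \<open>2 * N\<close> histories makes all features accurate up to \<open>4 * T * Br * \<epsilon>\<close>.

  Given its clean feature, a label minus its success probability is a centred Bernoulli variable.
  Averaging the associated exponential martingale over a Gaussian direction and completing the
  square bounds the noise in every direction by the regularized empirical norm of that direction
  (\<open>self_normalized_bound\<close>). The determinant that usually appears here is replaced by the trace at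
  once: Jensen's inequality compares the Gaussian integral of a quadratic form with that of the
  isotropic form of the same trace (\<open>gaussian_integral_trace_bound\<close>).

  On both events, strong convexity of the logistic loss on the range of the scores turns optimality
  of the estimator into a quadratic inequality \<open>X\<^sup>2 \<le> a * X + 4 * \<zeta> * r\<^sup>2\<close> for its error \<open>X\<close> in the
  regularized empirical norm, whence \<open>X \<le> a + 2 * r * sqrt \<zeta>\<close> (\<open>mle_error_bound\<close>). The
  regularization \<open>\<zeta>\<close> is of the size of the difference between the clean and the perturbed empirical
  covariance, so that the noise bound can be transferred from the former to the latter.

  For the neural model the same argument applies to every realization of the initialization at which
  the linearization is accurate, with the linearization error added to the score distance, and
  Fubini's theorem combines the realizations. The estimator is an arbitrary selection of minimizers;
  the good event is therefore expressed by the beliefs and the Gaussian mixture, which are jointly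
  measurable in initialization and data.
\<close>

section \<open>Total variation, softmax and Dobrushin contraction\<close>

definition tv :: "('s::finite \<Rightarrow> real) \<Rightarrow> ('s \<Rightarrow> real) \<Rightarrow> real" where
  "tv p q = (\<Sum>s\<in>UNIV. \<bar>p s - q s\<bar>) / 2"

lemma tv_nonneg: "0 \<le> tv p q"
  by (simp add: tv_def sum_nonneg)

lemma tv_le_1:
  assumes "prob_vector p" "prob_vector q"
  shows "tv p q \<le> 1"
proof -
  have "(\<Sum>s\<in>UNIV. \<bar>p s - q s\<bar>) \<le> (\<Sum>s\<in>UNIV. p s + q s)"
    using assms by (intro sum_mono) (auto simp: prob_vector_def abs_le_iff add_increasing add_increasing2)
  also have "\<dots> = 2" using assms by (simp add: sum.distrib prob_vector_def)
  finally show ?thesis by (simp add: tv_def)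
qed

lemma tv_triangle: "tv p r \<le> tv p q + tv q r"
proof -
  have "(\<Sum>s\<in>UNIV. \<bar>p s - r s\<bar>) \<le> (\<Sum>s\<in>UNIV. \<bar>p s - q s\<bar> + \<bar>q s - r s\<bar>)"
    by (intro sum_mono) simp
  then show ?thesis by (simp add: tv_def sum.distrib add_divide_distrib[symmetric])
qed

lemma norm_expectation_diff_le_tv:
  fixes g :: "'s::finite \<Rightarrow> 'b::real_normed_vector"
  assumes "\<And>s. norm (g s) \<le> C"
  shows "norm ((\<Sum>s\<in>UNIV. p s *\<^sub>R g s) - (\<Sum>s\<in>UNIV. q s *\<^sub>R g s)) \<le> 2 * C * tv p q"
proof -
  have "norm ((\<Sum>s\<in>UNIV. p s *\<^sub>R g s) - (\<Sum>s\<in>UNIV. q s *\<^sub>R g s))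
      = norm (\<Sum>s\<in>UNIV. (p s - q s) *\<^sub>R g s)"
    by (simp add: sum_subtractf scaleR_left_diff_distrib)
  also have "\<dots> \<le> (\<Sum>s\<in>UNIV. norm ((p s - q s) *\<^sub>R g s))" by (rule norm_sum)
  also have "\<dots> \<le> (\<Sum>s\<in>UNIV. \<bar>p s - q s\<bar> * C)"
    using assms by (intro sum_mono) (simp add: mult_left_mono)
  also have "\<dots> = 2 * C * tv p q" by (simp add: tv_def sum_distrib_right[symmetric])
  finally show ?thesis .
qed

lemma prob_vector_sum1: "prob_vector p \<Longrightarrow> sum p UNIV = 1"
  and prob_vector_nonneg: "prob_vector p \<Longrightarrow> 0 \<le> p s"
  by (auto simp: prob_vector_def)

lemma softmax_pos: "0 < softmax f x"
  by (simp add: softmax_def sum_pos)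

lemma prob_vector_softmax: "prob_vector (softmax f)"
proof -
  have "(\<Sum>y\<in>UNIV. exp (f y)) > 0" by (intro sum_pos) auto
  then show ?thesis
    by (simp add: prob_vector_def less_imp_le[OF softmax_pos])
       (simp add: softmax_def sum_divide_distrib[symmetric])
qed

text \<open>The covariance of \<open>h\<close> and \<open>D\<close> under \<open>p\<close> is at most \<open>E \<bar>D - E D\<bar>\<close>, which is at most the standard
  deviation of \<open>D\<close> by Cauchy-Schwarz. Bounding the mean absolute deviation by \<open>2 * \<eta>\<close> instead would
  lose a factor 2 in the distance of softmax distributions.\<close>
lemma softmax_covariance_bound:
  fixes p h D :: "'x::finite \<Rightarrow> real"
  assumes p: "prob_vector p" and h: "\<And>x. \<bar>h x\<bar> \<le> 1" and D: "\<And>x. \<bar>D x\<bar> \<le> \<eta>"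
  shows "\<bar>\<Sum>x\<in>UNIV. h x * (p x * (D x - (\<Sum>y\<in>UNIV. p y * D y)))\<bar> \<le> \<eta>"
proof -
  define m where "m = (\<Sum>y\<in>UNIV. p y * D y)"
  have \<eta>: "0 \<le> \<eta>" using D[of undefined] by linarith
  have "\<bar>\<Sum>x\<in>UNIV. h x * (p x * (D x - m))\<bar> \<le> (\<Sum>x\<in>UNIV. \<bar>h x * (p x * (D x - m))\<bar>)"
    by (rule sum_abs)
  also have "\<dots> \<le> (\<Sum>x\<in>UNIV. sqrt (p x) * (sqrt (p x) * \<bar>D x - m\<bar>))"
  proof (intro sum_mono)
    fix x
    have "\<bar>h x * (p x * (D x - m))\<bar> = \<bar>h x\<bar> * (p x * \<bar>D x - m\<bar>)"
      using prob_vector_nonneg[OF p, of x] by (simp add: abs_mult)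
    also have "\<dots> \<le> 1 * (p x * \<bar>D x - m\<bar>)"
      using h prob_vector_nonneg[OF p, of x] by (intro mult_right_mono) auto
    finally show "\<bar>h x * (p x * (D x - m))\<bar> \<le> sqrt (p x) * (sqrt (p x) * \<bar>D x - m\<bar>)"
      using prob_vector_nonneg[OF p, of x] by (simp flip: mult.assoc)
  qed
  also have "\<dots> \<le> L2_set (\<lambda>x. sqrt (p x)) UNIV * L2_set (\<lambda>x. sqrt (p x) * \<bar>D x - m\<bar>) UNIV"
    using L2_set_mult_ineq[of "\<lambda>x. sqrt (p x)" "\<lambda>x. sqrt (p x) * \<bar>D x - m\<bar>" UNIV]
      prob_vector_nonneg[OF p] by (simp add: abs_mult)
  also have "\<dots> = sqrt (\<Sum>x\<in>UNIV. p x * (D x - m)\<^sup>2)"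
    using prob_vector_nonneg[OF p] prob_vector_sum1[OF p]
    by (simp add: L2_set_def power_mult_distrib)
  also have "(\<Sum>x\<in>UNIV. p x * (D x - m)\<^sup>2) = (\<Sum>x\<in>UNIV. p x * (D x)\<^sup>2) - m\<^sup>2"
  proof -
    have "(\<Sum>x\<in>UNIV. p x * (D x - m)\<^sup>2)
        = (\<Sum>x\<in>UNIV. p x * (D x)\<^sup>2 - (2 * m) * (p x * D x) + m\<^sup>2 * p x)"
      by (simp add: power2_eq_square algebra_simps)
    also have "\<dots> = (\<Sum>x\<in>UNIV. p x * (D x)\<^sup>2) - 2 * m * m + m\<^sup>2 * 1"
      unfolding sum.distrib sum_subtractf sum_distrib_left[symmetric] m_def[symmetric]
        prob_vector_sum1[OF p] ..
    finally show ?thesis by (simp add: power2_eq_square)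
  qed
  also have "sqrt \<dots> \<le> sqrt (\<eta>\<^sup>2)"
  proof (rule real_sqrt_le_mono)
    have "(\<Sum>x\<in>UNIV. p x * (D x)\<^sup>2) \<le> (\<Sum>x\<in>UNIV. p x * \<eta>\<^sup>2)"
      using D \<eta> prob_vector_nonneg[OF p] by (intro sum_mono mult_left_mono) (auto simp: abs_le_square_iff[symmetric])
    also have "\<dots> = \<eta>\<^sup>2" by (simp add: sum_distrib_right[symmetric] prob_vector_sum1[OF p])
    finally show "(\<Sum>x\<in>UNIV. p x * (D x)\<^sup>2) - m\<^sup>2 \<le> \<eta>\<^sup>2" by (smt (verit) zero_le_power2)
  qed
  finally show ?thesis using \<eta> by (simp add: m_def)
qed

text \<open>Along the segment from \<open>g\<close> to \<open>f\<close>, the derivative of \<open>\<Sum>x. h x * softmax x\<close> is the covariance of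
  \<open>h\<close> with the score increment; the mean value theorem is applied with \<open>h\<close> the signs of the total
  difference, for which this sum changes by twice the total variation.\<close>
lemma tv_softmax_le:
  fixes f g :: "'x::finite \<Rightarrow> real"
  assumes "\<And>x. \<bar>f x - g x\<bar> \<le> \<eta>"
  shows "tv (softmax f) (softmax g) \<le> \<eta> / 2"
proof -
  define D where "D x = f x - g x" for x
  define s where "s t = softmax (\<lambda>x. g x + t * D x)" for t
  define h where "h x = sgn (softmax f x - softmax g x)" for x
  have ds: "((\<lambda>t. s t x) has_real_derivative s t x * (D x - (\<Sum>y\<in>UNIV. s t y * D y))) (at t)" for t x
  proof -
    define Z where "Z = (\<Sum>y\<in>UNIV. exp (g y + t * D y))"
    have Z: "Z > 0" unfolding Z_def by (intro sum_pos) auto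
    have "((\<lambda>t. s t x) has_real_derivative
        (exp (g x + t * D x) * D x * Z - exp (g x + t * D x) * (\<Sum>y\<in>UNIV. exp (g y + t * D y) * D y)) / (Z * Z)) (at t)"
      unfolding s_def softmax_def Z_def
      by (rule derivative_eq_intros refl | use Z in \<open>simp add: Z_def\<close>)+
    also have "(exp (g x + t * D x) * D x * Z - exp (g x + t * D x) * (\<Sum>y\<in>UNIV. exp (g y + t * D y) * D y)) / (Z * Z)
       = s t x * (D x - (\<Sum>y\<in>UNIV. s t y * D y))"
    proof -
      have "(\<Sum>y\<in>UNIV. s t y * D y) = (\<Sum>y\<in>UNIV. exp (g y + t * D y) * D y) / Z"
        by (simp add: s_def softmax_def Z_def sum_divide_distrib)
      moreover have "s t x = exp (g x + t * D x) / Z" by (simp add: s_def softmax_def Z_def)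
      ultimately show ?thesis using Z by (simp add: diff_divide_distrib right_diff_distrib)
    qed
    finally show ?thesis .
  qed
  have dF: "((\<lambda>t. \<Sum>x\<in>UNIV. h x * s t x) has_real_derivative
      (\<Sum>x\<in>UNIV. h x * (s t x * (D x - (\<Sum>y\<in>UNIV. s t y * D y))))) (at t)" for t
    by (intro DERIV_sum DERIV_cmult ds)
  obtain t where t: "(\<Sum>x\<in>UNIV. h x * s 1 x) - (\<Sum>x\<in>UNIV. h x * s 0 x)
      = (1 - 0) * (\<Sum>x\<in>UNIV. h x * (s t x * (D x - (\<Sum>y\<in>UNIV. s t y * D y))))"
    using MVT2[of 0 1 "\<lambda>t. \<Sum>x\<in>UNIV. h x * s t x", OF _ dF] by auto
  have "2 * tv (softmax f) (softmax g) = (\<Sum>x\<in>UNIV. h x * (softmax f x - softmax g x))"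
    by (simp add: tv_def h_def sgn_if) (intro sum.cong, auto)
  also have "\<dots> = (\<Sum>x\<in>UNIV. h x * s 1 x) - (\<Sum>x\<in>UNIV. h x * s 0 x)"
    by (simp add: s_def D_def sum_subtractf right_diff_distrib)
  also have "\<dots> \<le> \<bar>(\<Sum>x\<in>UNIV. h x * (s t x * (D x - (\<Sum>y\<in>UNIV. s t y * D y))))\<bar>"
    unfolding t by simp
  also have "\<dots> \<le> \<eta>"
    by (rule softmax_covariance_bound)
       (use assms in \<open>auto simp: s_def prob_vector_softmax h_def sgn_if D_def\<close>)
  finally show ?thesis by simp
qed

text \<open>The law obtained from \<open>p\<close> by one application of the kernel \<open>K\<close>: the predicted belief for a
  transition kernel, the observation law for an emission.\<close>
definition push :: "('s::finite \<Rightarrow> real) \<Rightarrow> ('s \<Rightarrow> 'x \<Rightarrow> real) \<Rightarrow> 'x \<Rightarrow> real" where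
  "push p K x = (\<Sum>s\<in>UNIV. K s x * p s)"

lemma prob_vector_push:
  fixes K :: "'s::finite \<Rightarrow> 'x::finite \<Rightarrow> real"
  assumes "prob_vector p" "\<And>s. prob_vector (K s)"
  shows "prob_vector (push p K)"
proof -
  have "(\<Sum>x\<in>UNIV. \<Sum>s\<in>UNIV. K s x * p s) = (\<Sum>s\<in>UNIV. (\<Sum>x\<in>UNIV. K s x) * p s)"
    by (subst sum.swap) (simp add: sum_distrib_right)
  then show ?thesis using assms by (auto simp: prob_vector_def push_def sum_nonneg)
qed

text \<open>The positive and negative parts of \<open>p - q\<close> have the same mass \<open>t = tv p q\<close>, so
  \<open>p - q\<close> is a mixture of differences of point masses; each such difference is mapped to a
  difference of two rows of \<open>K\<close>, which overlap by at least \<open>\<kappa>\<close>.\<close>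
lemma tv_push_contraction:
  fixes K :: "'s::finite \<Rightarrow> 'x::finite \<Rightarrow> real"
  assumes p: "prob_vector p" and q: "prob_vector q" and K: "\<And>s. prob_vector (K s)"
    and overlap: "\<And>s s'. \<kappa> \<le> (\<Sum>x\<in>UNIV. min (K s x) (K s' x))"
  shows "tv (push p K) (push q K) \<le> (1 - \<kappa>) * tv p q"
proof (cases "tv p q = 0")
  case True
  then have "p = q" by (auto simp: tv_def sum_nonneg_eq_0_iff fun_eq_iff)
  then show ?thesis by (simp add: tv_def)
next
  case False
  define t where "t = tv p q"
  define u where "u s = max 0 (p s - q s)" for s
  define v where "v s = max 0 (q s - p s)" for s
  have t: "t > 0" using False tv_nonneg[of p q] by (simp add: t_def)
  have d: "p s - q s = u s - v s" and nn: "0 \<le> u s" "0 \<le> v s" for s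
    by (auto simp: u_def v_def)
  have "sum u UNIV + sum v UNIV = 2 * t"
    unfolding t_def tv_def sum.distrib[symmetric] by (simp add: u_def v_def) (intro sum.cong, auto)
  moreover have "sum u UNIV - sum v UNIV = 0"
    unfolding sum_subtractf[symmetric] d[symmetric]
    by (simp add: sum_subtractf prob_vector_sum1[OF p] prob_vector_sum1[OF q])
  ultimately have su: "sum u UNIV = t" and sv: "sum v UNIV = t" by auto
  have rep: "push p K x - push q K x = (\<Sum>s\<in>UNIV. \<Sum>s'\<in>UNIV. u s * v s' * (K s x - K s' x)) / t" for x
  proof -
    have "(\<Sum>s\<in>UNIV. \<Sum>s'\<in>UNIV. u s * v s' * (K s x - K s' x))
        = (\<Sum>s\<in>UNIV. \<Sum>s'\<in>UNIV. (K s x * u s) * v s') - (\<Sum>s\<in>UNIV. \<Sum>s'\<in>UNIV. u s * (K s' x * v s'))"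
      by (simp add: sum_subtractf[symmetric] algebra_simps)
    also have "\<dots> = (\<Sum>s\<in>UNIV. K s x * u s) * t - t * (\<Sum>s\<in>UNIV. K s x * v s)"
      unfolding sum_product[symmetric] su sv ..
    also have "\<dots> = t * (\<Sum>s\<in>UNIV. K s x * (u s - v s))"
      by (simp add: sum_subtractf right_diff_distrib mult.commute)
    also have "\<dots> = t * (push p K x - push q K x)"
      unfolding d[symmetric] by (simp add: push_def sum_subtractf right_diff_distrib)
    finally show ?thesis using t by simp
  qed
  have row: "(\<Sum>x\<in>UNIV. \<bar>K s x - K s' x\<bar>) \<le> 2 * (1 - \<kappa>)" for s s'
  proof -
    have "(\<Sum>x\<in>UNIV. \<bar>K s x - K s' x\<bar>) = (\<Sum>x\<in>UNIV. K s x + K s' x - 2 * min (K s x) (K s' x))"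
      by (intro sum.cong) auto
    also have "\<dots> = 2 - 2 * (\<Sum>x\<in>UNIV. min (K s x) (K s' x))"
      by (simp add: sum_subtractf sum.distrib prob_vector_sum1[OF K] sum_distrib_left)
    finally show ?thesis using overlap[of s s'] by simp
  qed
  have "(\<Sum>x\<in>UNIV. \<bar>push p K x - push q K x\<bar>)
      \<le> (\<Sum>x\<in>UNIV. (\<Sum>s\<in>UNIV. \<Sum>s'\<in>UNIV. u s * v s' * \<bar>K s x - K s' x\<bar>) / t)"
  proof (rule sum_mono)
    fix x
    have "\<bar>\<Sum>s\<in>UNIV. \<Sum>s'\<in>UNIV. u s * v s' * (K s x - K s' x)\<bar>
        \<le> (\<Sum>s\<in>UNIV. \<bar>\<Sum>s'\<in>UNIV. u s * v s' * (K s x - K s' x)\<bar>)" by (rule sum_abs)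
    also have "\<dots> \<le> (\<Sum>s\<in>UNIV. \<Sum>s'\<in>UNIV. \<bar>u s * v s' * (K s x - K s' x)\<bar>)"
      by (intro sum_mono sum_abs)
    also have "\<dots> = (\<Sum>s\<in>UNIV. \<Sum>s'\<in>UNIV. u s * v s' * \<bar>K s x - K s' x\<bar>)"
      using nn by (simp add: abs_mult)
    finally show "\<bar>push p K x - push q K x\<bar>
        \<le> (\<Sum>s\<in>UNIV. \<Sum>s'\<in>UNIV. u s * v s' * \<bar>K s x - K s' x\<bar>) / t"
      using t by (simp add: rep abs_divide divide_right_mono)
  qed
  also have "\<dots> = (\<Sum>s\<in>UNIV. \<Sum>s'\<in>UNIV. u s * v s' * (\<Sum>x\<in>UNIV. \<bar>K s x - K s' x\<bar>)) / t"
  proof -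
    have "(\<Sum>x\<in>UNIV. \<Sum>s\<in>UNIV. \<Sum>s'\<in>UNIV. u s * v s' * \<bar>K s x - K s' x\<bar>)
       = (\<Sum>s\<in>UNIV. \<Sum>s'\<in>UNIV. \<Sum>x\<in>UNIV. u s * v s' * \<bar>K s x - K s' x\<bar>)"
      by (subst sum.swap) (intro sum.cong refl sum.swap)
    then show ?thesis by (simp add: sum_divide_distrib[symmetric] sum_distrib_left)
  qed
  also have "\<dots> \<le> (\<Sum>s\<in>UNIV. \<Sum>s'\<in>UNIV. u s * v s' * (2 * (1 - \<kappa>))) / t"
    using nn t row by (intro divide_right_mono sum_mono mult_left_mono) auto
  also have "\<dots> = t * t * (2 * (1 - \<kappa>)) / t"
    by (simp add: sum_distrib_right[symmetric] sum_product[symmetric] su sv)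
  also have "\<dots> = 2 * ((1 - \<kappa>) * t)" using t by simp
  finally show ?thesis by (simp add: tv_def[of "push p K"] t_def)
qed

lemma tv_push_kernel_le:
  fixes K L :: "'s::finite \<Rightarrow> 'x::finite \<Rightarrow> real"
  assumes p: "prob_vector p" and e: "\<And>s. tv (K s) (L s) \<le> \<epsilon>"
  shows "tv (push p K) (push p L) \<le> \<epsilon>"
proof -
  have "(\<Sum>x\<in>UNIV. \<bar>push p K x - push p L x\<bar>) \<le> (\<Sum>x\<in>UNIV. \<Sum>s\<in>UNIV. \<bar>K s x - L s x\<bar> * p s)"
  proof (rule sum_mono)
    fix x
    have "\<bar>\<Sum>s\<in>UNIV. (K s x - L s x) * p s\<bar> \<le> (\<Sum>s\<in>UNIV. \<bar>(K s x - L s x) * p s\<bar>)"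
      by (rule sum_abs)
    then show "\<bar>push p K x - push p L x\<bar> \<le> (\<Sum>s\<in>UNIV. \<bar>K s x - L s x\<bar> * p s)"
      using prob_vector_nonneg[OF p]
      by (simp add: push_def sum_subtractf[symmetric] left_diff_distrib[symmetric] abs_mult)
  qed
  also have "\<dots> = (\<Sum>s\<in>UNIV. 2 * tv (K s) (L s) * p s)"
    by (subst sum.swap) (simp add: tv_def sum_distrib_right)
  also have "\<dots> \<le> (\<Sum>s\<in>UNIV. 2 * \<epsilon> * p s)"
    using e prob_vector_nonneg[OF p] by (intro sum_mono mult_right_mono) auto
  also have "\<dots> = 2 * \<epsilon>" by (simp add: sum_distrib_left[symmetric] prob_vector_sum1[OF p])
  finally show ?thesis by (simp add: tv_def)
qed

section \<open>One step of the Bayes filter\<close>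

text \<open>Posterior of the state after the observation \<open>x\<close>, for the predicted belief \<open>p\<close>.\<close>
definition bayes :: "('s::finite \<Rightarrow> real) \<Rightarrow> ('s, 'x) emission \<Rightarrow> 'x \<Rightarrow> 's \<Rightarrow> real" where
  "bayes p Q x s = Q s x * p s / push p Q x"

lemma push_pos:
  assumes "prob_vector p" "\<And>s. 0 < Q s x"
  shows "0 < push p Q x"
proof -
  have "\<exists>s. p s \<noteq> 0"
  proof (rule ccontr)
    assume "\<not> (\<exists>s. p s \<noteq> 0)"
    then have "sum p UNIV = 0" by simp
    then show False using prob_vector_sum1[OF assms(1)] by simp
  qed
  then obtain s where "p s \<noteq> 0" by blast
  then have s: "0 < p s" using prob_vector_nonneg[OF assms(1), of s] by simp
  show ?thesis unfolding push_def
    by (rule sum_pos2[of _ s]) (use assms s in \<open>auto simp: prob_vector_nonneg less_imp_le\<close>)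
qed

lemma prob_vector_bayes:
  assumes "prob_vector p" "\<And>s. 0 < Q s x"
  shows "prob_vector (bayes p Q x)"
  using push_pos[of p Q x, OF assms] assms
  by (auto simp: prob_vector_def bayes_def sum_divide_distrib[symmetric] less_imp_le
      simp flip: push_def intro!: divide_nonneg_pos mult_nonneg_nonneg)

text \<open>Averaged over the true observation law, the posterior error is at most the total variation
  of the joint laws of state and observation plus that of the observation marginals; the first
  does not contract, the second contracts by the overlap of the observation model.\<close>
lemma bayes_expected_tv:
  fixes Q Q' :: "('s::finite, 'x::finite) emission"
  assumes p: "prob_vector p" and p': "prob_vector p'"
    and Q: "\<And>s. prob_vector (Q s)" "\<And>s x. 0 < Q s x"
    and Q': "\<And>s. prob_vector (Q' s)" "\<And>s x. 0 < Q' s x"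
    and overlap: "\<And>s s'. \<kappa> \<le> (\<Sum>x\<in>UNIV. min (Q' s x) (Q' s' x))"
    and e: "\<And>s. tv (Q' s) (Q s) \<le> \<epsilon>"
  shows "(\<Sum>x\<in>UNIV. push p Q x * tv (bayes p' Q' x) (bayes p Q x)) \<le> (2 - \<kappa>) * tv p' p + 2 * \<epsilon>"
proof -
  \<comment> \<open>Compare the true posterior with the perturbed joint law divided by the true normalizer \<open>z\<close>,
    and that with the perturbed posterior, whose normalizer is \<open>z'\<close>.\<close>
  have pt: "2 * (push p Q x * tv (bayes p' Q' x) (bayes p Q x))
      \<le> (\<Sum>s\<in>UNIV. \<bar>Q' s x - Q s x\<bar> * p s) + (\<Sum>s\<in>UNIV. Q' s x * \<bar>p' s - p s\<bar>)
        + \<bar>push p' Q' x - push p Q x\<bar>" for x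
  proof -
    define z z' where "z = push p Q x" and "z' = push p' Q' x"
    have z: "z > 0" "z' > 0" using p p' Q(2) Q'(2) by (auto simp: z_def z'_def push_pos)
    have b: "prob_vector (bayes p' Q' x)" using p' Q' by (intro prob_vector_bayes) auto
    have "2 * (z * tv (bayes p' Q' x) (bayes p Q x)) = (\<Sum>s\<in>UNIV. z * \<bar>bayes p' Q' x s - bayes p Q x s\<bar>)"
      by (simp add: tv_def sum_distrib_left[symmetric])
    also have "\<dots> \<le> (\<Sum>s\<in>UNIV. \<bar>Q' s x - Q s x\<bar> * p s + Q' s x * \<bar>p' s - p s\<bar>
                       + \<bar>z' - z\<bar> * bayes p' Q' x s)"
    proof (rule sum_mono)
      fix s
      have "z * \<bar>bayes p' Q' x s - bayes p Q x s\<bar> = \<bar>z * (bayes p' Q' x s - bayes p Q x s)\<bar>"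
        using z by (simp add: abs_mult)
      also have "z * (bayes p' Q' x s - bayes p Q x s)
          = (z * bayes p' Q' x s - z' * bayes p' Q' x s) + (z' * bayes p' Q' x s - z * bayes p Q x s)"
        by (simp add: algebra_simps)
      also have "z' * bayes p' Q' x s - z * bayes p Q x s = Q' s x * p' s - Q s x * p s"
        using z by (simp add: bayes_def z_def[symmetric] z'_def[symmetric])
      also have "z * bayes p' Q' x s - z' * bayes p' Q' x s = (z - z') * bayes p' Q' x s"
        by (simp add: algebra_simps)
      also have "Q' s x * p' s - Q s x * p s = (Q' s x - Q s x) * p s + Q' s x * (p' s - p s)"
        by (simp add: algebra_simps)
      also have "\<bar>(z - z') * bayes p' Q' x s + ((Q' s x - Q s x) * p s + Q' s x * (p' s - p s))\<bar>
          \<le> \<bar>(z - z') * bayes p' Q' x s\<bar> + (\<bar>(Q' s x - Q s x) * p s\<bar> + \<bar>Q' s x * (p' s - p s)\<bar>)"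
        by (intro order_trans[OF abs_triangle_ineq] add_left_mono abs_triangle_ineq)
      also have "\<dots> = \<bar>Q' s x - Q s x\<bar> * p s + Q' s x * \<bar>p' s - p s\<bar>
                       + \<bar>z' - z\<bar> * bayes p' Q' x s"
        using prob_vector_nonneg[OF p, of s] prob_vector_nonneg[OF b, of s] less_imp_le[OF Q'(2)[of s x]]
        by (simp add: abs_mult abs_minus_commute)
      finally show "z * \<bar>bayes p' Q' x s - bayes p Q x s\<bar>
          \<le> \<bar>Q' s x - Q s x\<bar> * p s + Q' s x * \<bar>p' s - p s\<bar> + \<bar>z' - z\<bar> * bayes p' Q' x s" .
    qed
    also have "\<dots> = (\<Sum>s\<in>UNIV. \<bar>Q' s x - Q s x\<bar> * p s) + (\<Sum>s\<in>UNIV. Q' s x * \<bar>p' s - p s\<bar>)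
        + \<bar>z' - z\<bar>"
      by (simp add: sum.distrib sum_distrib_left[symmetric] prob_vector_sum1[OF b])
    finally show ?thesis by (simp add: z_def z'_def)
  qed
  have s1: "(\<Sum>x\<in>UNIV. \<Sum>s\<in>UNIV. \<bar>Q' s x - Q s x\<bar> * p s) \<le> 2 * \<epsilon>"
  proof -
    have "(\<Sum>x\<in>UNIV. \<Sum>s\<in>UNIV. \<bar>Q' s x - Q s x\<bar> * p s) = (\<Sum>s\<in>UNIV. 2 * tv (Q' s) (Q s) * p s)"
      by (subst sum.swap) (simp add: tv_def sum_distrib_right)
    also have "\<dots> \<le> (\<Sum>s\<in>UNIV. 2 * \<epsilon> * p s)"
      using e prob_vector_nonneg[OF p] by (intro sum_mono mult_right_mono) auto
    also have "\<dots> = 2 * \<epsilon>" by (simp add: sum_distrib_left[symmetric] prob_vector_sum1[OF p])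
    finally show ?thesis .
  qed
  have s2: "(\<Sum>x\<in>UNIV. \<Sum>s\<in>UNIV. Q' s x * \<bar>p' s - p s\<bar>) = 2 * tv p' p"
    by (subst sum.swap) (simp add: tv_def sum_distrib_right[symmetric] prob_vector_sum1[OF Q'(1)])
  have "tv (push p' Q') (push p Q) \<le> tv (push p' Q') (push p Q') + tv (push p Q') (push p Q)"
    by (rule tv_triangle)
  also have "\<dots> \<le> (1 - \<kappa>) * tv p' p + \<epsilon>"
    by (intro add_mono tv_push_contraction tv_push_kernel_le p p' Q' overlap e)
  finally have s3: "(\<Sum>x\<in>UNIV. \<bar>push p' Q' x - push p Q x\<bar>) \<le> 2 * ((1 - \<kappa>) * tv p' p + \<epsilon>)"
    by (simp add: tv_def[of "push p' Q'"])
  have "2 * (\<Sum>x\<in>UNIV. push p Q x * tv (bayes p' Q' x) (bayes p Q x))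
      \<le> (\<Sum>x\<in>UNIV. (\<Sum>s\<in>UNIV. \<bar>Q' s x - Q s x\<bar> * p s) + (\<Sum>s\<in>UNIV. Q' s x * \<bar>p' s - p s\<bar>)
        + \<bar>push p' Q' x - push p Q x\<bar>)"
    unfolding sum_distrib_left by (intro sum_mono pt)
  also have "\<dots> \<le> 2 * \<epsilon> + 2 * tv p' p + 2 * ((1 - \<kappa>) * tv p' p + \<epsilon>)"
    unfolding sum.distrib using s1 s2 s3 by linarith
  finally show ?thesis by (simp add: algebra_simps)
qed

section \<open>Beliefs and the law of the observations\<close>

definition regular_kernels :: "('s::finite, 'a) trans \<Rightarrow> ('s, 'x::finite) emission \<Rightarrow> bool" where
  "regular_kernels P Q \<longleftrightarrow>
     (\<forall>s a. prob_vector (P s a)) \<and> (\<forall>s. prob_vector (Q s)) \<and> (\<forall>s x. 0 < Q s x)"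

abbreviation predict :: "('s::finite, 'a) trans \<Rightarrow> 'a \<Rightarrow> ('s \<Rightarrow> real) \<Rightarrow> 's \<Rightarrow> real" where
  "predict P a b \<equiv> push b (\<lambda>s. P s a)"

lemma belief_Suc:
  "belief \<nu>0 P Q a x (Suc k) = bayes (predict P (a k) (belief \<nu>0 P Q a x k)) Q (x (Suc k))"
  by (simp add: bayes_def push_def fun_eq_iff)

declare belief.simps(2) [simp del]

lemma prob_vector_belief:
  assumes "prob_vector \<nu>0" "regular_kernels P Q"
  shows "prob_vector (belief \<nu>0 P Q a x k)"
proof (induction k)
  case (Suc k)
  then show ?case
    using assms(2) unfolding belief_Suc
    by (intro prob_vector_bayes prob_vector_push) (auto simp: regular_kernels_def)
qed (use assms in simp)

lemma belief_cong:
  assumes "\<And>j. j \<in> {1..k} \<Longrightarrow> x j = x' j"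
  shows "belief \<nu>0 P Q a x k = belief \<nu>0 P Q a x' k"
  using assms by (induction k) (auto simp: belief_Suc)

lemma obs_prob_cong:
  assumes "\<And>j. j \<in> {1..T} \<Longrightarrow> x j = x' j"
  shows "obs_prob \<nu>0 P Q T a x = obs_prob \<nu>0 P Q T a x'"
  unfolding obs_prob_def using assms by (auto intro!: sum.cong prod.cong)

text \<open>Joint weight of the current state and the past observations, the unnormalized belief.\<close>
fun forward ::
  "('s::finite \<Rightarrow> real) \<Rightarrow> ('s, 'a) trans \<Rightarrow> ('s, 'x) emission \<Rightarrow> (nat \<Rightarrow> 'a) \<Rightarrow> (nat \<Rightarrow> 'x) \<Rightarrow> nat \<Rightarrow> 's \<Rightarrow> real"
where
  "forward \<nu>0 P Q a x 0 = \<nu>0"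
| "forward \<nu>0 P Q a x (Suc k) =
     (\<lambda>s'. Q s' (x (Suc k)) * predict P (a k) (forward \<nu>0 P Q a x k) s')"

lemma sum_PiE_insert:
  fixes f :: "('i \<Rightarrow> 'b) \<Rightarrow> 'c::comm_monoid_add"
  assumes "j \<notin> I"
  shows "(\<Sum>s\<in>insert j I \<rightarrow>\<^sub>E B. f s) = (\<Sum>s\<in>I \<rightarrow>\<^sub>E B. \<Sum>y\<in>B. f (s(j := y)))"
proof -
  have "(\<Sum>s\<in>insert j I \<rightarrow>\<^sub>E B. f s) = (\<Sum>(y, s)\<in>B \<times> (I \<rightarrow>\<^sub>E B). f (s(j := y)))"
    unfolding PiE_insert_eq
    by (subst sum.reindex[OF inj_combinator[OF assms]]) (simp add: case_prod_unfold)
  also have "\<dots> = (\<Sum>y\<in>B. \<Sum>s\<in>I \<rightarrow>\<^sub>E B. f (s(j := y)))"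
    by (rule sum.cartesian_product[symmetric])
  also have "\<dots> = (\<Sum>s\<in>I \<rightarrow>\<^sub>E B. \<Sum>y\<in>B. f (s(j := y)))"
    by (rule sum.swap)
  finally show ?thesis .
qed

text \<open>The terminal weight \<open>g\<close> is what makes the induction on the horizon go through: the last
  transition is absorbed into it.\<close>
lemma path_sum_eq_forward:
  fixes \<nu>0 :: "'s::finite \<Rightarrow> real"
  shows "(\<Sum>s \<in> {0..T} \<rightarrow>\<^sub>E UNIV.
        \<nu>0 (s 0) * (\<Prod>k<T. P (s k) (a k) (s (Suc k)) * Q (s (Suc k)) (x (Suc k))) * g (s T))
      = (\<Sum>s\<in>UNIV. forward \<nu>0 P Q a x T s * g s)"
proof (induction T arbitrary: g)
  case 0
  show ?case
    using sum_PiE_insert[of "0::nat" "{}" "\<lambda>s. \<nu>0 (s 0) * g (s 0)" "UNIV :: 's set"] by simp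
next
  case (Suc T)
  define F where "F s = \<nu>0 (s 0) * (\<Prod>k<T. P (s k) (a k) (s (Suc k)) * Q (s (Suc k)) (x (Suc k)))"
    for s :: "nat \<Rightarrow> 's"
  have ins: "{0..Suc T} = insert (Suc T) {0..T}" by auto
  have F_upd: "F (s(Suc T := y)) = F s" for s y
    unfolding F_def by (auto intro!: prod.cong)
  have "(\<Sum>s \<in> {0..Suc T} \<rightarrow>\<^sub>E UNIV. \<nu>0 (s 0) *
          (\<Prod>k<Suc T. P (s k) (a k) (s (Suc k)) * Q (s (Suc k)) (x (Suc k))) * g (s (Suc T)))
      = (\<Sum>s \<in> {0..Suc T} \<rightarrow>\<^sub>E UNIV.
          F s * (P (s T) (a T) (s (Suc T)) * Q (s (Suc T)) (x (Suc T)) * g (s (Suc T))))"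
    by (simp add: F_def mult_ac)
  also have "\<dots> = (\<Sum>s \<in> {0..T} \<rightarrow>\<^sub>E UNIV. \<Sum>y\<in>UNIV.
          F s * (P (s T) (a T) y * Q y (x (Suc T)) * g y))"
    unfolding ins by (subst sum_PiE_insert) (auto simp: F_upd)
  also have "\<dots> = (\<Sum>s \<in> {0..T} \<rightarrow>\<^sub>E UNIV.
          F s * (\<Sum>y\<in>UNIV. P (s T) (a T) y * Q y (x (Suc T)) * g y))"
    by (simp add: sum_distrib_left)
  also have "\<dots> = (\<Sum>s\<in>UNIV. forward \<nu>0 P Q a x T s * (\<Sum>y\<in>UNIV. P s (a T) y * Q y (x (Suc T)) * g y))"
    unfolding F_def by (rule Suc)
  also have "\<dots> = (\<Sum>y\<in>UNIV. \<Sum>s\<in>UNIV. forward \<nu>0 P Q a x T s * (P s (a T) y * Q y (x (Suc T)) * g y))"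
    unfolding sum_distrib_left by (rule sum.swap)
  also have "\<dots> = (\<Sum>s\<in>UNIV. forward \<nu>0 P Q a x (Suc T) s * g s)"
    by (simp add: push_def sum_distrib_left sum_distrib_right mult_ac)
  finally show ?case .
qed

lemma obs_prob_eq_sum_forward: "obs_prob \<nu>0 P Q T a x = (\<Sum>s\<in>UNIV. forward \<nu>0 P Q a x T s)"
  using path_sum_eq_forward[where g = "\<lambda>_. 1"] by (simp add: obs_prob_def)

lemma push_scale: "push (\<lambda>s. z * p s) K x = z * push p K x"
  by (simp add: push_def sum_distrib_left mult_ac)

text \<open>The belief is the normalized forward weight, so the normalizers of the Bayes steps multiply up
  to the likelihood: each is the conditional law of the next observation.\<close>
lemma obs_prob_Suc:
  assumes "prob_vector \<nu>0" "regular_kernels P Q"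
  shows "obs_prob \<nu>0 P Q (Suc k) a x =
      obs_prob \<nu>0 P Q k a x * push (predict P (a k) (belief \<nu>0 P Q a x k)) Q (x (Suc k))"
proof -
  define Z where "Z k = obs_prob \<nu>0 P Q k a x" for k
  define b where "b k = belief \<nu>0 P Q a x k" for k
  define p where "p k = push (predict P (a k) (b k)) Q (x (Suc k))" for k
  have p: "p k > 0" for k
    unfolding p_def b_def using assms prob_vector_belief[OF assms]
    by (intro push_pos prob_vector_push) (auto simp: regular_kernels_def)
  have step: "Z (Suc k) = Z k * p k" if "forward \<nu>0 P Q a x k = (\<lambda>s. Z k * b k s)" for k
    by (simp add: Z_def[of "Suc k"] obs_prob_eq_sum_forward that push_scale p_def sum_distrib_left
        push_def[of "push (b k) (\<lambda>s. P s (a k))"] mult_ac)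
  have fw: "forward \<nu>0 P Q a x k = (\<lambda>s. Z k * b k s)" for k
  proof (induction k)
    case 0
    then show ?case
      using prob_vector_sum1[OF assms(1)] by (simp add: Z_def obs_prob_eq_sum_forward b_def)
  next
    case (Suc k)
    show ?case
      using p[of k] unfolding step[OF Suc]
      by (simp add: Suc push_scale b_def[of "Suc k"] belief_Suc b_def[of k, symmetric] bayes_def
          p_def[symmetric] fun_eq_iff)
  qed
  show ?thesis
    using step[OF fw] by (simp add: Z_def p_def b_def)
qed

lemma obs_prob_0: "prob_vector \<nu>0 \<Longrightarrow> obs_prob \<nu>0 P Q 0 a x = 1"
  by (simp add: obs_prob_eq_sum_forward prob_vector_sum1)

lemma obs_prob_nonneg:
  assumes "prob_vector \<nu>0" "regular_kernels P Q"
  shows "0 \<le> obs_prob \<nu>0 P Q k a x"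
  unfolding obs_prob_def using assms
  by (intro sum_nonneg mult_nonneg_nonneg prod_nonneg)
     (auto simp: regular_kernels_def prob_vector_nonneg less_imp_le)

section \<open>Stability of the filter\<close>

text \<open>The triangle inequality through the true belief pushed by the perturbed kernel separates
  contraction and mismatch in the prediction. The argument yields the factors \<open>2 - \<kappa>Q\<close>; they are relaxed
  to \<open>4 - 3 * \<kappa>Q\<close> and \<open>3 - 2 * \<kappa>Q\<close>, which are larger because \<open>\<kappa>Q \<le> 1\<close>.\<close>
lemma filter_step_contraction:
  fixes P P' :: "('s::finite, 'a) trans" and Q Q' :: "('s, 'x::finite) emission"
  assumes b: "prob_vector b" and b': "prob_vector b'"
    and K: "regular_kernels P Q" and K': "regular_kernels P' Q'"
    and overlapP: "\<And>s s' a. \<kappa>P \<le> (\<Sum>x\<in>UNIV. min (P' s a x) (P' s' a x))"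
    and overlapQ: "\<And>s s'. \<kappa>Q \<le> (\<Sum>x\<in>UNIV. min (Q' s x) (Q' s' x))"
    and \<kappa>: "\<kappa>P \<le> 1" "\<kappa>Q \<le> 1"
    and eP: "\<And>s a. tv (P' s a) (P s a) \<le> eP" and eQ: "\<And>s. tv (Q' s) (Q s) \<le> eQ"
  shows "(\<Sum>x\<in>UNIV. push (predict P a b) Q x *
            tv (bayes (predict P' a b') Q' x) (bayes (predict P a b) Q x))
         \<le> contraction \<kappa>P \<kappa>Q * tv b' b + ((3 - 2 * \<kappa>Q) * eP + 2 * eQ)"
proof -
  have eP0: "0 \<le> eP" using eP[of undefined undefined] tv_nonneg order_trans by blast
  have "tv (predict P' a b') (predict P a b)
      \<le> tv (predict P' a b') (predict P' a b) + tv (predict P' a b) (predict P a b)"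
    by (rule tv_triangle)
  also have "\<dots> \<le> (1 - \<kappa>P) * tv b' b + eP"
    using K' by (intro add_mono tv_push_contraction tv_push_kernel_le b b' overlapP eP)
      (auto simp: regular_kernels_def)
  finally have pred: "tv (predict P' a b') (predict P a b) \<le> (1 - \<kappa>P) * tv b' b + eP" .
  have "(\<Sum>x\<in>UNIV. push (predict P a b) Q x *
            tv (bayes (predict P' a b') Q' x) (bayes (predict P a b) Q x))
      \<le> (2 - \<kappa>Q) * tv (predict P' a b') (predict P a b) + 2 * eQ"
    using K K' by (intro bayes_expected_tv prob_vector_push b b' overlapQ eQ)
      (auto simp: regular_kernels_def)
  also have "\<dots> \<le> (2 - \<kappa>Q) * ((1 - \<kappa>P) * tv b' b + eP) + 2 * eQ"
    using pred \<kappa> by (intro add_right_mono mult_left_mono) auto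
  also have "\<dots> = (2 - \<kappa>Q) * ((1 - \<kappa>P) * tv b' b) + (2 - \<kappa>Q) * eP + 2 * eQ"
    by (simp add: distrib_left)
  also have "\<dots> \<le> (4 - 3 * \<kappa>Q) * ((1 - \<kappa>P) * tv b' b) + (3 - 2 * \<kappa>Q) * eP + 2 * eQ"
    using \<kappa> eP0 tv_nonneg[of b' b] by (intro add_right_mono add_mono mult_right_mono) auto
  finally show ?thesis by (simp add: contraction_def algebra_simps)
qed

text \<open>All that the two parametric models contribute to the belief error: two regular pairs of kernels
  and a one-step inequality with the rate \<open>\<alpha>\<close> and the mismatch \<open>c\<close>.\<close>
locale belief_perturbation =
  fixes \<nu>0 :: "'s::finite \<Rightarrow> real"
    and P P' :: "('s, 'a) trans" and Q Q' :: "('s, 'x::finite) emission"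
    and \<alpha> c :: real
  assumes prior: "prob_vector \<nu>0"
    and regular: "regular_kernels P Q" and regular': "regular_kernels P' Q'"
    and \<alpha>: "0 \<le> \<alpha>" "\<alpha> < 1" and c: "0 \<le> c"
    and step: "\<And>a b b'. prob_vector b \<Longrightarrow> prob_vector b' \<Longrightarrow>
      (\<Sum>x\<in>UNIV. push (predict P a b) Q x *
            tv (bayes (predict P' a b') Q' x) (bayes (predict P a b) Q x)) \<le> \<alpha> * tv b' b + c"
begin

definition gap :: "(nat \<Rightarrow> 'a) \<Rightarrow> (nat \<Rightarrow> 'x) \<Rightarrow> nat \<Rightarrow> real" where
  "gap a x k = tv (belief \<nu>0 P' Q' a x k) (belief \<nu>0 P Q a x k)"

lemma gap_0: "gap a x 0 = 0" and gap_nonneg: "0 \<le> gap a x k"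
  by (simp_all add: gap_def tv_nonneg) (simp add: tv_def)

lemma gap_cong: "(\<And>j. j \<in> {1..k} \<Longrightarrow> x j = x' j) \<Longrightarrow> gap a x k = gap a x' k"
  unfolding gap_def by (metis belief_cong)

text \<open>Exponential supermartingale of the accumulated error: a variable \<open>D\<close> with values in
  \<open>[0, 1]\<close> and mean at most \<open>m\<close> satisfies \<open>E (exp (l D)) \<le> 1 + (exp l - 1) m \<le> exp ((exp l - 1) m)\<close>,
  and conditionally on the past the next error has mean at most \<open>\<alpha> * gap + c\<close>.\<close>
lemma exponential_moment:
  fixes l :: real
  assumes l: "0 \<le> l"
  shows "(\<Sum>x \<in> {1..k} \<rightarrow>\<^sub>E UNIV. obs_prob \<nu>0 P Q k a x *
     exp (l * (\<Sum>h=1..k. gap a x h) - (exp l - 1) * (\<Sum>h<k. \<alpha> * gap a x h + c))) \<le> 1"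
proof (induction k)
  case 0
  show ?case by (simp add: obs_prob_0 prior)
next
  case (Suc k)
  define w where "w j x = obs_prob \<nu>0 P Q j a x *
     exp (l * (\<Sum>h=1..j. gap a x h) - (exp l - 1) * (\<Sum>h<j. \<alpha> * gap a x h + c))" for j x
  have ins: "{1..Suc k} = insert (Suc k) {1..k}" by auto
  have inner: "(\<Sum>z\<in>UNIV. w (Suc k) (x(Suc k := z))) \<le> w k x" for x
  proof -
    define b where "b = belief \<nu>0 P Q a x k"
    define b' where "b' = belief \<nu>0 P' Q' a x k"
    define q where "q = push (predict P (a k) b) Q"
    define D where "D z = tv (bayes (predict P' (a k) b') Q' z) (bayes (predict P (a k) b) Q z)" for z
    define m where "m = \<alpha> * gap a x k + c"
    have pv: "prob_vector b" "prob_vector b'"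
      using prior regular regular' by (auto simp: b_def b'_def prob_vector_belief)
    have pp: "prob_vector (predict P (a k) b)" "prob_vector (predict P' (a k) b')"
      using pv regular regular' by (auto intro!: prob_vector_push simp: regular_kernels_def)
    have pq: "prob_vector q"
      unfolding q_def using regular by (intro prob_vector_push pp) (simp add: regular_kernels_def)
    have D: "0 \<le> D z" "D z \<le> 1" for z
      unfolding D_def using pp regular regular'
      by (auto intro!: tv_nonneg tv_le_1 prob_vector_bayes simp: regular_kernels_def)
    have mean: "(\<Sum>z\<in>UNIV. q z * D z) \<le> m"
      using step[OF pv] by (simp add: q_def D_def m_def gap_def b_def b'_def)
    have beliefs: "belief \<nu>0 P Q a (x(Suc k := z)) k = b" "belief \<nu>0 P' Q' a (x(Suc k := z)) k = b'" for z
      unfolding b_def b'_def by (intro belief_cong; simp)+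
    have gap_Suc: "gap a (x(Suc k := z)) (Suc k) = D z" for z
      by (simp add: gap_def belief_Suc beliefs D_def)
    have gap_old: "gap a (x(Suc k := z)) h = gap a x h" if "h \<le> k" for h z
      using that by (intro gap_cong) auto
    have obs_Suc: "obs_prob \<nu>0 P Q (Suc k) a (x(Suc k := z)) = obs_prob \<nu>0 P Q k a x * q z" for z
    proof -
      have "obs_prob \<nu>0 P Q k a (x(Suc k := z)) = obs_prob \<nu>0 P Q k a x"
        by (intro obs_prob_cong) auto
      then show ?thesis
        by (simp add: obs_prob_Suc[OF prior regular] beliefs q_def)
    qed
    have w_Suc: "w (Suc k) (x(Suc k := z)) = w k x * exp (- ((exp l - 1) * m)) * (q z * exp (l * D z))" for z
    proof -
      have 1: "(\<Sum>h=1..Suc k. gap a (x(Suc k := z)) h) = (\<Sum>h=1..k. gap a x h) + D z"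
        by (simp add: gap_Suc gap_old)
      have 2: "(\<Sum>h<Suc k. \<alpha> * gap a (x(Suc k := z)) h + c) = (\<Sum>h<k. \<alpha> * gap a x h + c) + m"
        by (simp add: gap_old m_def)
      show ?thesis
        unfolding w_def 1 2 obs_Suc by (simp add: algebra_simps flip: exp_add)
    qed
    have mgf: "(\<Sum>z\<in>UNIV. q z * exp (l * D z)) \<le> exp ((exp l - 1) * m)"
    proof -
      have chord: "exp (l * D z) \<le> 1 + (exp l - 1) * D z" for z
      proof -
        have "exp ((1 - D z) *\<^sub>R 0 + D z *\<^sub>R l) \<le> (1 - D z) * exp 0 + D z * exp l"
          using D[of z] by (intro convex_onD[OF exp_convex]) auto
        then show ?thesis by (simp add: algebra_simps)
      qed
      have "(\<Sum>z\<in>UNIV. q z * exp (l * D z)) \<le> (\<Sum>z\<in>UNIV. q z * (1 + (exp l - 1) * D z))"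
        using prob_vector_nonneg[OF pq] chord by (intro sum_mono mult_left_mono) auto
      also have "\<dots> = (\<Sum>z\<in>UNIV. q z) + (exp l - 1) * (\<Sum>z\<in>UNIV. q z * D z)"
        by (simp add: sum_distrib_left sum.distrib[symmetric] algebra_simps)
      also have "\<dots> \<le> 1 + (exp l - 1) * m"
        using mean l by (simp add: prob_vector_sum1[OF pq] mult_left_mono)
      also have "\<dots> \<le> exp ((exp l - 1) * m)" by (rule exp_ge_add_one_self)
      finally show ?thesis .
    qed
    have "0 \<le> w k x" by (simp add: w_def obs_prob_nonneg[OF prior regular])
    then have "w k x * exp (- ((exp l - 1) * m)) * (\<Sum>z\<in>UNIV. q z * exp (l * D z))
        \<le> w k x * exp (- ((exp l - 1) * m)) * exp ((exp l - 1) * m)"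
      using mgf by (intro mult_left_mono) auto
    then show ?thesis
      unfolding w_Suc by (simp add: sum_distrib_left mult.assoc flip: exp_add)
  qed
  have "(\<Sum>x \<in> {1..Suc k} \<rightarrow>\<^sub>E UNIV. w (Suc k) x)
      = (\<Sum>x \<in> {1..k} \<rightarrow>\<^sub>E UNIV. \<Sum>z\<in>UNIV. w (Suc k) (x(Suc k := z)))"
    unfolding ins by (rule sum_PiE_insert) simp
  also have "\<dots> \<le> (\<Sum>x \<in> {1..k} \<rightarrow>\<^sub>E UNIV. w k x)"
    by (intro sum_mono inner)
  also have "\<dots> \<le> 1" using Suc by (simp add: w_def)
  finally show ?case by (simp only: w_def)
qed

end

section \<open>Choice of the exponential rate\<close>

text \<open>The second derivative of the difference is \<open>(1 - exp l * (1 - l)) / 3 \<ge> 0\<close>.\<close>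
lemma exp_quadratic_bound:
  fixes l :: real
  assumes "0 \<le> l"
  shows "(exp l - 1 - l) * (1 - l / 3) \<le> l\<^sup>2 / 2"
proof -
  define f where "f l = l\<^sup>2 / 2 - (exp l - 1 - l) * (1 - l / 3)" for l :: real
  define f' where "f' l = l - (exp l - 1) * (1 - l / 3) + (exp l - 1 - l) / 3" for l :: real
  have d1: "(f has_real_derivative f' x) (at x)" for x
    unfolding f_def f'_def by (auto intro!: derivative_eq_intros simp: field_simps)
  have d2: "(f' has_real_derivative (1 - exp x * (1 - x)) / 3) (at x)" for x
    unfolding f'_def by (auto intro!: derivative_eq_intros simp: field_simps)
  have pos2: "0 \<le> (1 - exp x * (1 - x)) / 3" for x :: real
  proof -
    have "exp x * (1 - x) \<le> exp x * exp (- x)"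
      using exp_ge_add_one_self[of "- x"] by (intro mult_left_mono) auto
    then show ?thesis by (simp flip: exp_add)
  qed
  have "f' 0 \<le> f' x" if "0 \<le> x" for x
    by (rule DERIV_nonneg_imp_nondecreasing[OF that]) (use d2 pos2 in blast)
  then have "0 \<le> f' x" if "0 \<le> x" for x using that by (simp add: f'_def)
  then have "f 0 \<le> f l"
    using d1 by (intro DERIV_nonneg_imp_nondecreasing[OF assms]) blast
  then show ?thesis by (simp add: f_def)
qed

text \<open>Rate for a Poisson-type moment bound with mean \<open>m\<close> at the deviation \<open>t\<close>, by the choice
  \<open>l = t / (m + t / 3)\<close> of Bernstein's inequality. For \<open>m = 0\<close> this choice is the pole \<open>l = 3\<close> of the
  quadratic bound, and any large rate works.\<close>
lemma poisson_rate:
  fixes m t L :: real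
  assumes m: "0 \<le> m" and t: "0 < t" and L: "0 < L" and le: "2 * L * (m + t / 3) \<le> t\<^sup>2"
  shows "\<exists>l\<ge>0. L \<le> l * (m + t) - (exp l - 1) * m"
proof (cases "m = 0")
  case True
  then show ?thesis using t L by (intro exI[of _ "L / t"]) auto
next
  case False
  then have m: "0 < m" using m by simp
  define l where "l = t / (m + t / 3)"
  define u where "u = t\<^sup>2 / (m + t / 3)"
  have l: "0 < l" "l < 3" "1 - l / 3 = m / (m + t / 3)"
    using m t by (auto simp: l_def field_simps)
  have "exp l - 1 - l \<le> (l\<^sup>2 / 2) / (1 - l / 3)"
    using exp_quadratic_bound[of l] l(1,2) by (subst pos_le_divide_eq) auto
  also have "\<dots> = t\<^sup>2 / (m + t / 3) / m / 2"
    unfolding l(3) using m t by (simp add: l_def power2_eq_square)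
  finally have "(exp l - 1 - l) * m \<le> t\<^sup>2 / (m + t / 3) / m / 2 * m"
    using m by (intro mult_right_mono) auto
  also have "\<dots> = t\<^sup>2 / (m + t / 3) / 2" using m by simp
  finally have "(exp l - 1) * m - l * m \<le> u / 2"
    by (simp only: u_def left_diff_distrib)
  moreover have "l * t = u" by (simp add: l_def u_def power2_eq_square)
  moreover have "2 * L \<le> u" unfolding u_def using le m t by (subst pos_le_divide_eq) auto
  ultimately have "L \<le> l * (m + t) - (exp l - 1) * m"
    unfolding distrib_left[of l m t] by linarith
  then show ?thesis using l by (intro exI[of _ l]) auto
qed

text \<open>At total level \<open>x\<close> per step the conditional means add up to \<open>m = c + \<alpha> * x\<close>, so the deviation is
  \<open>t = (1 - \<alpha>) * x - c\<close>; the formula for \<open>x\<close> is what makes \<open>2 * L * (m + t / 3) \<le> t\<^sup>2\<close> hold. With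
  \<open>\<beta> = \<alpha> / (1 - \<alpha>)\<close>, so that \<open>1 / (1 - \<alpha>) = 1 + \<beta>\<close>, this becomes a comparison of polynomials with
  nonnegative coefficients.\<close>
lemma belief_error_rate:
  fixes \<alpha> c L :: real
  assumes \<alpha>: "0 \<le> \<alpha>" "\<alpha> < 1" and c: "0 \<le> c" and L: "0 < L"
    and x: "x = 2 * c / (1 - \<alpha>) + 2 / (1 - \<alpha>) * sqrt (2 * c * L)
             + L / (1 - \<alpha>) * (4 / 3 + 2 * \<alpha> / (1 - \<alpha>))"
  shows "0 < x" and "\<exists>l\<ge>0. L \<le> l * x - (exp l - 1) * (c + \<alpha> * x)"
proof -
  define \<beta> where "\<beta> = \<alpha> / (1 - \<alpha>)"
  define r where "r = sqrt (2 * c * L)"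
  define t where "t = c + 2 * r + L * (4 / 3 + 2 * \<beta>)"
  have \<beta>: "0 \<le> \<beta>" using \<alpha> by (simp add: \<beta>_def)
  have r: "0 \<le> r" "r\<^sup>2 = 2 * c * L" using c L by (auto simp: r_def)
  have t: "0 < t" unfolding t_def using c r \<beta> L by (intro add_nonneg_pos) auto
  have xt: "(1 - \<alpha>) * x = c + t"
  proof -
    have "x = (c + t) / (1 - \<alpha>)"
      unfolding x t_def r_def[symmetric] by (simp add: \<beta>_def add_divide_distrib)
    then show ?thesis using \<alpha> by simp
  qed
  have x_eq: "x = (c + t) / (1 - \<alpha>)" using xt \<alpha> by (simp add: field_simps)
  show x0: "0 < x" unfolding x_eq using \<alpha> c t by auto
  have m: "c + \<alpha> * x = c * (1 + \<beta>) + \<beta> * t"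
  proof -
    have "c + \<alpha> * x = c * (1 - \<alpha>) / (1 - \<alpha>) + \<alpha> * (c + t) / (1 - \<alpha>)"
      using \<alpha> unfolding x_eq by simp
    also have "\<dots> = (c * (1 - \<alpha>) + \<alpha> * (c + t)) / (1 - \<alpha>)"
      by (rule add_divide_distrib[symmetric])
    also have "c * (1 - \<alpha>) + \<alpha> * (c + t) = c + \<alpha> * t" by (simp add: algebra_simps)
    also have "(c + \<alpha> * t) / (1 - \<alpha>) = c * (1 / (1 - \<alpha>)) + \<beta> * t" by (simp add: \<beta>_def add_divide_distrib)
    also have "1 / (1 - \<alpha>) = 1 + \<beta>" using \<alpha> by (simp add: \<beta>_def field_simps)
    finally show ?thesis .
  qed
  have xm: "x = (c + \<alpha> * x) + t" using xt by (simp add: algebra_simps)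
  have "2 * L * ((c + \<alpha> * x) + t / 3) = r\<^sup>2 * (1 + \<beta>) + t * (2 * L * (\<beta> + 1 / 3))"
    unfolding m r by (simp add: algebra_simps)
  also have "\<dots> \<le> t\<^sup>2"
  proof -
    have "r\<^sup>2 * (1 + \<beta>) \<le> 4 * r\<^sup>2 + c * (L * (4 / 3 + 2 * \<beta>))"
      using \<beta> c L unfolding r by (simp add: algebra_simps)
    also have "\<dots> \<le> (c + 2 * r + L * (4 / 3 + 2 * \<beta>)) * (c + 2 * r + L * (2 / 3))"
    proof -
      have "(c + 2 * r + L * (4 / 3 + 2 * \<beta>)) * (c + 2 * r + L * (2 / 3))
        = 4 * r\<^sup>2 + c * (L * (4 / 3 + 2 * \<beta>))
          + (c * c + 4 * c * r + c * L * (2/3) + 2 * r * L * (2/3)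
             + L * (4/3 + 2 * \<beta>) * 2 * r + L * (4/3 + 2 * \<beta>) * L * (2/3))"
        by (simp add: algebra_simps power2_eq_square)
      moreover have "0 \<le> c * c + 4 * c * r + c * L * (2/3) + 2 * r * L * (2/3)
             + L * (4/3 + 2 * \<beta>) * 2 * r + L * (4/3 + 2 * \<beta>) * L * (2/3)"
        using c L r \<beta> by (intro add_nonneg_nonneg mult_nonneg_nonneg) auto
      ultimately show ?thesis by linarith
    qed
    also have "\<dots> = t * (t - 2 * L * (\<beta> + 1 / 3))"
      unfolding t_def by (simp add: algebra_simps)
    finally show ?thesis by (simp add: algebra_simps power2_eq_square)
  qed
  finally have "2 * L * ((c + \<alpha> * x) + t / 3) \<le> t\<^sup>2" .
  moreover have "0 \<le> c + \<alpha> * x" using c \<alpha> x0 by simp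
  ultimately show "\<exists>l\<ge>0. L \<le> l * x - (exp l - 1) * (c + \<alpha> * x)"
    using poisson_rate[of "c + \<alpha> * x" t L] t L xm by simp
qed

section \<open>Tail bound for the accumulated belief error\<close>

context belief_perturbation
begin

text \<open>Chernoff's bound on the finite set of histories. The conditional means at the times \<open>h < T\<close>
  dominate the errors at the times \<open>1..T\<close>; as the error vanishes at time 0, the latter sum is at least
  the sum over \<open>h < T\<close>, and the exponent can be expressed by one sum.\<close>
lemma accumulated_gap_tail:
  fixes M :: "'w measure" and X :: "nat \<Rightarrow> 'w \<Rightarrow> 'x"
  assumes M: "prob_space M"
    and X: "\<And>k. k \<in> {1..T} \<Longrightarrow> X k \<in> measurable M (count_space UNIV)"
    and law: "\<And>x. measure M {\<omega> \<in> space M. \<forall>k\<in>{1..T}. X k \<omega> = x k} = obs_prob \<nu>0 P Q T a x"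
    and T: "1 \<le> T" and K: "0 < \<delta>" "\<delta> < K"
    and \<epsilon>: "\<epsilon> = belief_error \<alpha> c T \<delta> K"
  shows "measure M {\<omega> \<in> space M. real T * \<epsilon> < (\<Sum>h<T. gap a (\<lambda>k. X k \<omega>) h)} \<le> \<delta> / K"
proof -
  interpret prob_space M by (rule M)
  define L where "L = ln (K / \<delta>)"
  have L: "0 < L" using K by (simp add: L_def)
  have \<epsilon>_eq: "\<epsilon> = 2 * c / (1 - \<alpha>) + 2 / (1 - \<alpha>) * sqrt (2 * c * (L / real T))
             + (L / real T) / (1 - \<alpha>) * (4 / 3 + 2 * \<alpha> / (1 - \<alpha>))"
    using T by (simp add: \<epsilon> belief_error_def L_def)
  have LT: "0 < L / real T" using L T by simp
  from belief_error_rate[OF \<alpha> c LT \<epsilon>_eq]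
  obtain l where \<epsilon>0: "0 < \<epsilon>" and l: "0 \<le> l" and rate: "L / real T \<le> l * \<epsilon> - (exp l - 1) * (c + \<alpha> * \<epsilon>)"
    by blast
  define bad where "bad = {x \<in> {1..T} \<rightarrow>\<^sub>E UNIV. real T * \<epsilon> < (\<Sum>h<T. gap a x h)}"
  define E where "E x = l * (\<Sum>h=1..T. gap a x h) - (exp l - 1) * (\<Sum>h<T. \<alpha> * gap a x h + c)" for x
  have fin: "finite bad" unfolding bad_def by (simp add: finite_PiE)
  have EL: "L \<le> E x" if "x \<in> bad" for x
  proof -
    define S where "S = (\<Sum>h<T. gap a x h)"
    have S: "real T * \<epsilon> \<le> S" using that by (simp add: bad_def S_def)
    \<comment> \<open>Positivity of the coefficient makes the exponent monotone in the accumulated error.\<close>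
    have coef: "0 \<le> l - (exp l - 1) * \<alpha>"
    proof -
      have "0 \<le> (l - (exp l - 1) * \<alpha>) * \<epsilon>"
      proof -
        have "0 \<le> (exp l - 1) * c" using l c by simp
        then show ?thesis using rate LT by (simp add: algebra_simps)
      qed
      then show ?thesis using \<epsilon>0 by (simp add: zero_le_mult_iff)
    qed
    have "S \<le> (\<Sum>h<Suc T. gap a x h)" by (simp add: S_def gap_nonneg)
    also have "\<dots> = (\<Sum>h=1..T. gap a x h)"
      by (subst sum.lessThan_Suc_shift) (simp add: gap_0 sum.atLeast1_atMost_eq)
    finally have "l * S - (exp l - 1) * (\<alpha> * S + real T * c) \<le> E x"
      using l by (simp add: E_def sum.distrib sum_distrib_left[symmetric] S_def[symmetric] mult_left_mono)
    moreover have "(l - (exp l - 1) * \<alpha>) * (real T * \<epsilon>) \<le> (l - (exp l - 1) * \<alpha>) * S"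
      using coef S by (rule mult_left_mono[rotated])
    moreover have "L \<le> real T * (l * \<epsilon> - (exp l - 1) * (c + \<alpha> * \<epsilon>))"
      using rate T by (simp add: pos_divide_le_eq mult.commute)
    ultimately show ?thesis by (simp add: algebra_simps)
  qed
  define ev where "ev x = {\<omega> \<in> space M. \<forall>k\<in>{1..T}. X k \<omega> = x k}" for x
  have ev: "ev x \<in> sets M" for x
  proof -
    have "{\<omega> \<in> space M. X k \<omega> = x k} \<in> sets M" if "k \<in> {1..T}" for k
      using measurable_sets[OF X[OF that], of "{x k}"] by (simp add: vimage_def Int_def conj_commute)
    then show ?thesis unfolding ev_def by (intro sets.sets_Collect_finite_All) auto
  qed
  have "{\<omega> \<in> space M. real T * \<epsilon> < (\<Sum>h<T. gap a (\<lambda>k. X k \<omega>) h)} \<subseteq> (\<Union>x\<in>bad. ev x)"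
  proof
    fix \<omega> assume \<omega>: "\<omega> \<in> {\<omega> \<in> space M. real T * \<epsilon> < (\<Sum>h<T. gap a (\<lambda>k. X k \<omega>) h)}"
    define x where "x = restrict (\<lambda>k. X k \<omega>) {1..T}"
    have "gap a x h = gap a (\<lambda>k. X k \<omega>) h" if "h < T" for h
      using that by (intro gap_cong) (auto simp: x_def)
    then have "(\<Sum>h<T. gap a x h) = (\<Sum>h<T. gap a (\<lambda>k. X k \<omega>) h)" by simp
    then have "x \<in> bad" using \<omega> by (auto simp: bad_def x_def)
    moreover have "\<omega> \<in> ev x" using \<omega> by (simp add: ev_def x_def)
    ultimately show "\<omega> \<in> (\<Union>x\<in>bad. ev x)" by blast
  qed
  then have "measure M {\<omega> \<in> space M. real T * \<epsilon> < (\<Sum>h<T. gap a (\<lambda>k. X k \<omega>) h)}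
      \<le> measure M (\<Union>x\<in>bad. ev x)"
    using fin ev by (intro finite_measure_mono) auto
  also have "\<dots> \<le> (\<Sum>x\<in>bad. measure M (ev x))"
    using fin ev by (intro finite_measure_subadditive_finite) auto
  also have "\<dots> = (\<Sum>x\<in>bad. obs_prob \<nu>0 P Q T a x)" unfolding ev_def law ..
  also have "\<dots> \<le> (\<Sum>x\<in>bad. obs_prob \<nu>0 P Q T a x * exp (E x) * exp (- L))"
  proof (rule sum_mono)
    fix x assume "x \<in> bad"
    then have "1 \<le> exp (E x) * exp (- L)" using EL by (simp flip: exp_add)
    then show "obs_prob \<nu>0 P Q T a x \<le> obs_prob \<nu>0 P Q T a x * exp (E x) * exp (- L)"
      using mult_left_mono[OF _ obs_prob_nonneg[OF prior regular, of T a x]] by (fastforce simp: mult.assoc)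
  qed
  also have "\<dots> \<le> (\<Sum>x\<in>{1..T} \<rightarrow>\<^sub>E UNIV. obs_prob \<nu>0 P Q T a x * exp (E x)) * exp (- L)"
    unfolding sum_distrib_right
    by (rule sum_mono2) (auto simp: bad_def finite_PiE obs_prob_nonneg[OF prior regular])
  also have "\<dots> \<le> 1 * exp (- L)"
    unfolding E_def by (intro mult_right_mono exponential_moment l) auto
  also have "\<dots> = \<delta> / K" using K by (simp add: L_def exp_minus)
  finally show ?thesis .
qed

end

section \<open>Gaussian integrals\<close>

text \<open>Density of the centred isotropic Gaussian law with standard deviation \<open>\<sigma>\<close> in each coordinate.\<close>
definition gauss :: "real \<Rightarrow> 'a::euclidean_space \<Rightarrow> real" where
  "gauss \<sigma> u = (\<Prod>b\<in>Basis. normal_density 0 \<sigma> (u \<bullet> b))"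

lemma gauss_nonneg: "0 \<le> gauss \<sigma> u"
  by (simp add: gauss_def prod_nonneg)

lemma borel_measurable_gauss [measurable]:
  assumes [measurable]: "f \<in> borel_measurable M" "g \<in> borel_measurable M"
  shows "(\<lambda>x. gauss (f x) (g x :: 'a::euclidean_space)) \<in> borel_measurable M"
  unfolding gauss_def normal_density_def by measurable

lemma gauss_eq:
  fixes u :: "'a::euclidean_space"
  shows "gauss \<sigma> u = (1 / sqrt (2 * pi * \<sigma>\<^sup>2)) ^ DIM('a) * exp (- (norm u)\<^sup>2 / (2 * \<sigma>\<^sup>2))"
proof -
  have "(norm u)\<^sup>2 = (\<Sum>b\<in>Basis. (u \<bullet> b)\<^sup>2)"
    by (simp add: norm_eq_sqrt_inner euclidean_inner[of u u] power2_eq_square sum_nonneg)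
  then show ?thesis
    by (simp add: gauss_def normal_density_def prod.distrib exp_sum[symmetric] sum_negf
        sum_divide_distrib power_divide prod_dividef flip: minus_divide_left)
qed

text \<open>Lebesgue measure on a Euclidean space is the image of the product measure over its basis.\<close>
lemma integral_prod_lborel:
  fixes f :: "'a::euclidean_space \<Rightarrow> real \<Rightarrow> real"
  assumes "\<And>b. b \<in> Basis \<Longrightarrow> integrable lborel (f b)"
  shows "has_bochner_integral lborel (\<lambda>u. \<Prod>b\<in>Basis. f b (u \<bullet> b)) (\<Prod>b\<in>Basis. \<integral>x. f b x \<partial>lborel)"
proof -
  interpret product_sigma_finite "\<lambda>_::'a. lborel :: real measure" ..
  have [measurable]: "\<And>b. b \<in> Basis \<Longrightarrow> f b \<in> borel_measurable borel"
    using borel_measurable_integrable[OF assms] by simp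
  have meas: "(\<lambda>u::'a. \<Prod>b\<in>Basis. f b (u \<bullet> b)) \<in> borel_measurable borel" by measurable
  have map: "(\<lambda>f. \<Sum>b\<in>Basis. f b *\<^sub>R b) \<in> measurable (\<Pi>\<^sub>M b\<in>(Basis::'a set). lborel) (borel :: 'a measure)"
    by measurable
  have ev: "(\<Prod>b\<in>Basis. f b ((\<Sum>b'\<in>Basis. x b' *\<^sub>R b') \<bullet> b)) = (\<Prod>b\<in>Basis. f b (x b))" for x
    by (intro prod.cong refl) simp
  show ?thesis
    unfolding has_bochner_integral_iff lborel_eq[where 'a='a]
      integrable_distr_eq[OF map meas] integral_distr[OF map meas] ev
    using assms by (auto intro!: product_integrable_prod product_integral_prod)
qed

lemma has_integral_gauss:
  assumes "0 < \<sigma>"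
  shows "has_bochner_integral lborel (gauss \<sigma> :: 'a::euclidean_space \<Rightarrow> real) 1"
  using integral_prod_lborel[of "\<lambda>_. normal_density 0 \<sigma>"] assms
  by (simp add: gauss_def[abs_def] integrable_normal_density integral_normal_density)

lemma normal_density_moments:
  assumes "0 < \<sigma>"
  shows "has_bochner_integral lborel (\<lambda>x. normal_density 0 \<sigma> x * x) 0"
    and "has_bochner_integral lborel (\<lambda>x. normal_density 0 \<sigma> x * x * x) (\<sigma>\<^sup>2)"
proof -
  show "has_bochner_integral lborel (\<lambda>x. normal_density 0 \<sigma> x * x) 0"
    using normal_moment_nz_1[OF assms, of 0] by simp
  show "has_bochner_integral lborel (\<lambda>x. normal_density 0 \<sigma> x * x * x) (\<sigma>\<^sup>2)"
    using normal_moment_even[OF assms, of 0 1]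
    by (simp add: power2_eq_square mult.assoc)
qed

text \<open>The integrand is a product of one-dimensional functions; the coordinates \<open>b\<close> and \<open>b'\<close> carry an
  additional linear factor each, whose mean vanishes if they differ.\<close>
lemma gauss_covariance:
  fixes b b' :: "'a::euclidean_space"
  assumes \<sigma>: "0 < \<sigma>" and b: "b \<in> Basis" "b' \<in> Basis"
  shows "has_bochner_integral lborel (\<lambda>u. gauss \<sigma> u * ((u \<bullet> b) * (u \<bullet> b'))) (if b = b' then \<sigma>\<^sup>2 else 0)"
proof -
  define f where "f c x = normal_density 0 \<sigma> x * (if c = b then x else 1) * (if c = b' then x else 1)"
    for c :: 'a and x
  have f_abs: "f c = (\<lambda>x. normal_density 0 \<sigma> x * (if c = b then x else 1) * (if c = b' then x else 1))" for c
    by (simp add: f_def fun_eq_iff)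
  have int: "integrable lborel (f c)" and
    val: "(\<integral>x. f c x \<partial>lborel) = (if c = b then (if c = b' then \<sigma>\<^sup>2 else 0) else if c = b' then 0 else 1)" for c
    using normal_density_moments[OF \<sigma>] \<sigma> unfolding f_abs
    by (cases "c = b"; cases "c = b'"; simp add: has_bochner_integral_iff)+
  have "(\<Prod>c\<in>Basis. f c (u \<bullet> c)) = gauss \<sigma> u * ((u \<bullet> b) * (u \<bullet> b'))" for u
    using b by (simp add: f_def prod.distrib gauss_def prod.delta mult.assoc)
  moreover have "(\<Prod>c\<in>Basis. \<integral>x. f c x \<partial>lborel) = (if b = b' then \<sigma>\<^sup>2 else 0)"
  proof (cases "b = b'")
    case True
    have "(\<Prod>c\<in>Basis. \<integral>x. f c x \<partial>lborel) = (\<Prod>c\<in>Basis. if c = b then \<sigma>\<^sup>2 else 1)"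
      unfolding val using True by (intro prod.cong) auto
    then show ?thesis using True b by simp
  next
    case False
    then show ?thesis unfolding val using b by (auto intro!: prod_zero bexI[of _ b])
  qed
  ultimately show ?thesis using integral_prod_lborel[of f, OF int] by simp
qed

lemma gauss_second_moment:
  fixes v :: "'a::euclidean_space"
  assumes \<sigma>: "0 < \<sigma>"
  shows "has_bochner_integral lborel (\<lambda>u. gauss \<sigma> u * (u \<bullet> v)\<^sup>2) (\<sigma>\<^sup>2 * (norm v)\<^sup>2)"
proof -
  have "has_bochner_integral lborel
      (\<lambda>u. \<Sum>b\<in>Basis. \<Sum>b'\<in>Basis. (v \<bullet> b) * (v \<bullet> b') * (gauss \<sigma> u * ((u \<bullet> b) * (u \<bullet> b'))))
      (\<Sum>b\<in>Basis. \<Sum>b'\<in>Basis. (v \<bullet> b) * (v \<bullet> b') * (if b = b' then \<sigma>\<^sup>2 else 0))"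
    by (intro has_bochner_integral_sum has_bochner_integral_mult_right gauss_covariance \<sigma>)
  also have "(\<lambda>u. \<Sum>b\<in>Basis. \<Sum>b'\<in>Basis. (v \<bullet> b) * (v \<bullet> b') * (gauss \<sigma> u * ((u \<bullet> b) * (u \<bullet> b'))))
      = (\<lambda>u. gauss \<sigma> u * (u \<bullet> v)\<^sup>2)"
  proof
    fix u :: 'a
    have "gauss \<sigma> u * (u \<bullet> v)\<^sup>2 = gauss \<sigma> u * ((\<Sum>b\<in>Basis. (u \<bullet> b) * (v \<bullet> b)) * (\<Sum>b\<in>Basis. (u \<bullet> b) * (v \<bullet> b)))"
      by (simp add: power2_eq_square euclidean_inner[of u v])
    also have "\<dots> = (\<Sum>b\<in>Basis. \<Sum>b'\<in>Basis. (v \<bullet> b) * (v \<bullet> b') * (gauss \<sigma> u * ((u \<bullet> b) * (u \<bullet> b'))))"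
      unfolding sum_product unfolding sum_distrib_left by (intro sum.cong refl) (simp only: mult_ac)
    finally show "(\<Sum>b\<in>Basis. \<Sum>b'\<in>Basis. (v \<bullet> b) * (v \<bullet> b') * (gauss \<sigma> u * ((u \<bullet> b) * (u \<bullet> b'))))
      = gauss \<sigma> u * (u \<bullet> v)\<^sup>2" ..
  qed
  also have "(\<Sum>b\<in>Basis. \<Sum>b'\<in>Basis. (v \<bullet> b) * (v \<bullet> b') * (if b = b' then \<sigma>\<^sup>2 else 0))
      = \<sigma>\<^sup>2 * (norm v)\<^sup>2"
    by (simp add: norm_eq_sqrt_inner euclidean_inner[of v v] sum_nonneg sum_distrib_left mult_ac
        if_distrib[of "\<lambda>x. _ * x"] cong: if_cong)
  finally show ?thesis .
qed

lemma gauss_norm_moment: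
  assumes \<sigma>: "0 < \<sigma>"
  shows "has_bochner_integral lborel (\<lambda>u::'a::euclidean_space. gauss \<sigma> u * (norm u)\<^sup>2) (real DIM('a) * \<sigma>\<^sup>2)"
proof -
  have "has_bochner_integral lborel (\<lambda>u::'a. \<Sum>b\<in>Basis. gauss \<sigma> u * (u \<bullet> b)\<^sup>2) (\<Sum>b\<in>(Basis::'a set). \<sigma>\<^sup>2 * (norm b)\<^sup>2)"
    by (intro has_bochner_integral_sum gauss_second_moment \<sigma>)
  moreover have "(\<Sum>b\<in>Basis. gauss \<sigma> u * (u \<bullet> b)\<^sup>2) = gauss \<sigma> u * (norm u)\<^sup>2" for u :: 'a
    by (simp add: norm_eq_sqrt_inner euclidean_inner[of u u] sum_nonneg sum_distrib_left power2_eq_square)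
  ultimately show ?thesis by simp
qed

text \<open>Quadratic form of the regularized design matrix \<open>(\<Sum>i\<in>I. \<phi> i (\<phi> i)\<^sup>T) + l I\<close>.\<close>
definition ridge_form :: "real \<Rightarrow> 'i set \<Rightarrow> ('i \<Rightarrow> 'a::euclidean_space) \<Rightarrow> 'a \<Rightarrow> real" where
  "ridge_form l I \<phi> u = (\<Sum>i\<in>I. (u \<bullet> \<phi> i)\<^sup>2) + l * (norm u)\<^sup>2"

lemma integral_le_nn_integral:
  fixes f g :: "'a \<Rightarrow> real"
  assumes "has_bochner_integral M g c" and "\<And>x. g x \<le> f x"
  shows "ennreal c \<le> (\<integral>\<^sup>+x. ennreal (f x) \<partial>M)"
proof -
  have int: "integrable M g" and c: "integral\<^sup>L M g = c"
    using assms(1) by (auto simp: has_bochner_integral_iff)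
  have "c \<le> (\<integral>x. max 0 (g x) \<partial>M)"
    unfolding c[symmetric] by (rule integral_mono) (use int in auto)
  then have "ennreal c \<le> ennreal (\<integral>x. max 0 (g x) \<partial>M)" by (rule ennreal_leI)
  also have "\<dots> = (\<integral>\<^sup>+x. ennreal (max 0 (g x)) \<partial>M)"
    by (rule nn_integral_eq_integral[symmetric]) (use int in auto)
  also have "\<dots> \<le> (\<integral>\<^sup>+x. ennreal (f x) \<partial>M)"
    using assms(2) by (intro nn_integral_mono) (auto simp: ennreal_leI max_def)
  finally show ?thesis .
qed

text \<open>Compare the form with the isotropic one of the same trace \<open>A\<close>, that is, take the Gaussian of
  variance \<open>DIM('a) / A\<close>: under it the difference of the two exponents has mean zero, so Jensen's
  inequality (here just \<open>1 + x \<le> exp x\<close>) gives the bound. In effect the determinant of the form is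
  replaced by a power of its trace.\<close>
lemma gaussian_integral_trace_bound:
  fixes \<phi> :: "'i \<Rightarrow> 'a::euclidean_space" and I :: "'i set"
  assumes l: "0 < l"
  defines "A \<equiv> (\<Sum>i\<in>I. (norm (\<phi> i))\<^sup>2) + real DIM('a) * l"
  shows "ennreal (sqrt (2 * pi * (real DIM('a) / A)) ^ DIM('a))
      \<le> (\<integral>\<^sup>+u. ennreal (exp (- ridge_form l I \<phi> u / 2)) \<partial>lborel)"
proof -
  define \<sigma> where "\<sigma> = sqrt (real DIM('a) / A)"
  have A: "0 < A" unfolding A_def using l by (intro add_nonneg_pos sum_nonneg) auto
  have \<sigma>: "0 < \<sigma>" and \<sigma>2: "\<sigma>\<^sup>2 = real DIM('a) / A" using A by (auto simp: \<sigma>_def)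
  define C where "C = sqrt (2 * pi * \<sigma>\<^sup>2) ^ DIM('a)"
  have C: "0 < C" using \<sigma> by (simp add: C_def)
  define g where "g u = C * (gauss \<sigma> u - (1/2) * ((\<Sum>i\<in>I. gauss \<sigma> u * (u \<bullet> \<phi> i)\<^sup>2) + l * (gauss \<sigma> u * (norm u)\<^sup>2))
      + (1 / (2 * \<sigma>\<^sup>2)) * (gauss \<sigma> u * (norm u)\<^sup>2))" for u
  have "has_bochner_integral lborel g
      (C * (1 - (1/2) * ((\<Sum>i\<in>I. \<sigma>\<^sup>2 * (norm (\<phi> i))\<^sup>2) + l * (real DIM('a) * \<sigma>\<^sup>2))
       + (1 / (2 * \<sigma>\<^sup>2)) * (real DIM('a) * \<sigma>\<^sup>2)))"
    unfolding g_def
    by (intro has_bochner_integral_mult_right has_bochner_integral_add has_bochner_integral_diff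
        has_bochner_integral_sum has_integral_gauss gauss_second_moment gauss_norm_moment \<sigma>)
  also have "(\<Sum>i\<in>I. \<sigma>\<^sup>2 * (norm (\<phi> i))\<^sup>2) + l * (real DIM('a) * \<sigma>\<^sup>2) = \<sigma>\<^sup>2 * A"
    by (simp add: A_def sum_distrib_left algebra_simps)
  also have "C * (1 - (1/2) * (\<sigma>\<^sup>2 * A) + (1 / (2 * \<sigma>\<^sup>2)) * (real DIM('a) * \<sigma>\<^sup>2)) = C"
    using A \<sigma> by (simp add: \<sigma>2)
  finally have int: "has_bochner_integral lborel g C" .
  have "g u \<le> exp (- ridge_form l I \<phi> u / 2)" for u
  proof -
    have "exp (- ridge_form l I \<phi> u / 2) = C * gauss \<sigma> u * exp ((norm u)\<^sup>2 / (2 * \<sigma>\<^sup>2) - ridge_form l I \<phi> u / 2)"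
    proof -
      have "C * gauss \<sigma> u = exp (- (norm u)\<^sup>2 / (2 * \<sigma>\<^sup>2))"
        using \<sigma> by (simp add: C_def gauss_eq power_one_over)
      then show ?thesis by (simp flip: exp_add)
    qed
    also have "\<dots> \<ge> C * gauss \<sigma> u * (1 + ((norm u)\<^sup>2 / (2 * \<sigma>\<^sup>2) - ridge_form l I \<phi> u / 2))"
      using C by (intro mult_left_mono exp_ge_add_one_self) (simp add: gauss_nonneg)
    also have "C * gauss \<sigma> u * (1 + ((norm u)\<^sup>2 / (2 * \<sigma>\<^sup>2) - ridge_form l I \<phi> u / 2)) = g u"
      by (simp add: g_def ridge_form_def algebra_simps sum_distrib_left add_divide_distrib)
    finally show ?thesis .
  qed
  from integral_le_nn_integral[OF int this] show ?thesis
    by (simp add: C_def \<sigma>2)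
qed

section \<open>Self-normalized bound by the method of mixtures\<close>

text \<open>The exponential martingale \<open>exp (u \<bullet> S - (\<Sum> (u \<bullet> \<phi> i)\<^sup>2) / 2)\<close>, averaged over a Gaussian
  direction \<open>u\<close> of precision \<open>l\<close>.\<close>
definition mixture :: "real \<Rightarrow> 'i set \<Rightarrow> ('i \<Rightarrow> real) \<Rightarrow> ('i \<Rightarrow> 'a::euclidean_space) \<Rightarrow> ennreal" where
  "mixture l I \<eta> \<phi> = (\<integral>\<^sup>+u. ennreal (exp (\<Sum>i\<in>I. \<eta> i * (u \<bullet> \<phi> i) - (u \<bullet> \<phi> i)\<^sup>2 / 2))
      * ennreal (gauss (1 / sqrt l) u) \<partial>lborel)"

lemma ridge_form_nonneg: "0 < l \<Longrightarrow> 0 \<le> ridge_form l I \<phi> u"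
  by (simp add: ridge_form_def sum_nonneg)

lemma ridge_form_pos: "0 < l \<Longrightarrow> u \<noteq> 0 \<Longrightarrow> 0 < ridge_form l I \<phi> u"
  unfolding ridge_form_def by (intro add_nonneg_pos sum_nonneg) auto

text \<open>The centre \<open>w\<close> solves the normal equations, which are solvable because the form is positive
  definite; working with \<open>w\<close> avoids inverse matrices.\<close>
lemma complete_square:
  fixes \<phi> :: "'i \<Rightarrow> 'a::euclidean_space" and I :: "'i set"
  assumes l: "0 < l"
  obtains w where
    "\<And>u. u \<bullet> S - ridge_form l I \<phi> u / 2 = ridge_form l I \<phi> w / 2 - ridge_form l I \<phi> (u - w) / 2"
proof -
  define f where "f w = (\<Sum>i\<in>I. (\<phi> i \<bullet> w) *\<^sub>R \<phi> i) + l *\<^sub>R w" for w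
  have lin: "linear f"
    unfolding f_def
    by (rule linearI)
       (simp_all add: inner_add_right scaleR_add_left scaleR_add_right sum.distrib scaleR_sum_right
         algebra_simps)
  have fq: "w \<bullet> f w = ridge_form l I \<phi> w" for w
    by (simp add: f_def ridge_form_def inner_add_right inner_sum_right power2_eq_square
        inner_commute power2_norm_eq_inner[unfolded power2_eq_square])
  have "inj f"
  proof (subst linear_injective_0[OF lin], intro allI impI)
    fix w assume "f w = 0"
    then have "ridge_form l I \<phi> w = 0" using fq[of w] by simp
    then show "w = 0" using ridge_form_pos[OF l, of w I \<phi>] by fastforce
  qed
  then have "surj f" using lin linear_injective_imp_surjective by blast
  then obtain w where w: "f w = S" by (metis surjD)
  have expand: "ridge_form l I \<phi> (u - w) = ridge_form l I \<phi> u + ridge_form l I \<phi> w - 2 * (u \<bullet> f w)" for u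
  proof -
    have 1: "((u - w) \<bullet> \<phi> i)\<^sup>2 = (u \<bullet> \<phi> i)\<^sup>2 + (w \<bullet> \<phi> i)\<^sup>2 - 2 * ((\<phi> i \<bullet> w) * (u \<bullet> \<phi> i))" for i
      by (simp add: inner_diff_left power2_eq_square algebra_simps inner_commute)
    have 2: "(norm (u - w))\<^sup>2 = (norm u)\<^sup>2 + (norm w)\<^sup>2 - 2 * (u \<bullet> w)"
      by (simp add: power2_norm_eq_inner inner_diff_left inner_diff_right inner_commute)
    show ?thesis
      unfolding ridge_form_def 1 2
      by (simp add: f_def inner_add_right inner_sum_right sum.distrib sum_subtractf
          sum_distrib_left[symmetric] algebra_simps)
  qed
  show thesis
    by (rule that[of w]) (simp add: expand w field_simps)
qed

text \<open>The Gaussian weight supplies the term \<open>l * (norm u)\<^sup>2\<close> of the form. After completing the square the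
  centre is removed by translation invariance of Lebesgue measure.\<close>
lemma mixture_lower_bound:
  fixes \<phi> :: "'i \<Rightarrow> 'a::euclidean_space" and I :: "'i set"
  assumes l: "0 < l"
  defines "A \<equiv> (\<Sum>i\<in>I. (norm (\<phi> i))\<^sup>2) + real DIM('a) * l"
  assumes w: "\<And>u. u \<bullet> (\<Sum>i\<in>I. \<eta> i *\<^sub>R \<phi> i) - ridge_form l I \<phi> u / 2
      = ridge_form l I \<phi> w / 2 - ridge_form l I \<phi> (u - w) / 2"
  shows "ennreal (sqrt (real DIM('a) * l / A) ^ DIM('a) * exp (ridge_form l I \<phi> w / 2)) \<le> mixture l I \<eta> \<phi>"
proof -
  define C where "C = sqrt (l / (2 * pi)) ^ DIM('a)"
  have C: "0 \<le> C" using l by (simp add: C_def)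
  have gauss_l: "gauss (1 / sqrt l) u = C * exp (- l * (norm u)\<^sup>2 / 2)" for u :: 'a
    using l by (simp add: gauss_eq C_def power_divide real_sqrt_divide mult.commute)
  have integrand: "exp (\<Sum>i\<in>I. \<eta> i * (u \<bullet> \<phi> i) - (u \<bullet> \<phi> i)\<^sup>2 / 2) * gauss (1 / sqrt l) u
      = C * exp (ridge_form l I \<phi> w / 2) * exp (- ridge_form l I \<phi> (u - w) / 2)" for u
  proof -
    have "(\<Sum>i\<in>I. \<eta> i * (u \<bullet> \<phi> i) - (u \<bullet> \<phi> i)\<^sup>2 / 2) + (- l * (norm u)\<^sup>2 / 2)
        = u \<bullet> (\<Sum>i\<in>I. \<eta> i *\<^sub>R \<phi> i) - ridge_form l I \<phi> u / 2"
      by (simp add: ridge_form_def inner_sum_right sum_subtractf sum_divide_distrib add_divide_distrib)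
    then show ?thesis unfolding gauss_l w by (simp add: mult.left_commute mult.commute flip: exp_add)
  qed
  have [measurable]: "(\<lambda>u. ridge_form l I \<phi> (f u)) \<in> borel_measurable N"
    if "f \<in> borel_measurable N" for f :: "'b \<Rightarrow> 'a" and N
    using that unfolding ridge_form_def by measurable
  have "mixture l I \<eta> \<phi> = (\<integral>\<^sup>+u. ennreal (C * exp (ridge_form l I \<phi> w / 2))
      * ennreal (exp (- ridge_form l I \<phi> (u - w) / 2)) \<partial>lborel)"
    unfolding mixture_def
    by (intro nn_integral_cong, subst ennreal_mult''[symmetric])
       (auto simp: gauss_nonneg integrand ennreal_mult C)
  also have "\<dots> = ennreal (C * exp (ridge_form l I \<phi> w / 2))
      * (\<integral>\<^sup>+u. ennreal (exp (- ridge_form l I \<phi> (u - w) / 2)) \<partial>lborel)"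
    by (rule nn_integral_cmult) measurable
  also have "(\<integral>\<^sup>+u. ennreal (exp (- ridge_form l I \<phi> (u - w) / 2)) \<partial>lborel)
      = (\<integral>\<^sup>+u. ennreal (exp (- ridge_form l I \<phi> u / 2)) \<partial>lborel)"
  proof -
    have "(\<integral>\<^sup>+u. ennreal (exp (- ridge_form l I \<phi> u / 2)) \<partial>lborel)
        = (\<integral>\<^sup>+u. ennreal (exp (- ridge_form l I \<phi> u / 2)) \<partial>distr lborel borel ((+) (- w)))"
      by (simp add: lborel_distr_plus)
    also have "\<dots> = (\<integral>\<^sup>+u. ennreal (exp (- ridge_form l I \<phi> (- w + u) / 2)) \<partial>lborel)"
      by (subst nn_integral_distr) auto
    finally show ?thesis by simp
  qed
  also have "ennreal (C * exp (ridge_form l I \<phi> w / 2)) * (\<integral>\<^sup>+u. ennreal (exp (- ridge_form l I \<phi> u / 2)) \<partial>lborel)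
      \<ge> ennreal (C * exp (ridge_form l I \<phi> w / 2)) * ennreal (sqrt (2 * pi * (real DIM('a) / A)) ^ DIM('a))"
    unfolding A_def using l by (intro mult_left_mono gaussian_integral_trace_bound) auto
  also have "ennreal (C * exp (ridge_form l I \<phi> w / 2)) * ennreal (sqrt (2 * pi * (real DIM('a) / A)) ^ DIM('a))
      = ennreal (sqrt (real DIM('a) * l / A) ^ DIM('a) * exp (ridge_form l I \<phi> w / 2))"
  proof -
    have "0 \<le> A" unfolding A_def using l by (intro add_nonneg_nonneg sum_nonneg) auto
    have "sqrt (l / (2 * pi)) * sqrt (2 * pi * (real DIM('a) / A)) = sqrt (real DIM('a) * l / A)"
      by (simp flip: real_sqrt_mult)
    then have "C * sqrt (2 * pi * (real DIM('a) / A)) ^ DIM('a) = sqrt (real DIM('a) * l / A) ^ DIM('a)"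
      unfolding C_def power_mult_distrib[symmetric] by simp
    then have "C * exp (ridge_form l I \<phi> w / 2) * sqrt (2 * pi * (real DIM('a) / A)) ^ DIM('a)
        = sqrt (real DIM('a) * l / A) ^ DIM('a) * exp (ridge_form l I \<phi> w / 2)"
      by (metis mult.assoc mult.commute)
    moreover have "ennreal (C * exp (ridge_form l I \<phi> w / 2)) * ennreal (sqrt (2 * pi * (real DIM('a) / A)) ^ DIM('a))
        = ennreal (C * exp (ridge_form l I \<phi> w / 2) * sqrt (2 * pi * (real DIM('a) / A)) ^ DIM('a))"
      by (rule ennreal_mult[symmetric]) (use C \<open>0 \<le> A\<close> in auto)
    ultimately show ?thesis by (simp only:)
  qed
  finally show ?thesis .
qed

text \<open>With \<open>w\<close> the centre of the square, the bound on the mixture says \<open>ridge_form l I \<phi> w \<le> R\<close>. This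
  controls \<open>u \<bullet> S - ridge_form l I \<phi> u / 2\<close> for all \<open>u\<close>, and optimizing over the multiples of \<open>v\<close>
  gives the Cauchy-Schwarz type conclusion.\<close>
lemma self_normalized_bound:
  fixes \<phi> :: "'i \<Rightarrow> 'a::euclidean_space" and I :: "'i set"
  assumes l: "0 < l" and \<delta>: "0 < \<delta>" "\<delta> < 1"
    and mix: "mixture l I \<eta> \<phi> \<le> ennreal (1 / \<delta>)"
  defines "R \<equiv> real DIM('a) * ln (1 + (\<Sum>i\<in>I. (norm (\<phi> i))\<^sup>2) / (real DIM('a) * l)) + 2 * ln (1 / \<delta>)"
  shows "(\<Sum>i\<in>I. \<eta> i * (v \<bullet> \<phi> i)) \<le> sqrt R * sqrt (ridge_form l I \<phi> v)"
proof -
  define S where "S = (\<Sum>i\<in>I. \<eta> i *\<^sub>R \<phi> i)"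
  define A where "A = (\<Sum>i\<in>I. (norm (\<phi> i))\<^sup>2) + real DIM('a) * l"
  obtain w where w: "\<And>u. u \<bullet> S - ridge_form l I \<phi> u / 2
      = ridge_form l I \<phi> w / 2 - ridge_form l I \<phi> (u - w) / 2"
    using complete_square[OF l] by blast
  have A: "0 < A" unfolding A_def using l by (intro add_nonneg_pos sum_nonneg) auto
  define r where "r = real DIM('a) * l / A"
  have r: "0 < r" using A l by (simp add: r_def)
  have r_inv: "1 / r = 1 + (\<Sum>i\<in>I. (norm (\<phi> i))\<^sup>2) / (real DIM('a) * l)"
    using l A by (simp add: r_def A_def add_divide_distrib)
  have "ennreal (sqrt r ^ DIM('a) * exp (ridge_form l I \<phi> w / 2)) \<le> ennreal (1 / \<delta>)"
    using mixture_lower_bound[OF l w[unfolded S_def]] mix unfolding r_def A_def by (rule order_trans)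
  then have "sqrt r ^ DIM('a) * exp (ridge_form l I \<phi> w / 2) \<le> 1 / \<delta>"
    using \<delta> by (subst (asm) ennreal_le_iff) auto
  then have "ln (sqrt r ^ DIM('a) * exp (ridge_form l I \<phi> w / 2)) \<le> ln (1 / \<delta>)"
    using r by (intro ln_mono) auto
  moreover have "ln (sqrt r ^ DIM('a) * exp (ridge_form l I \<phi> w / 2))
      = real DIM('a) * (ln r / 2) + ridge_form l I \<phi> w / 2"
    using r by (simp add: ln_mult ln_realpow ln_sqrt)
  moreover have "ln (1 / r) = - ln r" using r by (simp add: ln_div)
  ultimately have qw: "ridge_form l I \<phi> w \<le> R"
    unfolding R_def r_inv[symmetric] by simp
  have R: "0 < R"
    unfolding R_def using l \<delta>
    by (intro add_nonneg_pos mult_nonneg_nonneg ln_ge_zero) (auto simp: sum_nonneg)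
  have Sv: "(\<Sum>i\<in>I. \<eta> i * (v \<bullet> \<phi> i)) = v \<bullet> S" by (simp add: S_def inner_sum_right)
  show ?thesis
  proof (cases "v = 0")
    case True
    then show ?thesis by (simp add: ridge_form_def)
  next
    case False
    define q where "q = ridge_form l I \<phi> v"
    have q: "0 < q" unfolding q_def using ridge_form_pos[OF l False] .
    define s where "s = sqrt R / sqrt q"
    have s: "0 < s" "s\<^sup>2 * q = R" using R q by (auto simp: s_def power_divide)
    have "(s *\<^sub>R v) \<bullet> S - ridge_form l I \<phi> (s *\<^sub>R v) / 2 \<le> R / 2"
      unfolding w using qw ridge_form_nonneg[OF l, of I \<phi> "s *\<^sub>R v - w"] by simp
    moreover have "ridge_form l I \<phi> (s *\<^sub>R v) = s\<^sup>2 * q"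
      by (simp add: ridge_form_def q_def power_mult_distrib sum_distrib_left algebra_simps)
    ultimately have "s * (v \<bullet> S) \<le> R" using s by simp
    then have "v \<bullet> S \<le> R / s" using s by (simp add: pos_le_divide_eq mult.commute)
    also have "R / s = R / sqrt R * sqrt q" by (simp add: s_def)
    also have "R / sqrt R = sqrt R" using R by (simp add: real_div_sqrt)
    finally show ?thesis by (simp add: Sv q_def)
  qed
qed

lemma borel_measurable_mixture [measurable]:
  fixes \<phi> :: "'i \<Rightarrow> 'b \<Rightarrow> 'a::euclidean_space"
  assumes [measurable]: "l \<in> borel_measurable N"
    "\<And>i. i \<in> I \<Longrightarrow> \<eta> i \<in> borel_measurable N" "\<And>i. i \<in> I \<Longrightarrow> \<phi> i \<in> borel_measurable N"
  shows "(\<lambda>x. mixture (l x) I (\<lambda>i. \<eta> i x) (\<lambda>i. \<phi> i x)) \<in> borel_measurable N"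
  unfolding mixture_def by measurable

lemma (in prob_space) expectation_mixture_le_1:
  fixes \<phi> :: "'i \<Rightarrow> 'a \<Rightarrow> 'b::euclidean_space"
  assumes l: "0 < l"
    and [measurable]: "\<And>i. i \<in> I \<Longrightarrow> \<eta> i \<in> borel_measurable M" "\<And>i. i \<in> I \<Longrightarrow> \<phi> i \<in> borel_measurable M"
    and mgf: "\<And>u. (\<integral>\<^sup>+x. ennreal (exp (\<Sum>i\<in>I. \<eta> i x * (u \<bullet> \<phi> i x) - (u \<bullet> \<phi> i x)\<^sup>2 / 2)) \<partial>M) \<le> 1"
  shows "(\<integral>\<^sup>+x. mixture l I (\<lambda>i. \<eta> i x) (\<lambda>i. \<phi> i x) \<partial>M) \<le> 1"
proof -
  interpret L: pair_sigma_finite "lborel :: 'b measure" M ..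
  have "(\<integral>\<^sup>+x. mixture l I (\<lambda>i. \<eta> i x) (\<lambda>i. \<phi> i x) \<partial>M)
      = (\<integral>\<^sup>+u. (\<integral>\<^sup>+x. ennreal (exp (\<Sum>i\<in>I. \<eta> i x * (u \<bullet> \<phi> i x) - (u \<bullet> \<phi> i x)\<^sup>2 / 2))
      * ennreal (gauss (1 / sqrt l) u) \<partial>M) \<partial>lborel)"
    unfolding mixture_def by (rule L.Fubini') measurable
  also have "\<dots> = (\<integral>\<^sup>+u. (\<integral>\<^sup>+x. ennreal (exp (\<Sum>i\<in>I. \<eta> i x * (u \<bullet> \<phi> i x) - (u \<bullet> \<phi> i x)\<^sup>2 / 2)) \<partial>M)
      * ennreal (gauss (1 / sqrt l) u) \<partial>lborel)"
    by (intro nn_integral_cong nn_integral_multc) measurable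
  also have "\<dots> \<le> (\<integral>\<^sup>+u. 1 * ennreal (gauss (1 / sqrt l) (u::'b)) \<partial>lborel)"
    by (intro nn_integral_mono mult_right_mono mgf) auto
  also have "\<dots> = ennreal (\<integral>u. gauss (1 / sqrt l) (u::'b) \<partial>lborel)"
    using has_integral_gauss[of "1 / sqrt l", where 'a='b] l
    by (simp add: nn_integral_eq_integral has_bochner_integral_iff gauss_nonneg)
  also have "\<dots> = 1"
    using has_integral_gauss[of "1 / sqrt l", where 'a='b] l by (simp add: has_bochner_integral_iff)
  finally show ?thesis .
qed

section \<open>Strong convexity of the logistic loss\<close>

definition logistic_loss :: "bool \<Rightarrow> real \<Rightarrow> real" where
  "logistic_loss y z = - (of_bool y * ln (sigmoid z) + (1 - of_bool y) * ln (1 - sigmoid z))"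

lemma logistic_loss_eq: "logistic_loss y z = ln (1 + exp (- z)) + (1 - of_bool y) * z"
proof -
  have "0 < 1 + exp (- z)" by (simp add: add_pos_pos)
  moreover have "1 - sigmoid z = exp (- z) / (1 + exp (- z))"
    using calculation by (simp add: sigmoid_def field_simps)
  ultimately show ?thesis
    by (cases y) (simp_all add: logistic_loss_def sigmoid_def ln_div)
qed

lemma sigmoid_bounds: "0 < sigmoid z" "sigmoid z < 1"
  by (simp_all add: sigmoid_def add_pos_pos)

lemma DERIV_sigmoid: "(sigmoid has_real_derivative 1 / (2 + exp z + exp (- z))) (at z)"
proof -
  have pos: "0 < 1 + exp (- z)" by (simp add: add_pos_pos)
  have "(sigmoid has_real_derivative exp (- z) / (1 + exp (- z))\<^sup>2) (at z)"
    unfolding sigmoid_def[abs_def] using pos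
    by (auto intro!: derivative_eq_intros simp: power2_eq_square)
  also have "exp (- z) / (1 + exp (- z))\<^sup>2 = 1 / (2 + exp z + exp (- z))"
  proof -
    have "(1 + exp (- z))\<^sup>2 = exp (- z) * (2 + exp z + exp (- z))"
      by (simp add: power2_eq_square algebra_simps flip: exp_add)
    then show ?thesis by simp
  qed
  finally show ?thesis .
qed

lemma sigmoid_lipschitz: "\<bar>sigmoid a - sigmoid b\<bar> \<le> \<bar>a - b\<bar> / 4"
proof -
  have slope: "\<bar>1 / (2 + exp z + exp (- z))\<bar> \<le> 1 / 4" for z :: real
  proof -
    have "2 \<le> exp z + exp (- z)"
      using cosh_real_ge_1[of z] by (simp add: cosh_def)
    then show ?thesis by (simp add: divide_simps)
  qed
  have "norm (sigmoid a - sigmoid b) \<le> (1 / 4) * norm (a - b)"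
    by (rule field_differentiable_bound[of UNIV sigmoid "\<lambda>z. 1 / (2 + exp z + exp (- z))"])
       (use slope in \<open>auto intro: DERIV_subset[OF DERIV_sigmoid]\<close>)
  then show ?thesis by simp
qed

text \<open>The second derivative \<open>1 / (2 + exp z + exp (- z))\<close> is even and decreases in \<open>\<bar>z\<bar>\<close>, hence is at
  least \<open>\<rho>\<close> on the interval; subtracting \<open>\<rho> / 2 * z\<^sup>2\<close> leaves a convex function.\<close>
lemma logistic_loss_strongly_convex:
  assumes R: "\<bar>z\<bar> \<le> R" "\<bar>z'\<bar> \<le> R" and \<rho>: "\<rho> = 1 / (2 + exp R + exp (- R))"
  shows "(sigmoid z - of_bool y) * (z' - z) + \<rho> / 2 * (z' - z)\<^sup>2 \<le> logistic_loss y z' - logistic_loss y z"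
proof -
  define f where "f z = logistic_loss y z - \<rho> / 2 * z\<^sup>2" for z
  define f' where "f' z = sigmoid z - of_bool y - \<rho> * z" for z
  have d1: "(f has_real_derivative f' z) (at z)" for z
  proof -
    have pos: "0 < 1 + exp (- z)" by (simp add: add_pos_pos)
    have "(f has_real_derivative - exp (- z) / (1 + exp (- z)) + (1 - of_bool y) - \<rho> * z) (at z)"
      unfolding f_def logistic_loss_eq using pos
      by (auto intro!: derivative_eq_intros)
    also have "- exp (- z) / (1 + exp (- z)) = sigmoid z - 1"
      using pos by (simp add: sigmoid_def field_simps)
    finally show ?thesis by (simp add: f'_def)
  qed
  have d2: "(f' has_real_derivative 1 / (2 + exp z + exp (- z)) - \<rho>) (at z)" for z
    unfolding f'_def by (auto intro!: derivative_eq_intros DERIV_sigmoid)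
  have pos: "0 \<le> 1 / (2 + exp z + exp (- z)) - \<rho>" if "z \<in> {-R..R}" for z
  proof -
    have "cosh \<bar>z\<bar> \<le> cosh R"
      using that by (subst cosh_real_nonneg_le_iff) auto
    moreover have "cosh \<bar>z\<bar> = cosh z" by (cases "0 \<le> z") auto
    ultimately have "exp z + exp (- z) \<le> exp R + exp (- R)"
      by (simp add: cosh_def)
    then show ?thesis unfolding \<rho> by (simp add: frac_le add_pos_pos)
  qed
  have "f' z * (z' - z) \<le> f z' - f z"
    by (rule f''_imp_f'[of "{-R..R}" f f' "\<lambda>z. 1 / (2 + exp z + exp (- z)) - \<rho>"])
       (use d1 d2 pos R in auto)
  then show ?thesis by (simp add: f_def f'_def power2_eq_square algebra_simps)
qed

section \<open>Deterministic error bound for the constrained estimator\<close>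

text \<open>Optimality compares the loss at \<open>\<mu>\<close> with the loss at the feasible point \<open>\<mu>s\<close>.\<close>
lemma mle_basic_inequality:
  fixes \<phi> :: "nat \<Rightarrow> real^'d"
  assumes mle: "constrained_mle r N \<phi> y \<mu>" and \<mu>s: "norm \<mu>s \<le> r"
    and \<phi>: "\<And>i. i \<in> {1..N} \<Longrightarrow> norm (\<phi> i) \<le> b" and \<rho>: "\<rho> = 1 / (2 + exp (b * r) + exp (- (b * r)))"
  shows "\<rho> / 2 * (\<Sum>i=1..N. ((\<mu> - \<mu>s) \<bullet> \<phi> i)\<^sup>2)
      \<le> (\<Sum>i=1..N. (of_bool (y i) - sigmoid (\<phi> i \<bullet> \<mu>s)) * ((\<mu> - \<mu>s) \<bullet> \<phi> i))"
proof -
  have nll: "neg_log_lik N \<phi> y m = (\<Sum>i=1..N. logistic_loss (y i) (\<phi> i \<bullet> m))" for m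
    by (simp only: neg_log_lik_def logistic_loss_def sum_negf)
  have \<mu>: "norm \<mu> \<le> r" and opt: "neg_log_lik N \<phi> y \<mu> \<le> neg_log_lik N \<phi> y \<mu>s"
    using mle \<mu>s by (auto simp: constrained_mle_def is_arg_min_def not_less)
  have bd: "\<bar>\<phi> i \<bullet> m\<bar> \<le> b * r" if "i \<in> {1..N}" "norm m \<le> r" for i m
  proof -
    have "\<bar>\<phi> i \<bullet> m\<bar> \<le> norm (\<phi> i) * norm m" by (rule Cauchy_Schwarz_ineq2)
    also have "\<dots> \<le> b * r"
      using \<phi>[OF that(1)] that(2) by (intro mult_mono) (auto intro: order_trans[OF norm_ge_zero])
    finally show ?thesis .
  qed
  have "(\<Sum>i=1..N. (sigmoid (\<phi> i \<bullet> \<mu>s) - of_bool (y i)) * ((\<mu> - \<mu>s) \<bullet> \<phi> i) + \<rho> / 2 * ((\<mu> - \<mu>s) \<bullet> \<phi> i)\<^sup>2)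
      \<le> (\<Sum>i=1..N. logistic_loss (y i) (\<phi> i \<bullet> \<mu>) - logistic_loss (y i) (\<phi> i \<bullet> \<mu>s))"
  proof (rule sum_mono)
    fix i assume i: "i \<in> {1..N}"
    have "(\<mu> - \<mu>s) \<bullet> \<phi> i = \<phi> i \<bullet> \<mu> - \<phi> i \<bullet> \<mu>s"
      by (metis inner_commute inner_diff_right)
    then show "(sigmoid (\<phi> i \<bullet> \<mu>s) - of_bool (y i)) * ((\<mu> - \<mu>s) \<bullet> \<phi> i) + \<rho> / 2 * ((\<mu> - \<mu>s) \<bullet> \<phi> i)\<^sup>2
      \<le> logistic_loss (y i) (\<phi> i \<bullet> \<mu>) - logistic_loss (y i) (\<phi> i \<bullet> \<mu>s)"
      using logistic_loss_strongly_convex[OF bd[OF i \<mu>s] bd[OF i \<mu>] \<rho>, of "y i"] by simp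
  qed
  also have "\<dots> \<le> 0" using opt by (simp add: nll sum_subtractf)
  finally have "(\<Sum>i=1..N. (sigmoid (\<phi> i \<bullet> \<mu>s) - of_bool (y i)) * ((\<mu> - \<mu>s) \<bullet> \<phi> i))
      + \<rho> / 2 * (\<Sum>i=1..N. ((\<mu> - \<mu>s) \<bullet> \<phi> i)\<^sup>2) \<le> 0"
    by (simp add: sum.distrib sum_distrib_left)
  moreover have "(\<Sum>i=1..N. (of_bool (y i) - sigmoid (\<phi> i \<bullet> \<mu>s)) * ((\<mu> - \<mu>s) \<bullet> \<phi> i))
      = - (\<Sum>i=1..N. (sigmoid (\<phi> i \<bullet> \<mu>s) - of_bool (y i)) * ((\<mu> - \<mu>s) \<bullet> \<phi> i))"
    by (simp add: sum_negf[symmetric] algebra_simps)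
  ultimately show ?thesis by linarith
qed

lemma mat_norm_empirical_cov:
  fixes \<phi> :: "nat \<Rightarrow> real^'d"
  shows "mat_norm (empirical_cov N \<phi> + mat \<zeta>) v
      = sqrt ((1 / real N) * (\<Sum>i=1..N. (v \<bullet> \<phi> i)\<^sup>2) + \<zeta> * (norm v)\<^sup>2)"
proof -
  have outer: "(\<chi> k l. u $ k * u $ l) *v v = (v \<bullet> u) *\<^sub>R u" for u :: "real^'d"
    by (simp add: matrix_vector_mult_def vec_eq_iff inner_vec_def sum_distrib_left mult_ac)
  have sums: "(\<Sum>i\<in>I. A i) *v v = (\<Sum>i\<in>I. A i *v v)" for A :: "nat \<Rightarrow> real^'d^'d" and I
    by (induction I rule: infinite_finite_induct) (simp_all add: matrix_vector_mult_add_rdistrib)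
  have scale: "(c *\<^sub>R A) *v v = c *\<^sub>R (A *v v)" for c and A :: "real^'d^'d"
    by (simp add: scaleR_matrix_vector_assoc)
  have mat: "mat \<zeta> *v v = \<zeta> *\<^sub>R v"
    by (simp add: matrix_vector_mult_def mat_def vec_eq_iff if_distrib[of "\<lambda>x. x * _"] cong: if_cong)
  show ?thesis
    by (simp add: mat_norm_def empirical_cov_def matrix_vector_mult_add_rdistrib scale sums outer mat
        inner_add_right inner_sum_right power2_eq_square power2_norm_eq_inner[unfolded power2_eq_square])
qed

lemma le_of_square_le:
  fixes x a b :: real
  assumes "x\<^sup>2 \<le> a * x + b\<^sup>2" "0 \<le> a" "0 \<le> b" "0 \<le> x"
  shows "x \<le> a + b"
proof (rule ccontr)
  assume "\<not> x \<le> a + b"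
  then have gt: "a + b < x" by simp
  then have "a * x + b * b \<le> a * x + b * x" using assms by (intro add_left_mono mult_left_mono) auto
  also have "\<dots> = (a + b) * x" by (simp add: algebra_simps)
  also have "\<dots> < x * x" using gt assms by (intro mult_strict_right_mono) auto
  finally show False using assms(1) by (simp add: power2_eq_square)
qed

text \<open>The score \<open>(y i - sigmoid (\<phi>t i \<bullet> \<mu>s)) \<phi>t i\<close> of the perturbed sample is the sum of the clean noise
  term, an effect of the feature error on the direction, and an effect of it on the predicted label
  probability. The last two are at most a multiple of \<open>norm v \<le> X / sqrt \<zeta>\<close>. The first is
  self-normalized by the clean design; since on unit vectors the clean and the perturbed form
  differ by at most \<open>\<zeta> / c\<zeta>\<close> per sample, passing to the perturbed design costs at most the factor
  \<open>c\<zeta> / (c\<zeta> - 1)\<close>.\<close>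
lemma mle_error_bound:
  fixes \<phi> \<phi>t :: "nat \<Rightarrow> real^'d"
  assumes N: "1 \<le> N" and T: "1 \<le> T" and Br: "0 < Br" and \<epsilon>: "0 < \<epsilon>" and c\<zeta>: "1 < c\<zeta>"
    and \<delta>: "0 < \<delta>" "\<delta> < 1"
    and \<phi>: "\<And>i. i \<in> {1..N} \<Longrightarrow> norm (\<phi> i) \<le> 2 * (real T * Br)"
    and \<phi>t: "\<And>i. i \<in> {1..N} \<Longrightarrow> norm (\<phi>t i) \<le> 2 * (real T * Br)"
    and diff: "\<And>i. i \<in> {1..N} \<Longrightarrow> norm (\<phi>t i - \<phi> i) \<le> 4 * (real T * Br) * \<epsilon>"
    and mle: "constrained_mle r N \<phi>t y \<mu>" and \<mu>s: "norm \<mu>s \<le> r"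
    and mix: "mixture (real N * zeta_reg c\<zeta> T Br \<epsilon>) {1..N}
        (\<lambda>i. of_bool (y i) - sigmoid (\<phi> i \<bullet> \<mu>s)) \<phi> \<le> ennreal (1 / \<delta>)"
  shows "mat_norm (empirical_cov N \<phi>t + mat (zeta_reg c\<zeta> T Br \<epsilon>)) (\<mu> - \<mu>s)
      \<le> estimation_bound c\<zeta> \<delta> CARD('d) T N Br r \<epsilon>"
proof -
  define R where "R = real T * Br"
  define \<zeta> where "\<zeta> = zeta_reg c\<zeta> T Br \<epsilon>"
  define \<rho> where "\<rho> = rho_curv T Br r"
  define v where "v = \<mu> - \<mu>s"
  define \<eta> where "\<eta> i = of_bool (y i) - sigmoid (\<phi> i \<bullet> \<mu>s)" for i
  define G where "G = real CARD('d) * ln (1 + 4 * R\<^sup>2 / (\<zeta> * real CARD('d))) + 2 * ln (1 / \<delta>)"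
  define X where "X = mat_norm (empirical_cov N \<phi>t + mat \<zeta>) v"
  have R: "0 < R" using T Br by (simp add: R_def)
  have N': "0 < real N" using N by simp
  have \<zeta>_eq: "\<zeta> = c\<zeta> * (16 * R\<^sup>2 * \<epsilon> * (1 + \<epsilon>))"
    by (simp add: \<zeta>_def zeta_reg_def R_def power_mult_distrib algebra_simps)
  have \<zeta>: "0 < \<zeta>" unfolding \<zeta>_eq using c\<zeta> R \<epsilon> by simp
  have \<rho>: "0 < \<rho>" "\<rho> = 1 / (2 + exp (2 * R * r) + exp (- (2 * R * r)))"
    by (simp_all add: \<rho>_def rho_curv_def R_def mult.assoc add_pos_pos)
  have r: "0 \<le> r" using \<mu>s norm_ge_zero order_trans by blast
  have nv: "norm v \<le> 2 * r"
  proof -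
    have "norm \<mu> \<le> r" using mle by (simp add: constrained_mle_def is_arg_min_def)
    then show ?thesis unfolding v_def using \<mu>s norm_triangle_ineq4[of \<mu> \<mu>s] by linarith
  qed
  define q where "q = (\<Sum>i=1..N. (v \<bullet> \<phi>t i)\<^sup>2)"
  have q0: "0 \<le> q" by (simp add: q_def sum_nonneg)
  have X: "0 \<le> X" and X2: "X\<^sup>2 = (1 / real N) * q + \<zeta> * (norm v)\<^sup>2"
  proof -
    have "0 \<le> (1 / real N) * q + \<zeta> * (norm v)\<^sup>2" using \<zeta> q0 by simp
    then show "0 \<le> X" "X\<^sup>2 = (1 / real N) * q + \<zeta> * (norm v)\<^sup>2"
      by (auto simp: X_def mat_norm_empirical_cov q_def)
  qed
  have v_le: "norm v \<le> X / sqrt \<zeta>"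
  proof -
    have "(norm v * sqrt \<zeta>)\<^sup>2 \<le> X\<^sup>2"
      unfolding X2 using \<zeta> q0 by (simp add: power_mult_distrib mult.commute)
    then have "norm v * sqrt \<zeta> \<le> X" using X by (rule power2_le_imp_le)
    then show ?thesis using \<zeta> by (simp add: pos_le_divide_eq)
  qed
  have basic: "\<rho> / 2 * q \<le> (\<Sum>i=1..N. (of_bool (y i) - sigmoid (\<phi>t i \<bullet> \<mu>s)) * (v \<bullet> \<phi>t i))"
    unfolding q_def v_def using \<rho>(2)
    by (intro mle_basic_inequality[OF mle \<mu>s \<phi>t]) (auto simp: R_def)
  have inner_le: "\<bar>v \<bullet> x\<bar> \<le> norm v * b" if "norm x \<le> b" for x b
    using Cauchy_Schwarz_ineq2[of v x] mult_left_mono[OF that, of "norm v"] by simp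
  have split: "(of_bool (y i) - sigmoid (\<phi>t i \<bullet> \<mu>s)) * (v \<bullet> \<phi>t i)
      \<le> \<eta> i * (v \<bullet> \<phi> i) + (4 * R * \<epsilon> * (1 + 1 / 2 * R * r)) * norm v" if i: "i \<in> {1..N}" for i
  proof -
    have "\<bar>\<eta> i\<bar> \<le> 1" using sigmoid_bounds[of "\<phi> i \<bullet> \<mu>s"] by (auto simp: \<eta>_def)
    have "\<eta> i * (v \<bullet> (\<phi>t i - \<phi> i)) \<le> \<bar>\<eta> i\<bar> * \<bar>v \<bullet> (\<phi>t i - \<phi> i)\<bar>"
      unfolding abs_mult[symmetric] by (rule abs_ge_self)
    also have "\<dots> \<le> 1 * (norm v * (4 * R * \<epsilon>))"
      using \<open>\<bar>\<eta> i\<bar> \<le> 1\<close> inner_le[OF diff[OF i]] by (intro mult_mono) (auto simp: R_def)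
    finally have 1: "\<eta> i * (v \<bullet> (\<phi>t i - \<phi> i)) \<le> 1 * (norm v * (4 * R * \<epsilon>))" .
    have "\<bar>sigmoid (\<phi> i \<bullet> \<mu>s) - sigmoid (\<phi>t i \<bullet> \<mu>s)\<bar> \<le> \<bar>(\<phi>t i - \<phi> i) \<bullet> \<mu>s\<bar> / 4"
      using sigmoid_lipschitz[of "\<phi> i \<bullet> \<mu>s" "\<phi>t i \<bullet> \<mu>s"] by (simp add: inner_diff_left abs_minus_commute)
    also have "\<dots> \<le> norm (\<phi>t i - \<phi> i) * norm \<mu>s / 4"
      by (intro divide_right_mono Cauchy_Schwarz_ineq2) simp
    also have "\<dots> \<le> (4 * R * \<epsilon>) * r / 4"
      using diff[OF i] \<mu>s R \<epsilon> by (intro divide_right_mono mult_mono) (auto simp: R_def)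
    finally have s: "\<bar>sigmoid (\<phi> i \<bullet> \<mu>s) - sigmoid (\<phi>t i \<bullet> \<mu>s)\<bar> \<le> R * \<epsilon> * r" by simp
    have "\<bar>(sigmoid (\<phi> i \<bullet> \<mu>s) - sigmoid (\<phi>t i \<bullet> \<mu>s)) * (v \<bullet> \<phi>t i)\<bar> \<le> (R * \<epsilon> * r) * (norm v * (2 * R))"
      unfolding abs_mult using s inner_le[OF \<phi>t[OF i]] by (intro mult_mono) (auto simp: R_def)
    then have 2: "(sigmoid (\<phi> i \<bullet> \<mu>s) - sigmoid (\<phi>t i \<bullet> \<mu>s)) * (v \<bullet> \<phi>t i) \<le> (R * \<epsilon> * r) * (norm v * (2 * R))"
      by linarith
    have "(of_bool (y i) - sigmoid (\<phi>t i \<bullet> \<mu>s)) * (v \<bullet> \<phi>t i)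
        = \<eta> i * (v \<bullet> \<phi> i) + \<eta> i * (v \<bullet> (\<phi>t i - \<phi> i))
          + (sigmoid (\<phi> i \<bullet> \<mu>s) - sigmoid (\<phi>t i \<bullet> \<mu>s)) * (v \<bullet> \<phi>t i)"
      by (simp add: \<eta>_def inner_diff_right algebra_simps)
    also have "\<dots> \<le> \<eta> i * (v \<bullet> \<phi> i) + 1 * (norm v * (4 * R * \<epsilon>)) + (R * \<epsilon> * r) * (norm v * (2 * R))"
      using 1 2 by linarith
    also have "\<dots> = \<eta> i * (v \<bullet> \<phi> i) + (4 * R * \<epsilon> * (1 + 1 / 2 * R * r)) * norm v"
      by (simp add: algebra_simps)
    finally show ?thesis .
  qed
  have noise: "(\<Sum>i=1..N. \<eta> i * (v \<bullet> \<phi> i)) \<le> sqrt G * (sqrt (real N) * sqrt (c\<zeta> / (c\<zeta> - 1)) * X)"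
  proof -
    have Nz: "0 < real N * \<zeta>" using \<zeta> N by simp
    define G' where "G' = real CARD('d) * ln (1 + (\<Sum>i=1..N. (norm (\<phi> i))\<^sup>2) / (real CARD('d) * (real N * \<zeta>)))
        + 2 * ln (1 / \<delta>)"
    have "(\<Sum>i=1..N. \<eta> i * (v \<bullet> \<phi> i)) \<le> sqrt G' * sqrt (ridge_form (real N * \<zeta>) {1..N} \<phi> v)"
      using self_normalized_bound[OF Nz \<delta>, of "{1..N}" \<eta> \<phi> v] mix
      by (simp add: \<eta>_def[abs_def] \<zeta>_def G'_def)
    also have "\<dots> \<le> sqrt G * sqrt (real N * (c\<zeta> / (c\<zeta> - 1)) * X\<^sup>2)"
    proof (intro mult_mono real_sqrt_le_mono)
      have "(\<Sum>i=1..N. (norm (\<phi> i))\<^sup>2) \<le> (\<Sum>i=1..N. (2 * R)\<^sup>2)"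
        using \<phi> by (intro sum_mono power_mono) (auto simp: R_def)
      then have "(\<Sum>i=1..N. (norm (\<phi> i))\<^sup>2) / (real CARD('d) * (real N * \<zeta>))
          \<le> (real N * (4 * R\<^sup>2)) / (real CARD('d) * (real N * \<zeta>))"
        using \<zeta> by (intro divide_right_mono) (auto simp: power_mult_distrib)
      also have "\<dots> = 4 * R\<^sup>2 / (\<zeta> * real CARD('d))" using N' by (simp add: mult.commute)
      finally have le: "(\<Sum>i=1..N. (norm (\<phi> i))\<^sup>2) / (real CARD('d) * (real N * \<zeta>))
          \<le> 4 * R\<^sup>2 / (\<zeta> * real CARD('d))" .
      have "0 \<le> (\<Sum>i=1..N. (norm (\<phi> i))\<^sup>2) / (real CARD('d) * (real N * \<zeta>))"
        using \<zeta> by (intro divide_nonneg_nonneg sum_nonneg) auto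
      then show "G' \<le> G"
        unfolding G'_def G_def using le by (intro add_right_mono mult_left_mono ln_mono) auto
      show "ridge_form (real N * \<zeta>) {1..N} \<phi> v \<le> real N * (c\<zeta> / (c\<zeta> - 1)) * X\<^sup>2"
      proof -
        have "(v \<bullet> \<phi> i)\<^sup>2 \<le> (v \<bullet> \<phi>t i)\<^sup>2 + \<zeta> / c\<zeta> * (norm v)\<^sup>2" if i: "i \<in> {1..N}" for i
        proof -
          have "(v \<bullet> \<phi> i)\<^sup>2 - (v \<bullet> \<phi>t i)\<^sup>2 = (v \<bullet> (\<phi> i - \<phi>t i)) * (v \<bullet> (\<phi> i + \<phi>t i))"
            by (simp add: inner_diff_right inner_add_right power2_eq_square algebra_simps)
          also have "\<dots> \<le> (norm v * (4 * R * \<epsilon>)) * (norm v * (4 * R))"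
          proof (rule order_trans[OF abs_ge_self], unfold abs_mult, rule mult_mono)
            show "\<bar>v \<bullet> (\<phi> i - \<phi>t i)\<bar> \<le> norm v * (4 * R * \<epsilon>)"
              using diff[OF i] by (intro inner_le) (simp add: R_def norm_minus_commute)
            show "\<bar>v \<bullet> (\<phi> i + \<phi>t i)\<bar> \<le> norm v * (4 * R)"
              using \<phi>[OF i] \<phi>t[OF i] norm_triangle_ineq[of "\<phi> i" "\<phi>t i"]
              by (intro inner_le) (simp add: R_def)
          qed (use R \<epsilon> in auto)
          also have "\<dots> = (16 * R\<^sup>2 * \<epsilon> * 1) * (norm v)\<^sup>2"
            by (simp add: power2_eq_square algebra_simps)
          also have "\<dots> \<le> (16 * R\<^sup>2 * \<epsilon> * (1 + \<epsilon>)) * (norm v)\<^sup>2"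
            using \<epsilon> by (intro mult_right_mono mult_left_mono) auto
          also have "16 * R\<^sup>2 * \<epsilon> * (1 + \<epsilon>) = \<zeta> / c\<zeta>" using c\<zeta> by (simp add: \<zeta>_eq)
          finally show ?thesis by simp
        qed
        then have "ridge_form (real N * \<zeta>) {1..N} \<phi> v
            \<le> (\<Sum>i=1..N. (v \<bullet> \<phi>t i)\<^sup>2 + \<zeta> / c\<zeta> * (norm v)\<^sup>2) + real N * \<zeta> * (norm v)\<^sup>2"
          unfolding ridge_form_def by (intro add_right_mono sum_mono) auto
        also have "\<dots> = q + real N * (1 + 1 / c\<zeta>) * (\<zeta> * (norm v)\<^sup>2)"
          by (simp add: sum.distrib q_def algebra_simps)
        also have "\<dots> \<le> (1 + 1 / c\<zeta>) * q + real N * (1 + 1 / c\<zeta>) * (\<zeta> * (norm v)\<^sup>2)"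
          using c\<zeta> q0 by (simp add: algebra_simps)
        also have "\<dots> = real N * (1 + 1 / c\<zeta>) * X\<^sup>2"
          unfolding X2 using N' by (simp add: algebra_simps)
        also have "\<dots> \<le> real N * (c\<zeta> / (c\<zeta> - 1)) * X\<^sup>2"
        proof -
          have "(1 + 1 / c\<zeta>) * (c\<zeta> - 1) \<le> c\<zeta>" using c\<zeta> by (simp add: field_simps)
          then have "1 + 1 / c\<zeta> \<le> c\<zeta> / (c\<zeta> - 1)" using c\<zeta> by (simp add: pos_le_divide_eq)
          then show ?thesis by (intro mult_right_mono mult_left_mono) auto
        qed
        finally show ?thesis .
      qed
    next
      show "0 \<le> sqrt G" unfolding G_def using \<zeta> \<delta>
        by (intro real_sqrt_ge_zero add_nonneg_nonneg mult_nonneg_nonneg ln_ge_zero) auto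
      show "0 \<le> sqrt (ridge_form (real N * \<zeta>) {1..N} \<phi> v)"
        using ridge_form_nonneg[OF Nz] by simp
    qed
    also have "\<dots> = sqrt G * (sqrt (real N) * sqrt (c\<zeta> / (c\<zeta> - 1)) * X)"
      using X by (simp only: real_sqrt_mult real_sqrt_abs abs_of_nonneg)
    finally show ?thesis .
  qed
  define a where "a = 2 / \<rho> * (sqrt (c\<zeta> / (c\<zeta> - 1)) / sqrt (real N) * sqrt G
      + 4 * R * \<epsilon> * (1 + 1 / 2 * R * r) / sqrt \<zeta>)"
  have G0: "0 \<le> G" unfolding G_def using \<zeta> \<delta>
    by (intro add_nonneg_nonneg mult_nonneg_nonneg ln_ge_zero) auto
  have a: "0 \<le> a" unfolding a_def using \<rho> c\<zeta> R \<epsilon> r G0 \<zeta>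
    by (intro mult_nonneg_nonneg add_nonneg_nonneg divide_nonneg_nonneg) auto
  have "\<rho> / 2 * q \<le> (\<Sum>i=1..N. \<eta> i * (v \<bullet> \<phi> i) + (4 * R * \<epsilon> * (1 + 1 / 2 * R * r)) * norm v)"
    using basic sum_mono[OF split] by (rule order_trans)
  also have "\<dots> = (\<Sum>i=1..N. \<eta> i * (v \<bullet> \<phi> i)) + real N * ((4 * R * \<epsilon> * (1 + 1 / 2 * R * r)) * norm v)"
    by (simp add: sum.distrib)
  also have "\<dots> \<le> sqrt G * (sqrt (real N) * sqrt (c\<zeta> / (c\<zeta> - 1)) * X)
      + real N * ((4 * R * \<epsilon> * (1 + 1 / 2 * R * r)) * (X / sqrt \<zeta>))"
    using noise v_le R \<epsilon> r by (intro add_mono mult_left_mono) auto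
  also have "sqrt G * (sqrt (real N) * sqrt (c\<zeta> / (c\<zeta> - 1)) * X)
      = real N * (sqrt (c\<zeta> / (c\<zeta> - 1)) / sqrt (real N) * sqrt G * X)"
  proof -
    have "real N / sqrt (real N) = sqrt (real N)" by (simp add: real_div_sqrt)
    then have "sqrt G * (sqrt (real N) * sqrt (c\<zeta> / (c\<zeta> - 1)) * X)
        = sqrt G * (real N / sqrt (real N) * sqrt (c\<zeta> / (c\<zeta> - 1)) * X)" by (simp only:)
    then show ?thesis by (simp add: mult_ac)
  qed
  finally have "\<rho> / 2 * q \<le> real N * (sqrt (c\<zeta> / (c\<zeta> - 1)) / sqrt (real N) * sqrt G * X
      + (4 * R * \<epsilon> * (1 + 1 / 2 * R * r)) * (X / sqrt \<zeta>))"
    by (simp only: distrib_left)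
  also have "\<dots> = \<rho> / 2 * (real N * (a * X))"
    unfolding a_def using \<rho>(1) by (simp add: algebra_simps add_divide_distrib)
  finally have "q \<le> real N * (a * X)" using \<rho>(1) by simp
  then have "(1 / real N) * q \<le> a * X" using N' by (simp add: pos_divide_le_eq mult_ac)
  moreover have "\<zeta> * (norm v)\<^sup>2 \<le> (2 * r * sqrt \<zeta>)\<^sup>2"
  proof -
    have "(norm v)\<^sup>2 \<le> (2 * r)\<^sup>2" using nv by (intro power_mono) auto
    then show ?thesis using \<zeta> by (simp add: power_mult_distrib mult.commute)
  qed
  ultimately have "X\<^sup>2 \<le> a * X + (2 * r * sqrt \<zeta>)\<^sup>2" unfolding X2 by linarith
  then have "X \<le> a + 2 * r * sqrt \<zeta>"
    by (rule le_of_square_le[OF _ a _ X]) (use r \<zeta> in simp)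
  also have "a + 2 * r * sqrt \<zeta> = estimation_bound c\<zeta> \<delta> CARD('d) T N Br r \<epsilon>"
  proof -
    have "2 * sqrt c\<zeta> / (\<rho> * sqrt (real N * (c\<zeta> - 1))) * sqrt G
        = 2 / \<rho> * (sqrt (c\<zeta> / (c\<zeta> - 1)) / sqrt (real N) * sqrt G)"
      by (simp add: real_sqrt_mult real_sqrt_divide mult_ac)
    moreover have "8 * R * \<epsilon> / (\<rho> * sqrt \<zeta>) * (1 + 1 / 2 * R * r)
        = 2 / \<rho> * (4 * R * \<epsilon> * (1 + 1 / 2 * R * r) / sqrt \<zeta>)"
      by simp
    ultimately have "a + 2 * r * sqrt \<zeta> = 2 * sqrt c\<zeta> / (\<rho> * sqrt (real N * (c\<zeta> - 1))) * sqrt G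
        + 8 * R * \<epsilon> / (\<rho> * sqrt \<zeta>) * (1 + 1 / 2 * R * r) + 2 * r * sqrt \<zeta>"
      unfolding a_def distrib_left by simp
    also have "\<dots> = estimation_bound c\<zeta> \<delta> CARD('d) T N Br r \<epsilon>"
      by (simp add: estimation_bound_def Let_def \<zeta>_def \<rho>_def G_def R_def power_mult_distrib mult.assoc)
    finally show ?thesis .
  qed
  finally show ?thesis by (simp add: X_def \<zeta>_def v_def)
qed

section \<open>Features and noise of the preference data\<close>

lemma traj_feature_cong:
  assumes "\<And>k. k \<in> {1..T} \<Longrightarrow> x k = x' k"
  shows "traj_feature \<phi>r \<nu>0 T P Q a x = traj_feature \<phi>r \<nu>0 T P Q a x'"
  unfolding traj_feature_def belief_feature_def
  using assms by (intro sum.cong refl) (auto intro!: arg_cong2[where f="(*\<^sub>R)"] fun_cong[OF belief_cong])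

lemma feature_diff_cong:
  assumes "\<And>j k. j \<in> {1, 2} \<Longrightarrow> k \<in> {1..T} \<Longrightarrow> x j k = x' j k"
  shows "feature_diff \<phi>r \<nu>0 T P Q a x = feature_diff \<phi>r \<nu>0 T P Q a x'"
  unfolding feature_diff_def using assms
  by (intro arg_cong2[where f="(-)"] traj_feature_cong) auto

lemma norm_feature_diff_le:
  assumes "prob_vector \<nu>0" "regular_kernels P Q" and \<phi>r: "\<And>s a. norm (\<phi>r s a) \<le> Br"
  shows "norm (feature_diff \<phi>r \<nu>0 T P Q a x) \<le> 2 * (real T * Br)"
proof -
  have bf: "norm (belief_feature \<phi>r b a) \<le> Br" if b: "prob_vector b" for b a
  proof -
    have "norm (belief_feature \<phi>r b a) \<le> (\<Sum>s\<in>UNIV. norm (b s *\<^sub>R \<phi>r s a))"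
      unfolding belief_feature_def by (rule norm_sum)
    also have "\<dots> \<le> (\<Sum>s\<in>UNIV. b s * Br)"
      using \<phi>r prob_vector_nonneg[OF b] by (intro sum_mono) (simp add: mult_left_mono)
    also have "\<dots> = Br" by (simp add: sum_distrib_right[symmetric] prob_vector_sum1[OF b])
    finally show ?thesis .
  qed
  have tf: "norm (traj_feature \<phi>r \<nu>0 T P Q a x) \<le> real T * Br" for a x
  proof -
    have "norm (traj_feature \<phi>r \<nu>0 T P Q a x)
        \<le> (\<Sum>h<T. norm (belief_feature \<phi>r (belief \<nu>0 P Q a x h) (a h)))"
      unfolding traj_feature_def by (rule norm_sum)
    also have "\<dots> \<le> (\<Sum>h<T. Br)" using assms by (intro sum_mono bf prob_vector_belief)
    finally show ?thesis by simp
  qed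
  show ?thesis
    unfolding feature_diff_def
    using norm_triangle_ineq4 tf[of "a 1" "x 1"] tf[of "a 2" "x 2"] by (smt (verit))
qed

definition total_gap ::
  "('s::finite \<Rightarrow> real) \<Rightarrow> nat \<Rightarrow> ('s, 'a) trans \<Rightarrow> ('s, 'x) emission \<Rightarrow> ('s, 'a) trans \<Rightarrow> ('s, 'x) emission
    \<Rightarrow> (nat \<Rightarrow> 'a) \<Rightarrow> (nat \<Rightarrow> 'x) \<Rightarrow> real" where
  "total_gap \<nu>0 T P' Q' P Q a x = (\<Sum>h<T. tv (belief \<nu>0 P' Q' a x h) (belief \<nu>0 P Q a x h))"

lemma norm_feature_diff_error_le:
  assumes \<phi>r: "\<And>s a. norm (\<phi>r s a) \<le> Br" and Br: "0 \<le> Br"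
    and g: "\<And>j. j \<in> {1, 2} \<Longrightarrow> total_gap \<nu>0 T P' Q' P Q (a j) (x j) \<le> real T * \<epsilon>"
  shows "norm (feature_diff \<phi>r \<nu>0 T P' Q' a x - feature_diff \<phi>r \<nu>0 T P Q a x) \<le> 4 * (real T * Br) * \<epsilon>"
proof -
  have tf: "norm (traj_feature \<phi>r \<nu>0 T P' Q' (a j) (x j) - traj_feature \<phi>r \<nu>0 T P Q (a j) (x j))
      \<le> 2 * Br * (real T * \<epsilon>)" if j: "j \<in> {1, 2}" for j
  proof -
    have "norm (traj_feature \<phi>r \<nu>0 T P' Q' (a j) (x j) - traj_feature \<phi>r \<nu>0 T P Q (a j) (x j))
        \<le> (\<Sum>h<T. norm (belief_feature \<phi>r (belief \<nu>0 P' Q' (a j) (x j) h) (a j h)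
                        - belief_feature \<phi>r (belief \<nu>0 P Q (a j) (x j) h) (a j h)))"
      unfolding traj_feature_def sum_subtractf[symmetric] by (rule norm_sum)
    also have "\<dots> \<le> (\<Sum>h<T. 2 * Br * tv (belief \<nu>0 P' Q' (a j) (x j) h) (belief \<nu>0 P Q (a j) (x j) h))"
      unfolding belief_feature_def by (intro sum_mono norm_expectation_diff_le_tv \<phi>r)
    also have "\<dots> = 2 * Br * total_gap \<nu>0 T P' Q' P Q (a j) (x j)"
      by (simp add: total_gap_def sum_distrib_left)
    also have "\<dots> \<le> 2 * Br * (real T * \<epsilon>)" using g[OF j] Br by (intro mult_left_mono) auto
    finally show ?thesis .
  qed
  define A B C D where "A = traj_feature \<phi>r \<nu>0 T P' Q' (a 1) (x 1)"
    and "B = traj_feature \<phi>r \<nu>0 T P' Q' (a 2) (x 2)"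
    and "C = traj_feature \<phi>r \<nu>0 T P Q (a 1) (x 1)" and "D = traj_feature \<phi>r \<nu>0 T P Q (a 2) (x 2)"
  have "feature_diff \<phi>r \<nu>0 T P' Q' a x - feature_diff \<phi>r \<nu>0 T P Q a x = (A - C) - (B - D)"
    by (simp add: feature_diff_def A_def B_def C_def D_def)
  also have "norm \<dots> \<le> norm (A - C) + norm (B - D)" by (rule norm_triangle_ineq4)
  also have "\<dots> \<le> 2 * Br * (real T * \<epsilon>) + 2 * Br * (real T * \<epsilon>)"
    unfolding A_def B_def C_def D_def by (intro add_mono tf) auto
  finally show ?thesis by (simp add: algebra_simps)
qed

text \<open>Hoeffding's lemma for a centred Bernoulli variable, with constant \<open>1 / 2\<close> in place of \<open>1 / 8\<close>. A
  negative \<open>s\<close> reduces to a positive one by exchanging the two outcomes.\<close>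
lemma bernoulli_mgf_le:
  fixes p s :: real
  assumes p: "0 \<le> p" "p \<le> 1"
  shows "p * exp ((1 - p) * s) + (1 - p) * exp (- p * s) \<le> exp (s\<^sup>2 / 2)"
proof -
  have pos_case: "p * exp ((1 - p) * s) + (1 - p) * exp (- p * s) \<le> exp (s\<^sup>2 / 2)"
    if p: "0 \<le> p" "p \<le> 1" and s: "0 \<le> s" for p s :: real
  proof -
    have "1 \<le> exp s" using s by simp
    then have pos: "0 < 1 + p * (exp s - 1)" using p by (intro add_pos_nonneg mult_nonneg_nonneg) auto
    have "p * exp ((1 - p) * s) + (1 - p) * exp (- p * s) = exp (- s * p) * (1 + p * (exp s - 1))"
      by (simp add: algebra_simps flip: exp_add)
    also have "\<dots> = exp (- s * p + ln (1 + p * (exp s - 1)))"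
      using pos unfolding exp_add by simp
    also have "\<dots> \<le> exp (s\<^sup>2 / 2)"
      using Hoeffdings_lemma_aux[OF s p(1)] zero_le_power2[of s] unfolding exp_le_cancel_iff by linarith
    finally show ?thesis .
  qed
  show ?thesis
  proof (cases "0 \<le> s")
    case True
    then show ?thesis using pos_case p by blast
  next
    case False
    then show ?thesis using pos_case[of "1 - p" "- s"] p by (simp add: algebra_simps)
  qed
qed

text \<open>The kernels, and not only the observations, may depend on the sample point: for the neural model
  they depend on the initialization.\<close>
lemma borel_measurable_belief:
  fixes P :: "'z \<Rightarrow> ('s::finite, 'a) trans" and Q :: "'z \<Rightarrow> ('s, 'x::finite) emission"
  assumes P [measurable]: "\<And>s a s'. (\<lambda>z. P z s a s') \<in> borel_measurable Z"
    and Q [measurable]: "\<And>s x. (\<lambda>z. Q z s x) \<in> borel_measurable Z"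
    and X: "\<And>k. k \<in> {1..h} \<Longrightarrow> X k \<in> measurable Z (count_space UNIV)"
  shows "(\<lambda>z. belief \<nu>0 (P z) (Q z) a (\<lambda>k. X k z) h s) \<in> borel_measurable Z"
  using X
proof (induction h arbitrary: s)
  case (Suc h)
  have IH [measurable]: "(\<lambda>z. belief \<nu>0 (P z) (Q z) a (\<lambda>k. X k z) h s) \<in> borel_measurable Z" for s
    using Suc by auto
  have [measurable]: "X (Suc h) \<in> measurable Z (count_space UNIV)" using Suc.prems by auto
  have [measurable]: "(\<lambda>z. Q z s (X (Suc h) z)) \<in> borel_measurable Z" for s
    by (rule measurable_compose_countable[where g = "X (Suc h)" and f = "\<lambda>x z. Q z s x"]) measurable
  show ?case unfolding belief_Suc bayes_def push_def by measurable
qed simp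

text \<open>The same locale for a finite observation type, so that every history takes finitely many values.\<close>
locale finite_preference_data = preference_data M \<nu>0 P Q \<phi>r \<mu>star T N act Obs y
  for M :: "'w measure" and \<nu>0 :: "'s::finite \<Rightarrow> real" and P :: "('s, 'a) trans"
    and Q :: "('s, 'x::finite) emission" and \<phi>r :: "'s \<Rightarrow> 'a \<Rightarrow> real^'d" and \<mu>star :: "real^'d"
    and T N :: nat and act :: "nat \<Rightarrow> nat \<Rightarrow> nat \<Rightarrow> 'a"
    and Obs :: "nat \<Rightarrow> nat \<Rightarrow> nat \<Rightarrow> 'w \<Rightarrow> 'x" and y :: "nat \<Rightarrow> 'w \<Rightarrow> bool"
begin

definition clean_feature :: "nat \<Rightarrow> 'w \<Rightarrow> real^'d" where
  "clean_feature i \<omega> = feature_diff \<phi>r \<nu>0 T P Q (act i) (\<lambda>j k. Obs i j k \<omega>)"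

definition label_noise :: "nat \<Rightarrow> 'w \<Rightarrow> real" where
  "label_noise i \<omega> = of_bool (y i \<omega>) - sigmoid (clean_feature i \<omega> \<bullet> \<mu>star)"

abbreviation data_record :: "nat \<Rightarrow> 'w \<Rightarrow> 'x list \<times> 'x list \<times> bool" where
  "data_record i \<omega> \<equiv> (map (\<lambda>k. Obs i 1 k \<omega>) [1..<Suc T], map (\<lambda>k. Obs i 2 k \<omega>) [1..<Suc T], y i \<omega>)"

text \<open>The clean feature as a function of the recorded lists, which are the objects whose independence is
  assumed; the observation at time \<open>k\<close> is the list entry \<open>k - 1\<close>.\<close>
definition record_feature :: "nat \<Rightarrow> 'x list \<times> 'x list \<times> bool \<Rightarrow> real^'d" where
  "record_feature i d = feature_diff \<phi>r \<nu>0 T P Q (act i)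
     (\<lambda>j k. (if j = 1 then fst d else fst (snd d)) ! (k - 1))"

lemma clean_feature_eq: "clean_feature i \<omega> = record_feature i (data_record i \<omega>)"
  unfolding clean_feature_def record_feature_def
  by (rule feature_diff_cong) (auto simp del: upt_Suc)

lemma measurable_record: "i \<in> {1..N} \<Longrightarrow> data_record i \<in> measurable M (count_space UNIV)"
  using comparisons_independent by (simp add: indep_vars_def del: upt_Suc)

lemma measurable_clean_feature:
  assumes "i \<in> {1..N}"
  shows "clean_feature i \<in> measurable M (count_space UNIV)" "clean_feature i \<in> borel_measurable M"
proof -
  have eq: "clean_feature i = (\<lambda>\<omega>. record_feature i (data_record i \<omega>))"
    using clean_feature_eq by (rule ext)
  show "clean_feature i \<in> measurable M (count_space UNIV)" "clean_feature i \<in> borel_measurable M"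
    unfolding eq by (rule measurable_compose[OF measurable_record[OF assms]]; simp)+
qed

lemma measurable_label_noise:
  assumes i: "i \<in> {1..N}"
  shows "label_noise i \<in> borel_measurable M"
proof -
  have eq: "label_noise i = (\<lambda>\<omega>. (\<lambda>d. of_bool (snd (snd d)) - sigmoid (record_feature i d \<bullet> \<mu>star)) (data_record i \<omega>))"
    by (simp add: label_noise_def clean_feature_eq fun_eq_iff del: upt_Suc)
  show ?thesis unfolding eq by (rule measurable_compose[OF measurable_record[OF i]]) simp
qed

lemma finite_range_clean_feature: "finite (range (clean_feature i :: 'w \<Rightarrow> real^'d))"
proof -
  define S where "S = {xs :: 'x list. set xs \<subseteq> UNIV \<and> length xs = T}"
  have fin: "finite S" unfolding S_def by (rule finite_lists_length_eq[OF finite])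
  have "data_record i \<omega> \<in> S \<times> S \<times> UNIV" for \<omega> by (simp add: S_def del: upt_Suc)
  then have "range (clean_feature i) \<subseteq> record_feature i ` (S \<times> S \<times> UNIV)"
    unfolding clean_feature_eq[abs_def] by (intro image_subsetI imageI)
  then show ?thesis by (rule finite_subset) (use fin in auto)
qed

text \<open>Conditionally on each of the finitely many values of the clean feature the label noise is a centred
  Bernoulli variable, so that \<open>bernoulli_mgf_le\<close> applies value by value.\<close>
lemma label_noise_mgf:
  fixes u :: "real^'d"
  assumes i: "i \<in> {1..N}"
  shows "(\<integral>\<^sup>+\<omega>. ennreal (exp (label_noise i \<omega> * (u \<bullet> clean_feature i \<omega>) - (u \<bullet> clean_feature i \<omega>)\<^sup>2 / 2)) \<partial>M) \<le> 1"
proof -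
  define V where "V = range (clean_feature i)"
  have V: "finite V" unfolding V_def by (rule finite_range_clean_feature)
  define A where "A v = {\<omega> \<in> space M. clean_feature i \<omega> = v}" for v
  define A1 where "A1 v = {\<omega> \<in> space M. y i \<omega> \<and> clean_feature i \<omega> = v}" for v
  define A0 where "A0 v = {\<omega> \<in> space M. \<not> y i \<omega> \<and> clean_feature i \<omega> = v}" for v
  define w where "w b v = exp ((b - sigmoid (v \<bullet> \<mu>star)) * (u \<bullet> v) - (u \<bullet> v)\<^sup>2 / 2)" for b v
  note [measurable] = measurable_clean_feature(1)[OF i] label_measurable[OF i]
  have A_sets [measurable]: "A v \<in> sets M" "A1 v \<in> sets M" "A0 v \<in> sets M" for v
    unfolding A_def A1_def A0_def by measurable
  have split: "prob (A v) = prob (A1 v) + prob (A0 v)" for v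
  proof -
    have "A v = A1 v \<union> A0 v" "A1 v \<inter> A0 v = {}" by (auto simp: A_def A1_def A0_def)
    then show ?thesis using finite_measure_Union[of "A1 v" "A0 v"] A_sets by auto
  qed
  have integrand: "exp (label_noise i \<omega> * (u \<bullet> clean_feature i \<omega>) - (u \<bullet> clean_feature i \<omega>)\<^sup>2 / 2)
      = (\<Sum>v\<in>V. w 1 v * indicator (A1 v) \<omega> + w 0 v * indicator (A0 v) \<omega>)" if \<omega>: "\<omega> \<in> space M" for \<omega>
  proof -
    have "(\<Sum>v\<in>V. w 1 v * indicator (A1 v) \<omega> + w 0 v * indicator (A0 v) \<omega>)
        = (\<Sum>v\<in>V. if v = clean_feature i \<omega> then w (of_bool (y i \<omega>)) v else 0)"
      using \<omega> by (intro sum.cong) (auto simp: A1_def A0_def indicator_def)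
    also have "\<dots> = w (of_bool (y i \<omega>)) (clean_feature i \<omega>)"
      using V by (simp add: V_def)
    finally show ?thesis by (simp add: w_def label_noise_def)
  qed
  have value_bound: "w 1 v * prob (A1 v) + w 0 v * prob (A0 v) \<le> prob (A v)" for v
  proof (cases "prob (A v) = 0")
    case True
    then show ?thesis using split[of v] by (simp add: add_nonneg_eq_0_iff)
  next
    case False
    define p where "p = sigmoid (v \<bullet> \<mu>star)"
    have pos: "0 < prob (A v)" using False by (simp add: zero_less_measure_iff)
    have "prob (A1 v) / prob (A v) = p"
      using label_law[OF i, of v] pos
      by (simp add: A_def A1_def cond_prob_def p_def clean_feature_def)
    then have P1: "prob (A1 v) = prob (A v) * p" using pos by (simp add: field_simps)
    then have P0: "prob (A0 v) = prob (A v) * (1 - p)" using split[of v] by (simp add: algebra_simps)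
    have p: "0 \<le> p" "p \<le> 1" using sigmoid_bounds less_imp_le by (auto simp: p_def)
    have "w 1 v = exp ((1 - p) * (u \<bullet> v)) * exp (- ((u \<bullet> v)\<^sup>2 / 2))"
      "w 0 v = exp (- p * (u \<bullet> v)) * exp (- ((u \<bullet> v)\<^sup>2 / 2))"
      by (simp_all add: w_def p_def flip: exp_add)
    then have "w 1 v * prob (A1 v) + w 0 v * prob (A0 v)
        = prob (A v) * ((p * exp ((1 - p) * (u \<bullet> v)) + (1 - p) * exp (- p * (u \<bullet> v))) * exp (- ((u \<bullet> v)\<^sup>2 / 2)))"
      by (simp only: P1 P0) (simp only: distrib_left distrib_right mult_ac)
    also have "\<dots> \<le> prob (A v) * (exp ((u \<bullet> v)\<^sup>2 / 2) * exp (- ((u \<bullet> v)\<^sup>2 / 2)))"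
      using bernoulli_mgf_le[OF p] by (intro mult_left_mono mult_right_mono) auto
    finally show ?thesis by (simp flip: exp_add)
  qed
  have "(\<integral>\<^sup>+\<omega>. ennreal (exp (label_noise i \<omega> * (u \<bullet> clean_feature i \<omega>) - (u \<bullet> clean_feature i \<omega>)\<^sup>2 / 2)) \<partial>M)
      = (\<integral>\<^sup>+\<omega>. (\<Sum>v\<in>V. ennreal (w 1 v) * indicator (A1 v) \<omega> + ennreal (w 0 v) * indicator (A0 v) \<omega>) \<partial>M)"
    by (intro nn_integral_cong)
       (simp add: integrand sum_ennreal[symmetric] ennreal_mult' w_def ennreal_indicator del: sum_ennreal)
  also have "\<dots> = (\<Sum>v\<in>V. ennreal (w 1 v) * emeasure M (A1 v) + ennreal (w 0 v) * emeasure M (A0 v))"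
    by (simp add: nn_integral_sum nn_integral_add nn_integral_cmult_indicator)
  also have "\<dots> = (\<Sum>v\<in>V. ennreal (w 1 v * prob (A1 v) + w 0 v * prob (A0 v)))"
    by (simp add: emeasure_eq_measure ennreal_mult' w_def)
  also have "\<dots> \<le> (\<Sum>v\<in>V. ennreal (prob (A v)))"
    by (intro sum_mono ennreal_leI value_bound)
  also have "\<dots> = ennreal (\<Sum>v\<in>V. prob (A v))" by (simp add: sum_ennreal)
  also have "(\<Sum>v\<in>V. prob (A v)) = prob (\<Union>v\<in>V. A v)"
    using V by (intro finite_measure_finite_Union[symmetric])
      (auto simp: disjoint_family_on_def A_def A_sets[unfolded A_def])
  also have "ennreal \<dots> \<le> 1" by simp
  finally show ?thesis .
qed

lemma preference_mgf:
  fixes u :: "real^'d"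
  shows "(\<integral>\<^sup>+\<omega>. ennreal (exp (\<Sum>i\<in>{1..N}. label_noise i \<omega> * (u \<bullet> clean_feature i \<omega>)
            - (u \<bullet> clean_feature i \<omega>)\<^sup>2 / 2)) \<partial>M) \<le> 1"
proof -
  define X where "X i \<omega> = ennreal (exp (label_noise i \<omega> * (u \<bullet> clean_feature i \<omega>)
            - (u \<bullet> clean_feature i \<omega>)\<^sup>2 / 2))" for i \<omega>
  define F where "F i d = ennreal (exp ((of_bool (snd (snd d)) - sigmoid (record_feature i d \<bullet> \<mu>star))
     * (u \<bullet> record_feature i d) - (u \<bullet> record_feature i d)\<^sup>2 / 2))" for i d
  have X_F: "X i = (\<lambda>\<omega>. F i (data_record i \<omega>))" for i
    by (simp add: X_def F_def label_noise_def clean_feature_eq fun_eq_iff del: upt_Suc)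
  have indep: "indep_vars (\<lambda>_. borel) X {1..N}"
    unfolding X_F[abs_def]
    by (rule indep_vars_compose2[OF comparisons_independent]) simp
  have "(\<integral>\<^sup>+\<omega>. ennreal (exp (\<Sum>i\<in>{1..N}. label_noise i \<omega> * (u \<bullet> clean_feature i \<omega>)
            - (u \<bullet> clean_feature i \<omega>)\<^sup>2 / 2)) \<partial>M) = (\<integral>\<^sup>+\<omega>. (\<Prod>i\<in>{1..N}. X i \<omega>) \<partial>M)"
    by (simp add: X_def exp_sum prod_ennreal)
  also have "\<dots> = (\<Prod>i\<in>{1..N}. \<integral>\<^sup>+\<omega>. X i \<omega> \<partial>M)"
    by (rule indep_vars_nn_integral[OF _ indep]) auto
  also have "\<dots> \<le> (\<Prod>i\<in>{1..N}. 1)"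
    unfolding X_def by (intro prod_mono_ennreal label_noise_mgf) auto
  finally show ?thesis by simp
qed

section \<open>The good event\<close>

text \<open>The second condition is the one under which \<open>self_normalized_bound\<close> controls the label noise
  in all directions.\<close>
definition good_event ::
  "('s, 'a) trans \<Rightarrow> ('s, 'x) emission \<Rightarrow> real \<Rightarrow> real \<Rightarrow> real \<Rightarrow> 'w \<Rightarrow> bool" where
  "good_event P' Q' \<epsilon> l \<delta>c \<omega> \<longleftrightarrow>
     (\<forall>i\<in>{1..N}. \<forall>j\<in>{1, 2}. total_gap \<nu>0 T P' Q' P Q (act i j) (\<lambda>k. Obs i j k \<omega>) \<le> real T * \<epsilon>) \<and>
     mixture l {1..N} (\<lambda>i. label_noise i \<omega>) (\<lambda>i. clean_feature i \<omega>) \<le> ennreal (1 / \<delta>c)"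

lemma measurable_total_gap:
  fixes P' :: "'z \<Rightarrow> ('s, 'a) trans" and Q' :: "'z \<Rightarrow> ('s, 'x) emission"
  assumes f: "f \<in> measurable Z M"
    and P' [measurable]: "\<And>s a s'. (\<lambda>z. P' z s a s') \<in> borel_measurable Z"
    and Q' [measurable]: "\<And>s x. (\<lambda>z. Q' z s x) \<in> borel_measurable Z"
    and ij: "i \<in> {1..N}" "j \<in> {1, 2}"
  shows "(\<lambda>z. total_gap \<nu>0 T (P' z) (Q' z) P Q (act i j) (\<lambda>k. Obs i j k (f z))) \<in> borel_measurable Z"
proof -
  have X: "(\<lambda>z. Obs i j k (f z)) \<in> measurable Z (count_space UNIV)" if "k \<in> {1..h}" "h < T" for k h
    by (rule measurable_compose[OF f obs_measurable[OF ij]]) (use that in auto)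
  have [measurable]: "(\<lambda>z. belief \<nu>0 (P' z) (Q' z) (act i j) (\<lambda>k. Obs i j k (f z)) h s) \<in> borel_measurable Z"
    "(\<lambda>z. belief \<nu>0 P Q (act i j) (\<lambda>k. Obs i j k (f z)) h s) \<in> borel_measurable Z" if "h < T" for h s
    by (rule borel_measurable_belief; use X that in auto)+
  show ?thesis unfolding total_gap_def tv_def by measurable
qed

lemma good_event_measurable:
  fixes P' :: "'z \<Rightarrow> ('s, 'a) trans" and Q' :: "'z \<Rightarrow> ('s, 'x) emission"
  assumes f [measurable]: "f \<in> measurable Z M"
    and P' [measurable]: "\<And>s a s'. (\<lambda>z. P' z s a s') \<in> borel_measurable Z"
    and Q' [measurable]: "\<And>s x. (\<lambda>z. Q' z s x) \<in> borel_measurable Z"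
    and [measurable]: "\<epsilon> \<in> borel_measurable Z" "l \<in> borel_measurable Z"
  shows "{z \<in> space Z. good_event (P' z) (Q' z) (\<epsilon> z) (l z) \<delta>c (f z)} \<in> sets Z"
proof -
  have mix: "(\<lambda>z. mixture (l z) {1..N} (\<lambda>i. label_noise i (f z)) (\<lambda>i. clean_feature i (f z))) \<in> borel_measurable Z"
    using measurable_compose[OF f measurable_label_noise] measurable_compose[OF f measurable_clean_feature(2)]
    by (intro borel_measurable_mixture) auto
  show ?thesis
    unfolding good_event_def
    by (intro sets.sets_Collect_conj sets.sets_Collect_finite_All borel_measurable_le[OF measurable_total_gap[OF f P' Q']] borel_measurable_le[OF mix]) auto
qed

text \<open>A union bound over the \<open>2 * N\<close> histories, each failing with probability at most \<open>\<delta>b / (2 * N)\<close>, and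
  Markov's inequality for the mixture, whose mean is at most 1.\<close>
lemma prob_good_event:
  assumes pert: "belief_perturbation \<nu>0 P P' Q Q' \<alpha> c"
    and T: "1 \<le> T" and N: "1 \<le> N" and \<delta>b: "0 < \<delta>b" "\<delta>b < 1" and \<delta>c: "0 < \<delta>c" and l: "0 < l"
    and \<epsilon>: "\<epsilon> = belief_error \<alpha> c T \<delta>b (2 * real N)"
  shows "1 - (\<delta>b + \<delta>c) \<le> prob {\<omega> \<in> space M. good_event P' Q' \<epsilon> l \<delta>c \<omega>}"
proof -
  interpret pert: belief_perturbation \<nu>0 P P' Q Q' \<alpha> c by (rule pert)
  define G where "G = {\<omega> \<in> space M. good_event P' Q' \<epsilon> l \<delta>c \<omega>}"
  have G [measurable]: "G \<in> sets M"
    unfolding G_def by (rule good_event_measurable[of "\<lambda>\<omega>. \<omega>"]) auto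
  define far where "far i j = {\<omega> \<in> space M. real T * \<epsilon> < total_gap \<nu>0 T P' Q' P Q (act i j) (\<lambda>k. Obs i j k \<omega>)}" for i j
  define heavy where "heavy = {\<omega> \<in> space M. ennreal (1 / \<delta>c) \<le>
      mixture l {1..N} (\<lambda>i. label_noise i \<omega>) (\<lambda>i. clean_feature i \<omega>)}"
  have far_sets: "far i j \<in> sets M" if ij: "i \<in> {1..N}" "j \<in> {1, 2}" for i j
    unfolding far_def using measurable_total_gap[of "\<lambda>\<omega>. \<omega>" M "\<lambda>_. P'" "\<lambda>_. Q'", OF _ _ _ ij] by measurable
  have mix_meas [measurable]: "(\<lambda>\<omega>. mixture l {1..N} (\<lambda>i. label_noise i \<omega>) (\<lambda>i. clean_feature i \<omega>)) \<in> borel_measurable M"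
    using measurable_label_noise measurable_clean_feature(2) by (intro borel_measurable_mixture) auto
  have heavy_sets: "heavy \<in> sets M" unfolding heavy_def by measurable
  have far_prob: "prob (far i j) \<le> \<delta>b / (2 * real N)" if ij: "i \<in> {1..N}" "j \<in> {1, 2}" for i j
  proof -
    have "\<delta>b < 2 * real N" using \<delta>b N by linarith
    then show ?thesis
      unfolding far_def total_gap_def pert.gap_def[symmetric]
      using pert.accumulated_gap_tail[OF prob_space_axioms obs_measurable[OF ij] obs_law[OF ij] T \<delta>b(1) _ \<epsilon>]
      by auto
  qed
  have heavy_prob: "prob heavy \<le> \<delta>c"
  proof -
    have "emeasure M heavy \<le> ennreal \<delta>c *
        (\<integral>\<^sup>+\<omega>. mixture l {1..N} (\<lambda>i. label_noise i \<omega>) (\<lambda>i. clean_feature i \<omega>) * indicator (space M) \<omega> \<partial>M)"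
    proof -
      have "heavy = {\<omega> \<in> space M. 1 \<le> ennreal \<delta>c * mixture l {1..N} (\<lambda>i. label_noise i \<omega>) (\<lambda>i. clean_feature i \<omega>)}"
      proof -
        have "ennreal (1 / \<delta>c) \<le> m \<longleftrightarrow> 1 \<le> ennreal \<delta>c * m" for m
          using \<delta>c by (cases m) (auto simp: ennreal_mult[symmetric] ennreal_mult_top field_simps simp flip: ennreal_1)
        then show ?thesis unfolding heavy_def by simp
      qed
      then show ?thesis by (simp only:) (intro nn_integral_Markov_inequality, measurable)
    qed
    also have "\<dots> = ennreal \<delta>c * (\<integral>\<^sup>+\<omega>. mixture l {1..N} (\<lambda>i. label_noise i \<omega>) (\<lambda>i. clean_feature i \<omega>) \<partial>M)"
      by (intro arg_cong2[where f="(*)"] refl nn_integral_cong) simp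
    also have "\<dots> \<le> ennreal \<delta>c * 1"
      using l measurable_label_noise measurable_clean_feature(2)
      by (intro mult_left_mono expectation_mixture_le_1 preference_mgf) auto
    finally show ?thesis using \<delta>c by (simp add: emeasure_eq_measure)
  qed
  have cover: "space M - G \<subseteq> (\<Union>(i, j)\<in>{1..N} \<times> {1, 2}. far i j) \<union> heavy"
    by (auto simp: G_def good_event_def far_def heavy_def not_le)
  have UN_sets: "(\<Union>(i, j)\<in>{1..N} \<times> {1, 2}. far i j) \<in> sets M"
    using far_sets by (intro sets.finite_UN) auto
  have "prob (space M - G) \<le> prob ((\<Union>(i, j)\<in>{1..N} \<times> {1, 2}. far i j) \<union> heavy)"
    by (intro finite_measure_mono[OF cover] sets.Un UN_sets heavy_sets)
  also have "\<dots> \<le> prob (\<Union>(i, j)\<in>{1..N} \<times> {1, 2}. far i j) + prob heavy"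
    by (intro measure_Un_le UN_sets heavy_sets)
  also have "\<dots> \<le> (\<Sum>(i, j)\<in>{1..N} \<times> {1, 2::nat}. prob (far i j)) + prob heavy"
    unfolding case_prod_unfold using far_sets
    by (intro add_right_mono finite_measure_subadditive_finite) auto
  also have "\<dots> \<le> (\<Sum>(i, j)\<in>{1..N} \<times> {1, 2::nat}. \<delta>b / (2 * real N)) + \<delta>c"
    using far_prob heavy_prob by (intro add_mono sum_mono) auto
  also have "\<dots> = \<delta>b + \<delta>c" using N by (simp add: case_prod_unfold)
  finally have "prob (space M - G) \<le> \<delta>b + \<delta>c" .
  then show ?thesis using prob_compl[OF G] by (simp add: G_def[symmetric])
qed

lemma good_event_imp_bound:
  assumes regular: "regular_kernels P Q" "regular_kernels P' Q'" and prior: "prob_vector \<nu>0"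
    and T: "1 \<le> T" and N: "1 \<le> N" and Br: "0 < Br" and \<phi>r: "\<And>s a. norm (\<phi>r s a) \<le> Br"
    and \<mu>: "norm \<mu>star \<le> r" and \<delta>c: "0 < \<delta>c" "\<delta>c < 1" and c\<zeta>: "1 < c\<zeta>" and \<epsilon>: "0 < \<epsilon>"
    and good: "good_event P' Q' \<epsilon> (real N * zeta_reg c\<zeta> T Br \<epsilon>) \<delta>c \<omega>"
    and mle: "constrained_mle r N
      (\<lambda>i. feature_diff \<phi>r \<nu>0 T P' Q' (act i) (\<lambda>j k. Obs i j k \<omega>)) (\<lambda>i. y i \<omega>) \<mu>"
  shows "mat_norm (empirical_cov N (\<lambda>i. feature_diff \<phi>r \<nu>0 T P' Q' (act i) (\<lambda>j k. Obs i j k \<omega>))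
      + mat (zeta_reg c\<zeta> T Br \<epsilon>)) (\<mu> - \<mu>star) \<le> estimation_bound c\<zeta> \<delta>c CARD('d) T N Br r \<epsilon>"
proof (rule mle_error_bound[OF N T Br \<epsilon> c\<zeta> \<delta>c _ _ _ mle \<mu>, where \<phi> = "\<lambda>i. clean_feature i \<omega>"])
  show "norm (clean_feature i \<omega>) \<le> 2 * (real T * Br)" for i
    unfolding clean_feature_def by (intro norm_feature_diff_le prior regular \<phi>r)
  show "norm (feature_diff \<phi>r \<nu>0 T P' Q' (act i) (\<lambda>j k. Obs i j k \<omega>)) \<le> 2 * (real T * Br)" for i
    by (intro norm_feature_diff_le prior regular \<phi>r)
  show "norm (feature_diff \<phi>r \<nu>0 T P' Q' (act i) (\<lambda>j k. Obs i j k \<omega>) - clean_feature i \<omega>)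
      \<le> 4 * (real T * Br) * \<epsilon>" if "i \<in> {1..N}" for i
    unfolding clean_feature_def using good that Br
    by (intro norm_feature_diff_error_le \<phi>r) (auto simp: good_event_def)
  show "mixture (real N * zeta_reg c\<zeta> T Br \<epsilon>) {1..N}
      (\<lambda>i. of_bool (y i \<omega>) - sigmoid (clean_feature i \<omega> \<bullet> \<mu>star)) (\<lambda>i. clean_feature i \<omega>) \<le> ennreal (1 / \<delta>c)"
    using good by (simp add: good_event_def label_noise_def)
qed

end

section \<open>Softmax kernels\<close>

lemma regular_kernels_softmax:
  "regular_kernels (\<lambda>s a. softmax (F s a)) (\<lambda>s. softmax (H s))"
  by (simp add: regular_kernels_def prob_vector_softmax softmax_pos)

lemma kappa_trans_bounds:
  assumes p: "p \<in> D" and K: "\<And>p s a. prob_vector (K p s a)"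
  shows "kappa_trans K D \<le> (\<Sum>x\<in>UNIV. min (K p s a x) (K p s' a x))" and "kappa_trans K D \<le> 1"
proof -
  have pos: "0 \<le> (\<Sum>x\<in>UNIV. min (K p s a x) (K p s' a x))" for p s s' a
    using prob_vector_nonneg[OF K] by (intro sum_nonneg) auto
  have le: "kappa_trans K D \<le> (\<Sum>x\<in>UNIV. min (K p s a x) (K p s' a x))" for s s' a
  proof -
    have "kappa_trans K D \<le> (INF (s, s', a)\<in>UNIV. \<Sum>x\<in>UNIV. min (K p s a x) (K p s' a x))"
      unfolding kappa_trans_def
      by (rule cINF_lower[OF _ p]) (auto intro!: bdd_belowI2[of _ 0] cINF_greatest pos)
    also have "\<dots> \<le> (case (s, s', a) of (s, s', a) \<Rightarrow> \<Sum>x\<in>UNIV. min (K p s a x) (K p s' a x))"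
      by (rule cINF_lower) (auto intro!: bdd_belowI2[of _ 0] pos)
    finally show ?thesis by simp
  qed
  show "kappa_trans K D \<le> (\<Sum>x\<in>UNIV. min (K p s a x) (K p s' a x))" by (rule le)
  show "kappa_trans K D \<le> 1"
    using le[of undefined undefined undefined] prob_vector_sum1[OF K, of p undefined undefined] by simp
qed

lemma kappa_obs_bounds:
  assumes p: "p \<in> D" and K: "\<And>p s. prob_vector (K p s)"
  shows "kappa_obs K D \<le> (\<Sum>x\<in>UNIV. min (K p s x) (K p s' x))" and "kappa_obs K D \<le> 1"
proof -
  have pos: "0 \<le> (\<Sum>x\<in>UNIV. min (K p s x) (K p s' x))" for p s s'
    using prob_vector_nonneg[OF K] by (intro sum_nonneg) auto
  have le: "kappa_obs K D \<le> (\<Sum>x\<in>UNIV. min (K p s x) (K p s' x))" for s s'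
  proof -
    have "kappa_obs K D \<le> (INF (s, s')\<in>UNIV. \<Sum>x\<in>UNIV. min (K p s x) (K p s' x))"
      unfolding kappa_obs_def
      by (rule cINF_lower[OF _ p]) (auto intro!: bdd_belowI2[of _ 0] cINF_greatest pos)
    also have "\<dots> \<le> (case (s, s') of (s, s') \<Rightarrow> \<Sum>x\<in>UNIV. min (K p s x) (K p s' x))"
      by (rule cINF_lower) (auto intro!: bdd_belowI2[of _ 0] pos)
    finally show ?thesis by simp
  qed
  show "kappa_obs K D \<le> (\<Sum>x\<in>UNIV. min (K p s x) (K p s' x))" by (rule le)
  show "kappa_obs K D \<le> 1"
    using le[of undefined undefined] prob_vector_sum1[OF K, of p undefined] by simp
qed

text \<open>The common form of both models: scores at uniform distance at most \<open>2 * eP\<close> and \<open>2 * eQ\<close>, that is,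
  softmax kernels at total variation distance at most \<open>eP\<close> and \<open>eQ\<close>.\<close>
lemma softmax_belief_perturbation:
  fixes F F' :: "'s::finite \<Rightarrow> 'a \<Rightarrow> 's \<Rightarrow> real" and H H' :: "'s \<Rightarrow> 'x::finite \<Rightarrow> real"
  assumes prior: "prob_vector \<nu>0"
    and F: "\<And>s a s'. \<bar>F' s a s' - F s a s'\<bar> \<le> 2 * eP" and H: "\<And>s x. \<bar>H' s x - H s x\<bar> \<le> 2 * eQ"
    and overlapP: "\<And>s s' a. \<kappa>P \<le> (\<Sum>x\<in>UNIV. min (softmax (F' s a) x) (softmax (F' s' a) x))"
    and overlapQ: "\<And>s s'. \<kappa>Q \<le> (\<Sum>x\<in>UNIV. min (softmax (H' s) x) (softmax (H' s') x))"
    and \<kappa>: "\<kappa>P \<le> 1" "\<kappa>Q \<le> 1" and \<alpha>: "contraction \<kappa>P \<kappa>Q < 1"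
  shows "belief_perturbation \<nu>0 (\<lambda>s a. softmax (F s a)) (\<lambda>s a. softmax (F' s a))
      (\<lambda>s. softmax (H s)) (\<lambda>s. softmax (H' s)) (contraction \<kappa>P \<kappa>Q) ((3 - 2 * \<kappa>Q) * eP + 2 * eQ)"
proof
  have "0 \<le> 2 * eP" "0 \<le> 2 * eQ" using F H by (meson abs_ge_zero order_trans)+
  then show "0 \<le> (3 - 2 * \<kappa>Q) * eP + 2 * eQ" using \<kappa> by simp
  show "0 \<le> contraction \<kappa>P \<kappa>Q" using \<kappa> by (simp add: contraction_def)
  show "(\<Sum>x\<in>UNIV. push (predict (\<lambda>s a. softmax (F s a)) a b) (\<lambda>s. softmax (H s)) x *
         tv (bayes (predict (\<lambda>s a. softmax (F' s a)) a b') (\<lambda>s. softmax (H' s)) x)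
          (bayes (predict (\<lambda>s a. softmax (F s a)) a b) (\<lambda>s. softmax (H s)) x))
      \<le> contraction \<kappa>P \<kappa>Q * tv b' b + ((3 - 2 * \<kappa>Q) * eP + 2 * eQ)"
    if "prob_vector b" "prob_vector b'" for a b b'
  proof (rule filter_step_contraction[OF that regular_kernels_softmax regular_kernels_softmax overlapP overlapQ \<kappa>])
    show "tv (softmax (F' s a)) (softmax (F s a)) \<le> eP" for s a
      using tv_softmax_le[of "F' s a" "F s a" "2 * eP"] F by simp
    show "tv (softmax (H' s)) (softmax (H s)) \<le> eQ" for s
      using tv_softmax_le[of "H' s" "H s" "2 * eQ"] H by simp
  qed
qed (use prior \<alpha> in \<open>simp_all add: regular_kernels_softmax\<close>)

lemma (in belief_perturbation) belief_error_pos: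
  assumes "1 \<le> T" "0 < \<delta>" "\<delta> < K"
  shows "0 < belief_error \<alpha> c T \<delta> K"
proof (rule belief_error_rate(1)[OF \<alpha> c])
  show "0 < ln (K / \<delta>) / real T" using assms by simp
  show "belief_error \<alpha> c T \<delta> K = 2 * c / (1 - \<alpha>)
      + 2 / (1 - \<alpha>) * sqrt (2 * c * (ln (K / \<delta>) / real T))
      + ln (K / \<delta>) / real T / (1 - \<alpha>) * (4 / 3 + 2 * \<alpha> / (1 - \<alpha>))"
    by (simp add: belief_error_def)
qed

lemma zeta_reg_pos: "\<lbrakk>1 \<le> T; 0 < Br; 1 < c\<zeta>; 0 < \<epsilon>\<rbrakk> \<Longrightarrow> 0 < zeta_reg c\<zeta> T Br \<epsilon>"
  by (simp add: zeta_reg_def)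

lemma loglin_score_diff:
  assumes "norm (v :: real^'n) \<le> B"
  shows "\<bar>\<theta> \<bullet> v - \<theta>' \<bullet> v\<bar> \<le> 2 * (B / 2 * norm (\<theta> - \<theta>'))"
proof -
  have "\<bar>\<theta> \<bullet> v - \<theta>' \<bullet> v\<bar> \<le> norm (\<theta> - \<theta>') * norm v"
    by (simp add: inner_diff_left[symmetric] Cauchy_Schwarz_ineq2)
  also have "\<dots> \<le> norm (\<theta> - \<theta>') * B" using assms by (intro mult_left_mono) auto
  finally show ?thesis by (simp add: mult.commute)
qed

text \<open>Triangle inequality through the two linearized scores, whose difference is linear in the weights.\<close>
lemma nn_score_diff:
  assumes "norm (nn_tangent z0 c W0 x) \<le> B"
    and "\<bar>nn_score c W x - nn_lin_score z0 c W0 W x\<bar> \<le> e"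
    and "\<bar>nn_score c W' x - nn_lin_score z0 c W0 W' x\<bar> \<le> e"
  shows "\<bar>nn_score c W x - nn_score c W' x\<bar> \<le> 2 * (B / 2 * norm (W - W') + e)"
proof -
  have "\<bar>nn_lin_score z0 c W0 W x - nn_lin_score z0 c W0 W' x\<bar> = \<bar>nn_tangent z0 c W0 x \<bullet> (W - W')\<bar>"
    by (simp add: nn_lin_score_def inner_diff_right)
  also have "\<dots> \<le> norm (nn_tangent z0 c W0 x) * norm (W - W')" by (rule Cauchy_Schwarz_ineq2)
  also have "\<dots> \<le> B * norm (W - W')" using assms(1) by (intro mult_right_mono) auto
  finally have "\<bar>nn_lin_score z0 c W0 W x - nn_lin_score z0 c W0 W' x\<bar> \<le> B * norm (W - W')" .
  then show ?thesis using assms(2,3) by (simp add: distrib_left)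
qed

lemma loglin_belief_perturbation:
  fixes \<phi>p :: "'s::finite \<Rightarrow> 'a \<Rightarrow> 's \<Rightarrow> real^'dp" and \<phi>q :: "'s \<Rightarrow> 'x::finite \<Rightarrow> real^'dw"
  assumes prior: "prob_vector \<nu>0"
    and \<phi>p: "\<And>s a s'. norm (\<phi>p s a s') \<le> B" and \<phi>q: "\<And>s x. norm (\<phi>q s x) \<le> B"
    and \<kappa>P: "\<And>s s' a. \<kappa>P \<le> (\<Sum>x\<in>UNIV. min (loglin_trans \<phi>p \<theta> s a x) (loglin_trans \<phi>p \<theta> s' a x))"
    and \<kappa>Q: "\<And>s s'. \<kappa>Q \<le> (\<Sum>x\<in>UNIV. min (loglin_obs \<phi>q w s x) (loglin_obs \<phi>q w s' x))"
    and \<kappa>: "\<kappa>P \<le> 1" "\<kappa>Q \<le> 1" and \<alpha>: "contraction \<kappa>P \<kappa>Q < 1"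
  shows "belief_perturbation \<nu>0 (loglin_trans \<phi>p \<theta>s) (loglin_trans \<phi>p \<theta>) (loglin_obs \<phi>q ws) (loglin_obs \<phi>q w)
    (contraction \<kappa>P \<kappa>Q) (loglin_cb B \<kappa>Q (norm (w - ws)) (norm (\<theta> - \<theta>s)))"
proof -
  have c_eq: "loglin_cb B \<kappa>Q (norm (w - ws)) (norm (\<theta> - \<theta>s))
      = (3 - 2 * \<kappa>Q) * (B / 2 * norm (\<theta> - \<theta>s)) + 2 * (B / 2 * norm (w - ws))"
    by (simp add: loglin_cb_def distrib_left)
  have kernels: "loglin_trans \<phi>p \<theta>' = (\<lambda>s a. softmax (\<lambda>s'. \<theta>' \<bullet> \<phi>p s a s'))"
    "loglin_obs \<phi>q w' = (\<lambda>s. softmax (\<lambda>x. w' \<bullet> \<phi>q s x))" for \<theta>' w'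
    by (simp_all add: loglin_trans_def loglin_obs_def fun_eq_iff)
  show ?thesis
    unfolding c_eq kernels
    by (rule softmax_belief_perturbation[OF prior loglin_score_diff[OF \<phi>p] loglin_score_diff[OF \<phi>q]
        \<kappa>P[unfolded kernels] \<kappa>Q[unfolded kernels] \<kappa> \<alpha>])
qed

lemma nn_belief_perturbation:
  fixes eP :: "'s::finite \<Rightarrow> 'a \<Rightarrow> 's \<Rightarrow> real^'ep" and eQ :: "'s \<Rightarrow> 'x::finite \<Rightarrow> real^'eq"
  assumes prior: "prob_vector \<nu>0"
    and tP: "\<And>s a s'. norm (nn_tangent z0 cP WP0 (eP s a s')) \<le> B"
    and tQ: "\<And>s x. norm (nn_tangent z0 cQ WQ0 (eQ s x)) \<le> B"
    and lin: "linearization_ok z0 eP eQ \<epsilon>P \<epsilon>Q cP cQ WP0 WQ0 DP DQ"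
    and dom: "WPs \<in> DP" "WQs \<in> DQ" "WP \<in> DP" "WQ \<in> DQ"
    and \<kappa>P: "\<And>s s' a. \<kappa>P \<le> (\<Sum>x\<in>UNIV. min (nn_trans cP eP WP s a x) (nn_trans cP eP WP s' a x))"
    and \<kappa>Q: "\<And>s s'. \<kappa>Q \<le> (\<Sum>x\<in>UNIV. min (nn_obs cQ eQ WQ s x) (nn_obs cQ eQ WQ s' x))"
    and \<kappa>: "\<kappa>P \<le> 1" "\<kappa>Q \<le> 1" and \<alpha>: "contraction \<kappa>P \<kappa>Q < 1"
  shows "belief_perturbation \<nu>0 (nn_trans cP eP WPs) (nn_trans cP eP WP) (nn_obs cQ eQ WQs) (nn_obs cQ eQ WQ)
    (contraction \<kappa>P \<kappa>Q) (nn_cb B \<kappa>Q (norm (WQ - WQs)) \<epsilon>Q (norm (WP - WPs)) \<epsilon>P)"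
proof -
  have c_eq: "nn_cb B \<kappa>Q (norm (WQ - WQs)) \<epsilon>Q (norm (WP - WPs)) \<epsilon>P
      = (3 - 2 * \<kappa>Q) * (B / 2 * norm (WP - WPs) + \<epsilon>P) + 2 * (B / 2 * norm (WQ - WQs) + \<epsilon>Q)"
    by (simp add: nn_cb_def distrib_left)
  have kernels: "nn_trans cP eP W = (\<lambda>s a. softmax (\<lambda>s'. nn_score cP W (eP s a s')))"
    "nn_obs cQ eQ V = (\<lambda>s. softmax (\<lambda>x. nn_score cQ V (eQ s x)))" for W V
    by (simp_all add: nn_trans_def nn_obs_def fun_eq_iff)
  have dP: "\<bar>nn_score cP WP (eP s a s') - nn_score cP WPs (eP s a s')\<bar> \<le> 2 * (B / 2 * norm (WP - WPs) + \<epsilon>P)" for s a s'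
    by (rule nn_score_diff[OF tP]) (use lin dom in \<open>auto simp: linearization_ok_def\<close>)
  have dQ: "\<bar>nn_score cQ WQ (eQ s x) - nn_score cQ WQs (eQ s x)\<bar> \<le> 2 * (B / 2 * norm (WQ - WQs) + \<epsilon>Q)" for s x
    by (rule nn_score_diff[OF tQ]) (use lin dom in \<open>auto simp: linearization_ok_def\<close>)
  show ?thesis
    unfolding c_eq kernels
    by (rule softmax_belief_perturbation[OF prior dP dQ \<kappa>P[unfolded kernels] \<kappa>Q[unfolded kernels] \<kappa> \<alpha>])
qed

section \<open>Measurability over the random initialization\<close>

lemma borel_measurable_nn_score:
  fixes c :: "'v \<Rightarrow> 'm::finite \<Rightarrow> real" and W :: "'v \<Rightarrow> real^'e^'m"
  assumes [measurable]: "\<And>i. (\<lambda>v. c v i) \<in> borel_measurable Z" and W: "W \<in> borel_measurable Z"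
  shows "(\<lambda>v. nn_score (c v) (W v) x) \<in> borel_measurable Z"
proof -
  have [measurable]: "(\<lambda>v. W v $ i) \<in> borel_measurable Z" for i
    by (rule measurable_compose[OF W borel_measurable_continuous_onI]) (intro continuous_intros)
  show ?thesis unfolding nn_score_def relu_def by measurable
qed

lemma borel_measurable_softmax:
  assumes [measurable]: "\<And>y. (\<lambda>v. f v y) \<in> borel_measurable Z"
  shows "(\<lambda>v. softmax (f v) x) \<in> borel_measurable Z"
  unfolding softmax_def by measurable

lemma (in symmetric_initialization) measurable_signs:
  "(\<lambda>v. cP v i) \<in> borel_measurable M0" "(\<lambda>v. cQ v i) \<in> borel_measurable M0"
proof -
  have init: "(\<lambda>v. init_value (cP v) (cQ v) (WP0 v) (WQ0 v) j) \<in> borel_measurable M0" for j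
    using independent by (simp add: indep_vars_def)
  have L: "(\<lambda>v. cP v (Inl k)) \<in> borel_measurable M0" "(\<lambda>v. cQ v (Inl k)) \<in> borel_measurable M0" for k
    using init[of "SignP k"] init[of "SignQ k"] by simp_all
  have "cP v (Inr k) = - cP v (Inl k)" "cQ v (Inr k) = - cQ v (Inl k)" if "v \<in> space M0" for v k
    using symmetric[OF that] by (auto simp: symmetric_net_def)
  then have R: "(\<lambda>v. cP v (Inr k)) \<in> borel_measurable M0" "(\<lambda>v. cQ v (Inr k)) \<in> borel_measurable M0" for k
    using L by (simp_all cong: measurable_cong)
  show "(\<lambda>v. cP v i) \<in> borel_measurable M0" "(\<lambda>v. cQ v i) \<in> borel_measurable M0"
    using L R by (cases i; simp)+
qed

text \<open>Fubini for an event whose sections over the good initializations \<open>A\<close> have large probability. If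
  \<open>\<delta> > 1\<close> the claimed probability is negative and the empty event serves as witness.\<close>
lemma with_prob_at_least_product:
  assumes M0: "prob_space M0" and M: "prob_space M"
    and A: "A \<in> sets M0" "1 - \<delta>' \<le> measure M0 A" and \<delta>': "0 \<le> \<delta>'" and \<delta>: "0 \<le> \<delta>"
    and G: "{z \<in> space (M0 \<Otimes>\<^sub>M M). G (fst z) (snd z)} \<in> sets (M0 \<Otimes>\<^sub>M M)"
    and sect: "\<And>v. v \<in> A \<Longrightarrow> 1 - \<delta> \<le> measure M {\<omega> \<in> space M. G v \<omega>}"
    and imp: "\<And>v \<omega>. v \<in> A \<Longrightarrow> \<omega> \<in> space M \<Longrightarrow> G v \<omega> \<Longrightarrow> R v \<omega>"
  shows "with_prob_at_least (M0 \<Otimes>\<^sub>M M) (1 - (\<delta> + \<delta>')) (\<lambda>(v, \<omega>). R v \<omega>)"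
proof (cases "1 < \<delta>")
  case True
  then show ?thesis unfolding with_prob_at_least_def using \<delta>' by (intro bexI[of _ "{}"]) auto
next
  case False
  interpret M0: prob_space M0 by fact
  interpret M: prob_space M by fact
  interpret pair: pair_prob_space M0 M ..
  define E where "E = {z \<in> space (M0 \<Otimes>\<^sub>M M). G (fst z) (snd z)} \<inter> (A \<times> space M)"
  have E: "E \<in> sets (M0 \<Otimes>\<^sub>M M)" unfolding E_def using G A by (intro sets.Int pair_measureI) auto
  have sp: "v \<in> space M0" if "v \<in> A" for v using that A sets.sets_into_space by blast
  have section_eq: "Pair v -` E = (if v \<in> A then {\<omega> \<in> space M. G v \<omega>} else {})" for v
    using sp by (auto simp: E_def space_pair_measure)
  have "ennreal ((1 - \<delta>) * measure M0 A) = (\<integral>\<^sup>+v. ennreal (1 - \<delta>) * indicator A v \<partial>M0)"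
    using False A by (simp add: nn_integral_cmult_indicator M0.emeasure_eq_measure ennreal_mult)
  also have "\<dots> \<le> (\<integral>\<^sup>+v. emeasure M (Pair v -` E) \<partial>M0)"
    unfolding section_eq using sect
    by (intro nn_integral_mono) (auto simp: indicator_def M.emeasure_eq_measure intro!: ennreal_leI)
  also have "\<dots> = emeasure (M0 \<Otimes>\<^sub>M M) E" using M.emeasure_pair_measure_alt[OF E] by simp
  also have "\<dots> = ennreal (measure (M0 \<Otimes>\<^sub>M M) E)" by (rule pair.emeasure_eq_measure)
  finally have "(1 - \<delta>) * measure M0 A \<le> measure (M0 \<Otimes>\<^sub>M M) E" by simp
  moreover have "(1 - \<delta>) * (1 - \<delta>') \<le> (1 - \<delta>) * measure M0 A"
    using False A by (intro mult_left_mono) auto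
  moreover have "1 - (\<delta> + \<delta>') \<le> (1 - \<delta>) * (1 - \<delta>')" using \<delta> \<delta>' by (simp add: algebra_simps)
  ultimately have "1 - (\<delta> + \<delta>') \<le> measure (M0 \<Otimes>\<^sub>M M) E" by linarith
  moreover have "case z of (v, \<omega>) \<Rightarrow> R v \<omega>" if "z \<in> E" for z
    using that imp by (auto simp: E_def)
  ultimately show ?thesis unfolding with_prob_at_least_def using E by blast
qed

section \<open>The estimation error bound\<close>

theorem theorem5p8:
  fixes M :: "'w measure" and M0 :: "'v measure"
    and \<nu>0 :: "'s::finite \<Rightarrow> real"
    and Ptrue :: "('s, 'a::finite) trans" and Qtrue :: "('s, 'x::finite) emission"
    and \<phi>r :: "'s \<Rightarrow> 'a \<Rightarrow> real^'d" and \<mu>star :: "real^'d"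
    and T N :: nat
    and act :: "nat \<Rightarrow> nat \<Rightarrow> nat \<Rightarrow> 'a"
    and Obs :: "nat \<Rightarrow> nat \<Rightarrow> nat \<Rightarrow> 'w \<Rightarrow> 'x"
    and y :: "nat \<Rightarrow> 'w \<Rightarrow> bool"
    and Br r\<mu> \<delta>b \<delta>c c\<zeta> :: real
    \<comment> \<open>log-linear model\<close>
    and \<phi>p :: "'s \<Rightarrow> 'a \<Rightarrow> 's \<Rightarrow> real^'dp" and \<phi>q :: "'s \<Rightarrow> 'x \<Rightarrow> real^'dw"
    and B \<nu>min \<nu>max r\<Theta> :: real
    and \<theta>star \<theta> :: "real^'dp" and wstar w :: "real^'dw"
    and \<mu>_ll :: "'w \<Rightarrow> real^'d"
    \<comment> \<open>neural-softmax model\<close>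
    and eP :: "'s \<Rightarrow> 'a \<Rightarrow> 's \<Rightarrow> real^'ep" and eQ :: "'s \<Rightarrow> 'x \<Rightarrow> real^'eq"
    and cP cQ :: "'v \<Rightarrow> 'k::finite + 'k \<Rightarrow> real"
    and WP0 WPstar WP :: "'v \<Rightarrow> real^'ep^('k + 'k)"
    and WQ0 WQstar WQ :: "'v \<Rightarrow> real^'eq^('k + 'k)"
    and DP :: "'v \<Rightarrow> (real^'ep^('k + 'k)) set" and DQ :: "'v \<Rightarrow> (real^'eq^('k + 'k)) set"
    and z0 BNN \<epsilon>P \<epsilon>Q \<delta>NN :: real
    and \<mu>_nn :: "'v \<Rightarrow> 'w \<Rightarrow> real^'d"
  assumes "prob_vector \<nu>0"
    and "preference_data M \<nu>0 Ptrue Qtrue \<phi>r \<mu>star T N act Obs y"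
    and "T \<ge> 1" and "N \<ge> 1"
    and "0 < Br" and "\<And>s a. norm (\<phi>r s a) \<le> Br" and "norm \<mu>star \<le> r\<mu>"
    and "\<delta>b \<in> {0<..<1}" and "\<delta>c \<in> {0<..<1}" and "c\<zeta> > 1"
  shows
    "(let feasible = {\<Theta>. norm (\<Theta> - (\<theta>star, wstar)) \<le> r\<Theta>};
          \<kappa>P = kappa_trans (\<lambda>(\<theta>', w'). loglin_trans \<phi>p \<theta>') feasible;
          \<kappa>Q = kappa_obs (\<lambda>(\<theta>', w'). loglin_obs \<phi>q w') feasible;
          \<alpha> = contraction \<kappa>P \<kappa>Q;
          cb = loglin_cb B \<kappa>Q (norm (w - wstar)) (norm (\<theta> - \<theta>star));
          \<epsilon>b = belief_error \<alpha> cb T \<delta>b (2 * real N);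
          \<phi>t = (\<lambda>\<omega> i. feature_diff \<phi>r \<nu>0 T (loglin_trans \<phi>p \<theta>) (loglin_obs \<phi>q w)
                        (act i) (\<lambda>j k. Obs i j k \<omega>))
      in
        Ptrue = loglin_trans \<phi>p \<theta>star \<and> Qtrue = loglin_obs \<phi>q wstar \<and>
        (\<forall>s a s'. norm (\<phi>p s a s') \<le> B) \<and> (\<forall>s x. norm (\<phi>q s x) \<le> B) \<and>
        (\<forall>s. \<nu>min \<le> \<nu>0 s \<and> \<nu>0 s \<le> \<nu>max) \<and> 0 < \<nu>min \<and> \<nu>max < 1 \<and>
        0 < r\<Theta> \<and> (\<theta>, w) \<in> feasible \<and>
        \<kappa>P \<in> {0<..1} \<and> \<kappa>Q \<in> {0<..1} \<and> \<alpha> < 1 \<and>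
        (\<forall>\<omega>\<in>space M. constrained_mle r\<mu> N (\<phi>t \<omega>) (\<lambda>i. y i \<omega>) (\<mu>_ll \<omega>))
      \<longrightarrow>
        with_prob_at_least M (1 - (\<delta>b + \<delta>c)) (\<lambda>\<omega>.
          mat_norm (empirical_cov N (\<phi>t \<omega>) + mat (zeta_reg c\<zeta> T Br \<epsilon>b)) (\<mu>_ll \<omega> - \<mu>star)
          \<le> estimation_bound c\<zeta> \<delta>c CARD('d) T N Br r\<mu> \<epsilon>b))
     \<and>
     (let \<kappa>P = (\<lambda>v. kappa_trans (nn_trans (cP v) eP) (DP v));
          \<kappa>Q = (\<lambda>v. kappa_obs (nn_obs (cQ v) eQ) (DQ v));
          \<alpha> = (\<lambda>v. contraction (\<kappa>P v) (\<kappa>Q v));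
          cb = (\<lambda>v. nn_cb BNN (\<kappa>Q v) (norm (WQ v - WQstar v)) \<epsilon>Q (norm (WP v - WPstar v)) \<epsilon>P);
          \<epsilon>b = (\<lambda>v. belief_error (\<alpha> v) (cb v) T \<delta>b (2 * real N));
          \<phi>t = (\<lambda>v \<omega> i. feature_diff \<phi>r \<nu>0 T (nn_trans (cP v) eP (WP v)) (nn_obs (cQ v) eQ (WQ v))
                        (act i) (\<lambda>j k. Obs i j k \<omega>))
      in
        symmetric_initialization M0 cP cQ WP0 WQ0 \<and>
        z0 \<in> {0..1} \<and> \<delta>NN \<in> {0<..<1} \<and> 0 \<le> \<epsilon>P \<and> 0 \<le> \<epsilon>Q \<and>
        (AE v in M0.
           (\<forall>s a s'. norm (nn_tangent z0 (cP v) (WP0 v) (eP s a s')) \<le> BNN) \<and>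
           (\<forall>s x. norm (nn_tangent z0 (cQ v) (WQ0 v) (eQ s x)) \<le> BNN)) \<and>
        (AE v in M0.
           bounded (DP v) \<and> convex (DP v) \<and> WP0 v \<in> interior (DP v) \<and>
           bounded (DQ v) \<and> convex (DQ v) \<and> WQ0 v \<in> interior (DQ v) \<and>
           WPstar v \<in> DP v \<and> WQstar v \<in> DQ v \<and> WP v \<in> DP v \<and> WQ v \<in> DQ v \<and>
           nn_trans (cP v) eP (WPstar v) = Ptrue \<and> nn_obs (cQ v) eQ (WQstar v) = Qtrue \<and>
           \<alpha> v < 1) \<and>
        WPstar \<in> borel_measurable M0 \<and> WQstar \<in> borel_measurable M0 \<and>
        WP \<in> borel_measurable M0 \<and> WQ \<in> borel_measurable M0 \<and>
        \<kappa>P \<in> borel_measurable M0 \<and> \<kappa>Q \<in> borel_measurable M0 \<and>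
        with_prob_at_least M0 (1 - \<delta>NN) (\<lambda>v.
          linearization_ok z0 eP eQ \<epsilon>P \<epsilon>Q (cP v) (cQ v) (WP0 v) (WQ0 v) (DP v) (DQ v)) \<and>
        (\<forall>v\<in>space M0. \<forall>\<omega>\<in>space M.
           constrained_mle r\<mu> N (\<phi>t v \<omega>) (\<lambda>i. y i \<omega>) (\<mu>_nn v \<omega>))
      \<longrightarrow>
        with_prob_at_least (M0 \<Otimes>\<^sub>M M) (1 - (\<delta>b + \<delta>c + \<delta>NN)) (\<lambda>(v, \<omega>).
          mat_norm (empirical_cov N (\<phi>t v \<omega>) + mat (zeta_reg c\<zeta> T Br (\<epsilon>b v))) (\<mu>_nn v \<omega> - \<mu>star)
          \<le> estimation_bound c\<zeta> \<delta>c CARD('d) T N Br r\<mu> (\<epsilon>b v)))"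
proof (intro conjI, goal_cases)
  case 1
  interpret finite_preference_data M \<nu>0 Ptrue Qtrue \<phi>r \<mu>star T N act Obs y
    unfolding finite_preference_data_def by (rule assms(2))
  show ?case
  proof (unfold Let_def, intro impI, elim conjE)
    define feas where "feas = {\<Theta>. norm (\<Theta> - (\<theta>star, wstar)) \<le> r\<Theta>}"
    define \<kappa>P where "\<kappa>P = kappa_trans (\<lambda>(\<theta>', w'). loglin_trans \<phi>p \<theta>') feas"
    define \<kappa>Q where "\<kappa>Q = kappa_obs (\<lambda>(\<theta>', w'). loglin_obs \<phi>q w') feas"
    define c where "c = loglin_cb B \<kappa>Q (norm (w - wstar)) (norm (\<theta> - \<theta>star))"
    define \<epsilon> where "\<epsilon> = belief_error (contraction \<kappa>P \<kappa>Q) c T \<delta>b (2 * real N)"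
    note folds = feas_def[symmetric] \<kappa>P_def[symmetric] \<kappa>Q_def[symmetric] c_def[symmetric] \<epsilon>_def[symmetric]
    let ?\<phi>t = "\<lambda>\<omega> i. feature_diff \<phi>r \<nu>0 T (loglin_trans \<phi>p \<theta>) (loglin_obs \<phi>q w) (act i) (\<lambda>j k. Obs i j k \<omega>)"
    assume P: "Ptrue = loglin_trans \<phi>p \<theta>star" and Q: "Qtrue = loglin_obs \<phi>q wstar"
      and \<phi>p: "\<forall>s a s'. norm (\<phi>p s a s') \<le> B" and \<phi>q: "\<forall>s x. norm (\<phi>q s x) \<le> B"
      and "(\<theta>, w) \<in> {\<Theta>. norm (\<Theta> - (\<theta>star, wstar)) \<le> r\<Theta>}"
      and "contraction (kappa_trans (\<lambda>(\<theta>', w'). loglin_trans \<phi>p \<theta>') {\<Theta>. norm (\<Theta> - (\<theta>star, wstar)) \<le> r\<Theta>})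
          (kappa_obs (\<lambda>(\<theta>', w'). loglin_obs \<phi>q w') {\<Theta>. norm (\<Theta> - (\<theta>star, wstar)) \<le> r\<Theta>}) < 1"
      and mle: "\<forall>\<omega>\<in>space M. constrained_mle r\<mu> N (?\<phi>t \<omega>) (\<lambda>i. y i \<omega>) (\<mu>_ll \<omega>)"
    then have feas: "(\<theta>, w) \<in> feas" and \<alpha>: "contraction \<kappa>P \<kappa>Q < 1"
      by (simp_all only: folds)
    have \<kappa>P: "\<kappa>P \<le> (\<Sum>x\<in>UNIV. min (loglin_trans \<phi>p \<theta> s a x) (loglin_trans \<phi>p \<theta> s' a x))" "\<kappa>P \<le> 1" for s s' a
      unfolding \<kappa>P_def using kappa_trans_bounds[OF feas, of "\<lambda>(\<theta>', w'). loglin_trans \<phi>p \<theta>'"]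
      by (simp_all add: loglin_trans_def prob_vector_softmax split_beta)
    have \<kappa>Q: "\<kappa>Q \<le> (\<Sum>x\<in>UNIV. min (loglin_obs \<phi>q w s x) (loglin_obs \<phi>q w s' x))" "\<kappa>Q \<le> 1" for s s'
      unfolding \<kappa>Q_def using kappa_obs_bounds[OF feas, of "\<lambda>(\<theta>', w'). loglin_obs \<phi>q w'"]
      by (simp_all add: loglin_obs_def prob_vector_softmax split_beta)
    have pert: "belief_perturbation \<nu>0 Ptrue (loglin_trans \<phi>p \<theta>) Qtrue (loglin_obs \<phi>q w) (contraction \<kappa>P \<kappa>Q) c"
      unfolding c_def P Q
      by (rule loglin_belief_perturbation[OF assms(1) \<phi>p[rule_format] \<phi>q[rule_format] \<kappa>P(1) \<kappa>Q(1) \<kappa>P(2) \<kappa>Q(2) \<alpha>])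
    have \<epsilon>: "0 < \<epsilon>"
      unfolding \<epsilon>_def by (rule belief_perturbation.belief_error_pos[OF pert]) (use assms in auto)
    define l where "l = real N * zeta_reg c\<zeta> T Br \<epsilon>"
    have l: "0 < l" unfolding l_def using zeta_reg_pos[OF assms(3,5,10) \<epsilon>] assms(4) by simp
    define G where "G = {\<omega> \<in> space M. good_event (loglin_trans \<phi>p \<theta>) (loglin_obs \<phi>q w) \<epsilon> l \<delta>c \<omega>}"
    have "G \<in> sets M"
      unfolding G_def by (rule good_event_measurable[of "\<lambda>\<omega>. \<omega>"]) auto
    moreover have "1 - (\<delta>b + \<delta>c) \<le> measure M G"
      unfolding G_def by (rule prob_good_event[OF pert _ _ _ _ _ l \<epsilon>_def]) (use assms in auto)
    moreover have "mat_norm (empirical_cov N (?\<phi>t \<omega>) + mat (zeta_reg c\<zeta> T Br \<epsilon>)) (\<mu>_ll \<omega> - \<mu>star)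
          \<le> estimation_bound c\<zeta> \<delta>c CARD('d) T N Br r\<mu> \<epsilon>" if "\<omega> \<in> G" for \<omega>
      by (rule good_event_imp_bound[OF belief_perturbation.regular[OF pert]
              belief_perturbation.regular'[OF pert] assms(1,3,4,5,6,7) _ _ assms(10) \<epsilon>])
         (use that mle assms in \<open>auto simp: G_def l_def\<close>)
    ultimately have "with_prob_at_least M (1 - (\<delta>b + \<delta>c)) (\<lambda>\<omega>.
          mat_norm (empirical_cov N (?\<phi>t \<omega>) + mat (zeta_reg c\<zeta> T Br \<epsilon>)) (\<mu>_ll \<omega> - \<mu>star)
          \<le> estimation_bound c\<zeta> \<delta>c CARD('d) T N Br r\<mu> \<epsilon>)"
      unfolding with_prob_at_least_def by blast
    then show "with_prob_at_least M (1 - (\<delta>b + \<delta>c)) (\<lambda>\<omega>.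
          mat_norm (empirical_cov N (?\<phi>t \<omega>) + mat (zeta_reg c\<zeta> T Br (belief_error
            (contraction (kappa_trans (\<lambda>(\<theta>', w'). loglin_trans \<phi>p \<theta>') {\<Theta>. norm (\<Theta> - (\<theta>star, wstar)) \<le> r\<Theta>})
              (kappa_obs (\<lambda>(\<theta>', w'). loglin_obs \<phi>q w') {\<Theta>. norm (\<Theta> - (\<theta>star, wstar)) \<le> r\<Theta>}))
            (loglin_cb B (kappa_obs (\<lambda>(\<theta>', w'). loglin_obs \<phi>q w') {\<Theta>. norm (\<Theta> - (\<theta>star, wstar)) \<le> r\<Theta>})
              (norm (w - wstar)) (norm (\<theta> - \<theta>star))) T \<delta>b (2 * real N)))) (\<mu>_ll \<omega> - \<mu>star)
          \<le> estimation_bound c\<zeta> \<delta>c CARD('d) T N Br r\<mu> (belief_error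
            (contraction (kappa_trans (\<lambda>(\<theta>', w'). loglin_trans \<phi>p \<theta>') {\<Theta>. norm (\<Theta> - (\<theta>star, wstar)) \<le> r\<Theta>})
              (kappa_obs (\<lambda>(\<theta>', w'). loglin_obs \<phi>q w') {\<Theta>. norm (\<Theta> - (\<theta>star, wstar)) \<le> r\<Theta>}))
            (loglin_cb B (kappa_obs (\<lambda>(\<theta>', w'). loglin_obs \<phi>q w') {\<Theta>. norm (\<Theta> - (\<theta>star, wstar)) \<le> r\<Theta>})
              (norm (w - wstar)) (norm (\<theta> - \<theta>star))) T \<delta>b (2 * real N)))"
      by (simp only: folds)
  qed
next
  case 2
  interpret finite_preference_data M \<nu>0 Ptrue Qtrue \<phi>r \<mu>star T N act Obs y
    unfolding finite_preference_data_def by (rule assms(2))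
  show ?case
  proof (unfold Let_def, intro impI, elim conjE)
    define \<kappa>P where "\<kappa>P v = kappa_trans (nn_trans (cP v) eP) (DP v)" for v
    define \<kappa>Q where "\<kappa>Q v = kappa_obs (nn_obs (cQ v) eQ) (DQ v)" for v
    define c where "c v = nn_cb BNN (\<kappa>Q v) (norm (WQ v - WQstar v)) \<epsilon>Q (norm (WP v - WPstar v)) \<epsilon>P" for v
    define \<epsilon> where "\<epsilon> v = belief_error (contraction (\<kappa>P v) (\<kappa>Q v)) (c v) T \<delta>b (2 * real N)" for v
    let ?P' = "\<lambda>v. nn_trans (cP v) eP (WP v)" and ?Q' = "\<lambda>v. nn_obs (cQ v) eQ (WQ v)"
    let ?\<phi>t = "\<lambda>v \<omega> i. feature_diff \<phi>r \<nu>0 T (?P' v) (?Q' v) (act i) (\<lambda>j k. Obs i j k \<omega>)"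
    assume init: "symmetric_initialization M0 cP cQ WP0 WQ0" and \<delta>NN: "\<delta>NN \<in> {0<..<1}"
      and AE_tangent: "AE v in M0.
           (\<forall>s a s'. norm (nn_tangent z0 (cP v) (WP0 v) (eP s a s')) \<le> BNN) \<and>
           (\<forall>s x. norm (nn_tangent z0 (cQ v) (WQ0 v) (eQ s x)) \<le> BNN)"
      and AE_domain: "AE v in M0.
           bounded (DP v) \<and> convex (DP v) \<and> WP0 v \<in> interior (DP v) \<and>
           bounded (DQ v) \<and> convex (DQ v) \<and> WQ0 v \<in> interior (DQ v) \<and>
           WPstar v \<in> DP v \<and> WQstar v \<in> DQ v \<and> WP v \<in> DP v \<and> WQ v \<in> DQ v \<and>
           nn_trans (cP v) eP (WPstar v) = Ptrue \<and> nn_obs (cQ v) eQ (WQstar v) = Qtrue \<and>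
           contraction (kappa_trans (nn_trans (cP v) eP) (DP v)) (kappa_obs (nn_obs (cQ v) eQ) (DQ v)) < 1"
      and [measurable]: "WPstar \<in> borel_measurable M0" "WQstar \<in> borel_measurable M0"
        "WP \<in> borel_measurable M0" "WQ \<in> borel_measurable M0"
      and meas_\<kappa>: "(\<lambda>v. kappa_trans (nn_trans (cP v) eP) (DP v)) \<in> borel_measurable M0"
        "(\<lambda>v. kappa_obs (nn_obs (cQ v) eQ) (DQ v)) \<in> borel_measurable M0"
      and lin: "with_prob_at_least M0 (1 - \<delta>NN) (\<lambda>v.
          linearization_ok z0 eP eQ \<epsilon>P \<epsilon>Q (cP v) (cQ v) (WP0 v) (WQ0 v) (DP v) (DQ v))"
      and mle: "\<forall>v\<in>space M0. \<forall>\<omega>\<in>space M.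
           constrained_mle r\<mu> N (?\<phi>t v \<omega>) (\<lambda>i. y i \<omega>) (\<mu>_nn v \<omega>)"
    interpret init: symmetric_initialization M0 cP cQ WP0 WQ0 by (rule init)
    have [measurable]: "\<kappa>P \<in> borel_measurable M0" "\<kappa>Q \<in> borel_measurable M0"
      using meas_\<kappa> by (simp_all add: \<kappa>P_def[abs_def] \<kappa>Q_def[abs_def])
    have \<epsilon>_meas [measurable]: "\<epsilon> \<in> borel_measurable M0"
      unfolding \<epsilon>_def[abs_def] c_def belief_error_def contraction_def nn_cb_def by measurable
    have P'_meas: "(\<lambda>v. ?P' v s a s') \<in> borel_measurable M0" for s a s'
      unfolding nn_trans_def
      by (intro borel_measurable_softmax borel_measurable_nn_score init.measurable_signs) measurable
    have Q'_meas: "(\<lambda>v. ?Q' v s x) \<in> borel_measurable M0" for s x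
      unfolding nn_obs_def
      by (intro borel_measurable_softmax borel_measurable_nn_score init.measurable_signs) measurable
    obtain A0 where A0: "A0 \<in> sets M0" "1 - \<delta>NN \<le> measure M0 A0"
      and A0_lin: "\<And>v. v \<in> A0 \<Longrightarrow> linearization_ok z0 eP eQ \<epsilon>P \<epsilon>Q (cP v) (cQ v) (WP0 v) (WQ0 v) (DP v) (DQ v)"
      using lin unfolding with_prob_at_least_def by blast
    \<comment> \<open>The almost sure properties hold off a null set, which is removed from the linearization event.\<close>
    define ok where "ok v \<longleftrightarrow>
           (\<forall>s a s'. norm (nn_tangent z0 (cP v) (WP0 v) (eP s a s')) \<le> BNN) \<and>
           (\<forall>s x. norm (nn_tangent z0 (cQ v) (WQ0 v) (eQ s x)) \<le> BNN) \<and>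
           WPstar v \<in> DP v \<and> WQstar v \<in> DQ v \<and> WP v \<in> DP v \<and> WQ v \<in> DQ v \<and>
           nn_trans (cP v) eP (WPstar v) = Ptrue \<and> nn_obs (cQ v) eQ (WQstar v) = Qtrue \<and>
           contraction (\<kappa>P v) (\<kappa>Q v) < 1" for v
    have "AE v in M0. ok v"
      using AE_tangent AE_domain by eventually_elim (simp add: ok_def \<kappa>P_def \<kappa>Q_def)
    from AE_E[OF this] obtain Z where Z_ok: "{v \<in> space M0. \<not> ok v} \<subseteq> Z"
      and Z: "emeasure M0 Z = 0" "Z \<in> sets M0" .
    then have Z: "Z \<in> null_sets M0" by auto
    define A where "A = A0 - Z"
    have A: "A \<in> sets M0" using A0 Z by (auto simp: A_def)
    have A_prob: "1 - \<delta>NN \<le> measure M0 A"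
      unfolding A_def using A0 measure_Diff_null_set[OF A0(1) Z] by simp
    have A_space: "v \<in> space M0" if "v \<in> A" for v using that A sets.sets_into_space by blast
    have pert: "belief_perturbation \<nu>0 Ptrue (?P' v) Qtrue (?Q' v) (contraction (\<kappa>P v) (\<kappa>Q v)) (c v)"
      if v: "v \<in> A" for v
    proof -
      have ok: "ok v" using Z_ok v A_space[OF v] by (auto simp: A_def)
      have dom: "WPstar v \<in> DP v" "WQstar v \<in> DQ v" "WP v \<in> DP v" "WQ v \<in> DQ v"
        and P: "Ptrue = nn_trans (cP v) eP (WPstar v)" and Q: "Qtrue = nn_obs (cQ v) eQ (WQstar v)"
        and \<alpha>: "contraction (\<kappa>P v) (\<kappa>Q v) < 1"
        and tangent: "\<And>s a s'. norm (nn_tangent z0 (cP v) (WP0 v) (eP s a s')) \<le> BNN"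
          "\<And>s x. norm (nn_tangent z0 (cQ v) (WQ0 v) (eQ s x)) \<le> BNN"
        using ok unfolding ok_def by blast+
      have lin: "linearization_ok z0 eP eQ \<epsilon>P \<epsilon>Q (cP v) (cQ v) (WP0 v) (WQ0 v) (DP v) (DQ v)"
        using A0_lin v by (simp add: A_def)
      have \<kappa>P: "\<kappa>P v \<le> (\<Sum>x\<in>UNIV. min (?P' v s a x) (?P' v s' a x))" "\<kappa>P v \<le> 1" for s s' a
        unfolding \<kappa>P_def using kappa_trans_bounds[OF dom(3), of "nn_trans (cP v) eP"]
        by (simp_all add: nn_trans_def prob_vector_softmax)
      have \<kappa>Q: "\<kappa>Q v \<le> (\<Sum>x\<in>UNIV. min (?Q' v s x) (?Q' v s' x))" "\<kappa>Q v \<le> 1" for s s'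
        unfolding \<kappa>Q_def using kappa_obs_bounds[OF dom(4), of "nn_obs (cQ v) eQ"]
        by (simp_all add: nn_obs_def prob_vector_softmax)
      show ?thesis
        unfolding c_def P Q
        by (rule nn_belief_perturbation[OF assms(1) tangent lin dom \<kappa>P(1) \<kappa>Q(1) \<kappa>P(2) \<kappa>Q(2) \<alpha>])
    qed
    have \<epsilon>: "0 < \<epsilon> v" if "v \<in> A" for v
      unfolding \<epsilon>_def by (rule belief_perturbation.belief_error_pos[OF pert[OF that]]) (use assms in auto)
    define l where "l v = real N * zeta_reg c\<zeta> T Br (\<epsilon> v)" for v
    have [measurable]: "l \<in> borel_measurable M0"
      unfolding l_def[abs_def] zeta_reg_def by measurable
    have l: "0 < l v" if "v \<in> A" for v
      unfolding l_def using zeta_reg_pos[OF assms(3,5,10) \<epsilon>[OF that]] assms(4) by simp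
    define G where "G v = good_event (?P' v) (?Q' v) (\<epsilon> v) (l v) \<delta>c" for v
    have "with_prob_at_least (M0 \<Otimes>\<^sub>M M) (1 - ((\<delta>b + \<delta>c) + \<delta>NN)) (\<lambda>(v, \<omega>).
          mat_norm (empirical_cov N (?\<phi>t v \<omega>) + mat (zeta_reg c\<zeta> T Br (\<epsilon> v))) (\<mu>_nn v \<omega> - \<mu>star)
          \<le> estimation_bound c\<zeta> \<delta>c CARD('d) T N Br r\<mu> (\<epsilon> v))"
    proof (rule with_prob_at_least_product[OF init.prob_space_axioms prob_space_axioms A A_prob, where G = G])
      show "{z \<in> space (M0 \<Otimes>\<^sub>M M). G (fst z) (snd z)} \<in> sets (M0 \<Otimes>\<^sub>M M)"
        unfolding G_def
        by (rule good_event_measurable[of snd _ "\<lambda>z. ?P' (fst z)" "\<lambda>z. ?Q' (fst z)" "\<lambda>z. \<epsilon> (fst z)" "\<lambda>z. l (fst z)"])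
           (auto intro: measurable_compose[OF measurable_fst P'_meas] measurable_compose[OF measurable_fst Q'_meas])
      show "1 - (\<delta>b + \<delta>c) \<le> prob {\<omega> \<in> space M. G v \<omega>}" if "v \<in> A" for v
        unfolding G_def by (rule prob_good_event[OF pert[OF that] _ _ _ _ _ l[OF that] \<epsilon>_def]) (use assms in auto)
      show "mat_norm (empirical_cov N (?\<phi>t v \<omega>) + mat (zeta_reg c\<zeta> T Br (\<epsilon> v))) (\<mu>_nn v \<omega> - \<mu>star)
          \<le> estimation_bound c\<zeta> \<delta>c CARD('d) T N Br r\<mu> (\<epsilon> v)"
        if v: "v \<in> A" and \<omega>: "\<omega> \<in> space M" and G: "G v \<omega>" for v \<omega>
        by (rule good_event_imp_bound[OF belief_perturbation.regular[OF pert[OF v]]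
              belief_perturbation.regular'[OF pert[OF v]] assms(1,3,4,5,6,7) _ _ assms(10) \<epsilon>[OF v]])
           (use G mle A_space[OF v] \<omega> assms in \<open>auto simp: G_def l_def\<close>)
    qed (use assms \<delta>NN in auto)
    then show "with_prob_at_least (M0 \<Otimes>\<^sub>M M) (1 - (\<delta>b + \<delta>c + \<delta>NN)) (\<lambda>(v, \<omega>).
          mat_norm (empirical_cov N (?\<phi>t v \<omega>) + mat (zeta_reg c\<zeta> T Br
            (belief_error (contraction (kappa_trans (nn_trans (cP v) eP) (DP v)) (kappa_obs (nn_obs (cQ v) eQ) (DQ v)))
              (nn_cb BNN (kappa_obs (nn_obs (cQ v) eQ) (DQ v)) (norm (WQ v - WQstar v)) \<epsilon>Q (norm (WP v - WPstar v)) \<epsilon>P)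
              T \<delta>b (2 * real N)))) (\<mu>_nn v \<omega> - \<mu>star)
          \<le> estimation_bound c\<zeta> \<delta>c CARD('d) T N Br r\<mu>
            (belief_error (contraction (kappa_trans (nn_trans (cP v) eP) (DP v)) (kappa_obs (nn_obs (cQ v) eQ) (DQ v)))
              (nn_cb BNN (kappa_obs (nn_obs (cQ v) eQ) (DQ v)) (norm (WQ v - WQstar v)) \<epsilon>Q (norm (WP v - WPstar v)) \<epsilon>P)
              T \<delta>b (2 * real N)))"
      unfolding \<epsilon>_def c_def \<kappa>P_def \<kappa>Q_def .
  qed
qed

end
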